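(* The map $\psi:\mathfrak m\mathrm{MR}\to\prod_\alpha\mathbb Z\tilde L_\alpha$ given by $w\mapsto\tilde L_{\mathcal C(w)}$ (extended linearly and continuously) is a bialgebra morphism, identifying $\prod_\alpha\mathbb Z\tilde L_\alpha$ with the quotient $\mathfrak m\mathrm{QSym}=\mathfrak m\mathrm{MR}/I$.
   Context: Source bialgebra. An $\mathfrak m$-permutation of $[n]$ is a word in $1,\dots,n$ using every letter of $[n]$, with no two consecutive letters equal; $S^{\mathfrak m}_n$ is the set of these, $S^{\mathfrak m}_0=\{\emptyset\}$, $S^{\mathfrak m}_\infty=\bigcup_n S^{\mathfrak m}_n$, and $\ell(w)$ is the number of letters. $\mathfrak m\mathrm{MR}=\prod_{w\in S^{\mathfrak m}_\infty}\mathbb Z w$ (arbitrary, possibly infinite, linear combinations; all maps are extended by linearity and continuity, i.e. respecting infinite combinations, and tensor products are completed accordingly). A word $w_1\cdots w_m$ is a multiword of $u=u_1\cdots u_k$ if $w_j=u_{t(j)}$ for a surjective non-decreasing $t:[m]\to[k]$. For words $u,v$ with all letters distinct, $u\star v$ is the sum of all words in the letters of $u,v$ with no two consecutive letters equal, whose restrictions to the letters of $u$ and of $v$ are multiwords of $u$ and $v$; for words with repeated letters, $\star$ is defined by substitution of letters from the distinct-letter case. Product: for $w\in S^{\mathfrak m}_n$, $u=u_1\cdots u_l\in S^{\mathfrak m}_m$, $w*u=w\star(u_1+n)\cdots(u_l+n)$. Coproduct: $\Delta(w)=\mathrm{st}(\blacktriangle w)$, where $\blacktriangle(a_1\cdots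 a_n)=\sum_{i=0}^n a_1\cdots a_i\otimes a_{i+1}\cdots a_n+\sum_{i=1}^n a_1\cdots a_i\otimes a_i\cdots a_n$ and $\mathrm{st}(w)$ is the unique $\mathfrak m$-permutation of the same length with the same relative order of letters ($w_i\le w_j\iff \mathrm{st}(w)_i\le \mathrm{st}(w)_j$). Unit $n\mapsto n\emptyset$, counit the coefficient of $\emptyset$. Descents. $\mathrm{Des}(w)=\{i\in[\ell(w)-1]:w_i>w_{i+1}\}$, always viewed as a subset of $[\ell(w)-1]$ (so descent sets of words of different lengths are never equal). For a composition $\alpha=(\alpha_1,\dots,\alpha_k)$ of $m$, $D(\alpha)=\{\alpha_1,\alpha_1+\alpha_2,\dots,\alpha_1+\cdots+\alpha_{k-1}\}\subset[m-1]$; $\mathcal C$ is the inverse bijection, and $\mathcal C(w)=\mathcal C(\mathrm{Des}(w))$, a composition of $\ell(w)$. $I\subset\mathfrak m\mathrm{MR}$ is the (continuous) span of the elements $w-u$ with $\mathrm{Des}(w)=\mathrm{Des}(u)$; it is a biideal, and $\mathfrak m\mathrm{QSym}=\mathfrak m\mathrm{MR}/I$. Target. For a composition $\alpha$ of $m$, choose $w\in S_m$ with $\mathcal C(w)=\alpha$; $\tilde L_\alpha\in\mathbb Z[[x_1,x_2,\dots]]$ is the sum, over all sequences $(\sigma_1,\dots,\sigma_m)$ of nonempty finite sets of positive integers with $\max\sigma_i\le\min\sigma_{i+1}$ if $w_i<w_{i+1}$ and $\max\sigma_i<\min\sigma_{i+1}$ if $w_i>w_{i+1}$, of $\prod_{i=1}^m\prod_{r\in\sigma_i}x_r$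 (with $\tilde L_\emptyset=1$). $\prod_\alpha\mathbb Z\tilde L_\alpha$ (over all compositions $\alpha$, including the empty one) is the space of arbitrary linear combinations of the $\tilde L_\alpha$, with the product of power series and the coproduct $f(x)\mapsto f(x,y)$, where $f(x,y)$ is $f$ evaluated on the ordered variables $x_1<x_2<\cdots<y_1<y_2<\cdots$, viewed in the completed tensor square; the unit is $1$ and the counit is the constant term. *)

theory Defs
  imports
    "HOL-Combinatorics.Multiset_Permutations"
    "HOL-Library.Function_Algebras"
    "HOL-Library.Poly_Mapping"
begin

section \<open>Infinite linear combinations\<close>

text \<open>
  An element of a product of copies of the integers indexed by \<^term>\<open>b :: 'b\<close> is a function
  \<^typ>\<open>'b \<Rightarrow> int\<close>, and the completed tensor product of two such products consists of functions on
  pairs of indices. \<open>lincomb A c F\<close> is the possibly infinite combination of the vectors \<open>F a\<close>,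
  \<open>a \<in> A\<close>, with coefficients \<open>c a\<close>; it converges if each coordinate receives only finitely many
  nonzero contributions, which holds for all \<open>c\<close> if the family is locally finite.
  If basis vectors indexed by \<open>A\<close> are sent to \<open>F a\<close>, the linear and continuous
  extension of this map is \<open>\<lambda>f. lincomb A f F\<close>.
\<close>

definition locally_finite :: "'i set \<Rightarrow> ('i \<Rightarrow> 'b \<Rightarrow> int) \<Rightarrow> bool" where
  "locally_finite A F \<longleftrightarrow> (\<forall>b. finite {a \<in> A. F a b \<noteq> 0})"

definition lincomb :: "'i set \<Rightarrow> ('i \<Rightarrow> int) \<Rightarrow> ('i \<Rightarrow> 'b \<Rightarrow> int) \<Rightarrow> 'b \<Rightarrow> int" where
  "lincomb A c F = (\<lambda>b. \<Sum>a\<in>{a \<in> A. c a * F a b \<noteq> 0}. c a * F a b)"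

definition cspan :: "'i set \<Rightarrow> ('i \<Rightarrow> 'b \<Rightarrow> int) \<Rightarrow> ('b \<Rightarrow> int) set" where
  "cspan A F = {lincomb A c F | c. \<forall>b. finite {a \<in> A. c a * F a b \<noteq> 0}}"

definition delta :: "'b \<Rightarrow> 'b \<Rightarrow> int" where
  "delta a = (\<lambda>b. of_bool (b = a))"

definition tensor :: "('a \<Rightarrow> int) \<Rightarrow> ('b \<Rightarrow> int) \<Rightarrow> 'a \<times> 'b \<Rightarrow> int" where
  "tensor f g = (\<lambda>(a, b). f a * g b)"


section \<open>Bialgebra operations, morphisms and quotients\<close>

text \<open>
  The integers are the ground ring. The completed tensor square of \<open>carr\<close> is part of the data,
  together with the map \<open>tens\<close> sending \<open>x\<close>, \<open>y\<close> to \<open>x \<otimes> y\<close>.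
\<close>

record ('a, 't) bialg =
  carr :: "'a set"
  tcarr :: "'t set"
  add :: "'a \<Rightarrow> 'a \<Rightarrow> 'a"
  tadd :: "'t \<Rightarrow> 't \<Rightarrow> 't"
  tens :: "'a \<Rightarrow> 'a \<Rightarrow> 't"
  mul :: "'a \<Rightarrow> 'a \<Rightarrow> 'a"
  unt :: "int \<Rightarrow> 'a"
  cop :: "'a \<Rightarrow> 't"
  cou :: "'a \<Rightarrow> int"

definition bialg_closed :: "('a, 't) bialg \<Rightarrow> bool" where
  "bialg_closed A \<longleftrightarrow>
     (\<forall>x\<in>carr A. \<forall>y\<in>carr A.
        add A x y \<in> carr A \<and> mul A x y \<in> carr A \<and> tens A x y \<in> tcarr A) \<and>
     (\<forall>s\<in>tcarr A. \<forall>t\<in>tcarr A. tadd A s t \<in> tcarr A) \<and>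
     (\<forall>n. unt A n \<in> carr A) \<and>
     (\<forall>x\<in>carr A. cop A x \<in> tcarr A)"

text \<open>
  Here \<open>\<phi>2\<close> plays the role of \<open>\<phi> \<otimes> \<phi>\<close> on the completed tensor squares.
\<close>

definition bialg_hom ::
  "('a, 's) bialg \<Rightarrow> ('b, 't) bialg \<Rightarrow> ('a \<Rightarrow> 'b) \<Rightarrow> ('s \<Rightarrow> 't) \<Rightarrow> bool" where
  "bialg_hom A B \<phi> \<phi>2 \<longleftrightarrow>
     \<phi> \<in> carr A \<rightarrow> carr B \<and>
     \<phi>2 \<in> tcarr A \<rightarrow> tcarr B \<and>
     (\<forall>x\<in>carr A. \<forall>y\<in>carr A. \<phi> (add A x y) = add B (\<phi> x) (\<phi> y)) \<and>
     (\<forall>s\<in>tcarr A. \<forall>t\<in>tcarr A. \<phi>2 (tadd A s t) = tadd B (\<phi>2 s) (\<phi>2 t)) \<and>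
     (\<forall>x\<in>carr A. \<forall>y\<in>carr A. \<phi>2 (tens A x y) = tens B (\<phi> x) (\<phi> y)) \<and>
     (\<forall>x\<in>carr A. \<forall>y\<in>carr A. \<phi> (mul A x y) = mul B (\<phi> x) (\<phi> y)) \<and>
     (\<forall>n. \<phi> (unt A n) = unt B n) \<and>
     (\<forall>x\<in>carr A. \<phi>2 (cop A x) = cop B (\<phi> x)) \<and>
     (\<forall>x\<in>carr A. cou A x = cou B (\<phi> x))"

definition bialg_iso ::
  "('a, 's) bialg \<Rightarrow> ('b, 't) bialg \<Rightarrow> ('a \<Rightarrow> 'b) \<Rightarrow> ('s \<Rightarrow> 't) \<Rightarrow> bool" where
  "bialg_iso A B \<phi> \<phi>2 \<longleftrightarrow>
     bialg_hom A B \<phi> \<phi>2 \<and>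
     bij_betw \<phi> (carr A) (carr B) \<and> bij_betw \<phi>2 (tcarr A) (tcarr B)"

definition congruence :: "'a::minus set \<Rightarrow> 'a set \<Rightarrow> ('a \<times> 'a) set" where
  "congruence S I = {(x, y). x \<in> S \<and> y \<in> S \<and> x - y \<in> I}"

text \<open>
  The quotient by an equivalence relation \<open>r\<close> on the carrier and \<open>r2\<close> on the completed tensor
  square; all operations are computed on representatives.
\<close>

definition quot_bialg ::
  "('a, 't) bialg \<Rightarrow> ('a \<times> 'a) set \<Rightarrow> ('t \<times> 't) set \<Rightarrow> ('a set, 't set) bialg" where
  "quot_bialg A r r2 =
     \<lparr>carr = carr A // r,
      tcarr = tcarr A // r2,
      add = (\<lambda>X Y. \<Union>x\<in>X. \<Union>y\<in>Y. r `` {add A x y}),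
      tadd = (\<lambda>S T. \<Union>s\<in>S. \<Union>t\<in>T. r2 `` {tadd A s t}),
      tens = (\<lambda>X Y. \<Union>x\<in>X. \<Union>y\<in>Y. r2 `` {tens A x y}),
      mul = (\<lambda>X Y. \<Union>x\<in>X. \<Union>y\<in>Y. r `` {mul A x y}),
      unt = (\<lambda>n. r `` {unt A n}),
      cop = (\<lambda>X. \<Union>x\<in>X. r2 `` {cop A x}),
      cou = (\<lambda>X. the_elem (cou A ` X))\<rparr>"


section \<open>The bialgebra mMR\<close>

definition mperm :: "nat \<Rightarrow> nat list \<Rightarrow> bool" where
  "mperm n w \<longleftrightarrow> set w = {1..n} \<and> distinct_adj w"

definition mperms :: "nat list set" where
  "mperms = {w. \<exists>n. mperm n w}"

definition multiword :: "'a list \<Rightarrow> 'a list \<Rightarrow> bool" where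
  "multiword w u \<longleftrightarrow>
     (\<exists>t. mono_on {..<length w} t \<and> t ` {..<length w} = {..<length u} \<and>
          (\<forall>j<length w. w ! j = u ! t j))"

text \<open>The words occurring in \<open>u \<star> v\<close> when all letters of \<open>u\<close> and \<open>v\<close> are distinct.\<close>

definition star_distinct :: "'a list \<Rightarrow> 'a list \<Rightarrow> 'a list set" where
  "star_distinct u v =
     {z. set z \<subseteq> set u \<union> set v \<and> distinct_adj z \<and>
         multiword (filter (\<lambda>a. a \<in> set u) z) u \<and>
         multiword (filter (\<lambda>a. a \<in> set v) z) v}"

text \<open>
  For arbitrary words, the letters \<open>u ! i\<close> and \<open>v ! j\<close> are substituted for distinct
  letters \<open>Inl i\<close> and \<open>Inr j\<close>; \<open>star u v x\<close> is the multiplicity of the word \<open>x\<close>.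
\<close>

definition star :: "'a list \<Rightarrow> 'a list \<Rightarrow> 'a list \<Rightarrow> int" where
  "star u v = (\<lambda>x. int (card
     {z \<in> star_distinct (map Inl [0..<length u]) (map Inr [0..<length v]).
        map (case_sum (\<lambda>i. u ! i) (\<lambda>j. v ! j)) z = x}))"

text \<open>A word \<open>w\<close> with \<open>mperm n w\<close> has \<open>n = card (set w)\<close>.\<close>

definition mMR_mul_word :: "nat list \<times> nat list \<Rightarrow> nat list \<Rightarrow> int" where
  "mMR_mul_word = (\<lambda>(w, u). star w (map (\<lambda>a. a + card (set w)) u))"

definition st :: "nat list \<Rightarrow> nat list" where
  "st w = (THE v. v \<in> mperms \<and> length v = length w \<and>
     (\<forall>i<length w. \<forall>j<length w. w ! i \<le> w ! j \<longleftrightarrow> v ! i \<le> v ! j))"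

definition mMR_cop_word :: "nat list \<Rightarrow> nat list \<times> nat list \<Rightarrow> int" where
  "mMR_cop_word w =
     (\<lambda>p. (\<Sum>i=0..length w. delta (st (take i w), st (drop i w)) p) +
          (\<Sum>i=1..length w. delta (st (take i w), st (drop (i - 1) w)) p))"

definition mMR :: "(nat list \<Rightarrow> int, nat list \<times> nat list \<Rightarrow> int) bialg" where
  "mMR =
     \<lparr>carr = {f. \<forall>w. w \<notin> mperms \<longrightarrow> f w = 0},
      tcarr = {f. \<forall>p. p \<notin> mperms \<times> mperms \<longrightarrow> f p = 0},
      add = (+),
      tadd = (+),
      tens = tensor,
      mul = (\<lambda>f g. lincomb (mperms \<times> mperms) (tensor f g) mMR_mul_word),
      unt = (\<lambda>n w. n * delta [] w),
      cop = (\<lambda>f. lincomb mperms f mMR_cop_word),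
      cou = (\<lambda>f. f [])\<rparr>"


section \<open>Descents and the quotient mQSym\<close>

definition Des :: "nat list \<Rightarrow> nat set" where
  "Des w = {i \<in> {1..<length w}. w ! (i - 1) > w ! i}"

definition compositions_of :: "nat \<Rightarrow> nat list set" where
  "compositions_of m = {\<alpha>. 0 \<notin> set \<alpha> \<and> sum_list \<alpha> = m}"

definition compositions :: "nat list set" where
  "compositions = (\<Union>m. compositions_of m)"

definition Dset :: "nat list \<Rightarrow> nat set" where
  "Dset \<alpha> = (\<lambda>k. sum_list (take k \<alpha>)) ` {1..<length \<alpha>}"

text \<open>The composition \<open>\<C>(w)\<close> of \<open>length w\<close>.\<close>

definition comp_of_word :: "nat list \<Rightarrow> nat list" where
  "comp_of_word w = the_inv_into (compositions_of (length w)) Dset (Des w)"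

text \<open>
  Descent sets are regarded as subsets of \<open>[length w - 1]\<close>, so the length is part of the data.
\<close>

definition same_Des :: "(nat list \<times> nat list) set" where
  "same_Des = {(w, u). w \<in> mperms \<and> u \<in> mperms \<and> length w = length u \<and> Des w = Des u}"

definition I_ideal :: "(nat list \<Rightarrow> int) set" where
  "I_ideal = cspan same_Des (\<lambda>(w, u). delta w - delta u)"

text \<open>
  The completion of \<open>I \<otimes> mMR + mMR \<otimes> I\<close>, by which the completed tensor square
  of mMR is divided to obtain the completed tensor square of mMR/I.
\<close>

definition I_tensor :: "(nat list \<times> nat list \<Rightarrow> int) set" where
  "I_tensor =
     {S + T | S T.
        S \<in> cspan (same_Des \<times> mperms) (\<lambda>((w, u), v). tensor (delta w - delta u) (delta v)) \<and>
        T \<in> cspan (mperms \<times> same_Des) (\<lambda>(v, (w, u)). tensor (delta v) (delta w - delta u))}"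

definition I_rel :: "((nat list \<Rightarrow> int) \<times> (nat list \<Rightarrow> int)) set" where
  "I_rel = congruence (carr mMR) I_ideal"

definition I_trel :: "((nat list \<times> nat list \<Rightarrow> int) \<times> (nat list \<times> nat list \<Rightarrow> int)) set" where
  "I_trel = congruence (tcarr mMR) I_tensor"

definition mQSym :: "((nat list \<Rightarrow> int) set, (nat list \<times> nat list \<Rightarrow> int) set) bialg" where
  "mQSym = quot_bialg mMR I_rel I_trel"


section \<open>The multi-fundamental power series\<close>

text \<open>
  A power series in \<open>x\<^sub>1, x\<^sub>2, \<dots>\<close> is the function sending each monomial, given by its finitely
  supported exponent function, to its coefficient. There is no variable \<open>x\<^sub>0\<close>: coefficients of
  monomials with \<open>0\<close> in their support vanish.
\<close>

type_synonym monomial = "nat \<Rightarrow>\<^sub>0 nat"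
type_synonym series = "monomial \<Rightarrow> int"

definition perm_of_comp :: "nat list \<Rightarrow> nat list" where
  "perm_of_comp \<alpha> = (SOME w. w \<in> permutations_of_set {1..sum_list \<alpha>} \<and> comp_of_word w = \<alpha>)"

definition set_monomial :: "nat set list \<Rightarrow> monomial" where
  "set_monomial \<sigma> = (\<Sum>s\<leftarrow>\<sigma>. \<Sum>r\<in>s. Poly_Mapping.single r 1)"

definition set_sequences :: "nat list \<Rightarrow> nat set list set" where
  "set_sequences w =
     {\<sigma>. length \<sigma> = length w \<and>
         (\<forall>s\<in>set \<sigma>. finite s \<and> s \<noteq> {} \<and> s \<subseteq> {1..}) \<and>
         (\<forall>i. Suc i < length w \<longrightarrow>
            (w ! i < w ! Suc i \<longrightarrow> Max (\<sigma> ! i) \<le> Min (\<sigma> ! Suc i)) \<and>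
            (w ! i > w ! Suc i \<longrightarrow> Max (\<sigma> ! i) < Min (\<sigma> ! Suc i)))}"

definition Ltilde :: "nat list \<Rightarrow> series" where
  "Ltilde \<alpha> = (\<lambda>M. int (card {\<sigma> \<in> set_sequences (perm_of_comp \<alpha>). set_monomial \<sigma> = M}))"

definition series_mult :: "series \<Rightarrow> series \<Rightarrow> series" where
  "series_mult F G = (\<lambda>M. \<Sum>(A, B)\<in>{(A, B). A + B = M}. F A * G B)"

definition rename :: "(nat \<Rightarrow> nat) \<Rightarrow> monomial \<Rightarrow> monomial" where
  "rename e M = (\<Sum>r\<in>Poly_Mapping.keys M. Poly_Mapping.single (e r) (Poly_Mapping.lookup M r))"

text \<open>
  The coefficient of \<open>x\<^sup>M y\<^sup>N\<close> in \<open>F(x, y)\<close>. The finitely many variables occurring in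
  \<open>x\<^sup>M y\<^sup>N\<close>, ordered by \<open>x\<^sub>1 < x\<^sub>2 < \<dots> < y\<^sub>1 < y\<^sub>2 < \<dots>\<close>, are renamed to variables among
  \<open>x\<^sub>1, x\<^sub>2, \<dots>\<close> by an order-preserving injection (\<open>d\<close> on the \<open>x\<close>'s, \<open>e\<close> on the \<open>y\<close>'s).
  The series \<open>F\<close> of interest are quasisymmetric, so the coefficient in \<open>F\<close> of the resulting
  monomial does not depend on the injection.
\<close>

definition series_xy :: "series \<Rightarrow> monomial \<times> monomial \<Rightarrow> int" where
  "series_xy F = (\<lambda>(M, N).
     let X = Poly_Mapping.keys M; Y = Poly_Mapping.keys N in
     if 0 \<in> X \<union> Y then 0
     else THE c. \<forall>d e.
       strict_mono_on X d \<and> strict_mono_on Y e \<and> (\<forall>r\<in>X. 0 < d r) \<and> (\<forall>s\<in>Y. 0 < e s) \<and>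
       (\<forall>r\<in>X. \<forall>s\<in>Y. d r < e s) \<longrightarrow> F (rename d M + rename e N) = c)"

text \<open>
  The completed tensor square is realised inside the power series in two sets of variables, with
  \<open>F \<otimes> G\<close> corresponding to \<open>F(x) G(y)\<close>.
\<close>

definition L_bialg :: "(series, monomial \<times> monomial \<Rightarrow> int) bialg" where
  "L_bialg =
     \<lparr>carr = cspan compositions Ltilde,
      tcarr = cspan (compositions \<times> compositions) (\<lambda>(\<alpha>, \<beta>). tensor (Ltilde \<alpha>) (Ltilde \<beta>)),
      add = (+),
      tadd = (+),
      tens = tensor,
      mul = series_mult,
      unt = (\<lambda>n M. n * delta 0 M),
      cop = series_xy,
      cou = (\<lambda>F. F 0)\<rparr>"


section \<open>The map \<open>\<psi>\<close>\<close>

definition psi_word :: "nat list \<Rightarrow> series" where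
  "psi_word w = Ltilde (comp_of_word w)"

definition psi :: "(nat list \<Rightarrow> int) \<Rightarrow> series" where
  "psi f = lincomb mperms f psi_word"

definition psi_tensor :: "(nat list \<times> nat list \<Rightarrow> int) \<Rightarrow> monomial \<times> monomial \<Rightarrow> int" where
  "psi_tensor T =
     lincomb (mperms \<times> mperms) T (\<lambda>(w, u). tensor (psi_word w) (psi_word u))"

text \<open>The maps induced by \<open>\<psi>\<close> and \<open>\<psi> \<otimes> \<psi>\<close> on the quotient.\<close>

definition psi_quot :: "(nat list \<Rightarrow> int) set \<Rightarrow> series" where
  "psi_quot X = the_elem (psi ` X)"

definition psi_tensor_quot ::
  "(nat list \<times> nat list \<Rightarrow> int) set \<Rightarrow> monomial \<times> monomial \<Rightarrow> int" where
  "psi_tensor_quot X = the_elem (psi_tensor ` X)"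

end

theory Submission
  imports Defs "HOL-Library.Product_Lexorder"
begin

text \<open>
  Flatten a sequence of sets \<open>\<sigma>\<^sub>1, \<sigma>\<^sub>2, \<dots>\<close> along a word \<open>w\<close> to the list of all pairs \<open>(r, w\<^sub>i)\<close>
  with \<open>r \<in> \<sigma>\<^sub>i\<close>. The conditions defining \<open>L\<close> say that this list increases strictly in the
  lexicographic order, and \<open>w\<close> is the word of second components with runs of equal letters
  contracted. Hence a product of two \<open>L\<close>'s counts pairs of increasing lists over disjoint alphabets,
  that is, increasing lists over the union of the alphabets, whose contracted words are the terms of
  the star product. Substituting \<open>x, y\<close> cuts an increasing list in two, and a run of equal letters
  may be cut in the middle, as in the coproduct of words. So \<open>\<psi>\<close> is a morphism. Since the
  \<open>L\<close>'s are triangular with respect to their leading monomials, they are independent; hence the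
  kernels of \<open>\<psi>\<close> and \<open>\<psi> \<otimes> \<psi>\<close> consist of the combinations whose coefficients sum to zero over
  every class of words with equal descent sets, which are exactly \<open>I\<close> and its tensor analogue.
\<close>

section \<open>Quotients by kernels of surjective bialgebra morphisms\<close>

text \<open>The biideal property of \<open>I_ideal\<close> comes from identifying it with the kernel
  of \<open>psi\<close>: operations descend because \<open>psi\<close> carries them to the target,
  and closure of the target follows from surjectivity. Two obstacles shape the computation. First,
  all combinations are infinite. A word of length n meets only monomials of degree at least n, so
  each single coefficient is a finite sum over words of bounded length, and every identity is
  checked one coefficient at a time. Second, words have repeated letters, so substitution in the
  star product is not injective and \<open>star\<close> carries multiplicities. Since
  \<open>psi_word\<close> depends only on length and descents, both factors are replaced by
  permutations over disjoint alphabets before increasing lists are merged; the point to verify is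
  that this leaves the descents of every term unchanged. The completed tensor square needs its own
  kernel computation, because \<open>I_tensor\<close> is a sum of two completed spans: coefficients
  are moved to class representatives in the left factor and then in the right one.\<close>

definition kernel_rel :: "'a set \<Rightarrow> ('a \<Rightarrow> 'b) \<Rightarrow> ('a \<times> 'a) set" where
  "kernel_rel S \<phi> = {(x, y). x \<in> S \<and> y \<in> S \<and> \<phi> x = \<phi> y}"

lemma equiv_kernel_rel: "equiv S (kernel_rel S \<phi>)"
  by (auto simp: kernel_rel_def equiv_def refl_on_def sym_def trans_def)

lemma kernel_rel_class: "x \<in> S \<Longrightarrow> kernel_rel S \<phi> `` {x} = {y \<in> S. \<phi> y = \<phi> x}"
  by (auto simp: kernel_rel_def)

lemma UN_const_class: "x \<in> X \<Longrightarrow> (\<And>a. a \<in> X \<Longrightarrow> f a = c) \<Longrightarrow> (\<Union>a\<in>X. f a) = c"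
  by auto

lemma the_elem_image_const:
  assumes "x \<in> X" and "\<And>y. y \<in> X \<Longrightarrow> f y = c"
  shows "the_elem (f ` X) = c"
proof -
  have "f ` X = {c}"
    using assms by auto
  then show ?thesis
    by simp
qed

lemma the_elem_kernel_class:
  "x \<in> S \<Longrightarrow> the_elem (\<phi> ` (kernel_rel S \<phi> `` {x})) = \<phi> x"
  by (rule the_elem_image_const) (auto simp: kernel_rel_class)

lemma kernel_class_eqI:
  "x \<in> S \<Longrightarrow> y \<in> S \<Longrightarrow> \<phi> x = \<phi> y \<Longrightarrow> kernel_rel S \<phi> `` {x} = kernel_rel S \<phi> `` {y}"
  by (simp add: kernel_rel_class)

lemma quotient_kernel_relE:
  assumes "X \<in> S // kernel_rel S \<phi>"
  obtains x where "x \<in> S" "X = kernel_rel S \<phi> `` {x}"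
  using assms by (auto simp: quotient_def)

lemma UN_kernel_class:
  assumes "x \<in> S"
    and "\<And>a. a \<in> S \<Longrightarrow> \<phi> a = \<phi> x \<Longrightarrow> f a = f x"
  shows "(\<Union>a\<in>kernel_rel S \<phi> `` {x}. f a) = f x"
  unfolding kernel_rel_class[OF assms(1)]
  by (rule UN_const_class[of x]) (simp_all add: assms(1), metis assms(2))

lemma UN_UN_kernel_class:
  assumes "x \<in> S" "y \<in> S"
    and "\<And>a b. a \<in> S \<Longrightarrow> b \<in> S \<Longrightarrow> \<phi> a = \<phi> x \<Longrightarrow> \<phi> b = \<phi> y \<Longrightarrow> f a b = f x y"
  shows "(\<Union>a\<in>kernel_rel S \<phi> `` {x}. \<Union>b\<in>kernel_rel S \<phi> `` {y}. f a b) = f x y"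
  unfolding kernel_rel_class[OF assms(1)] kernel_rel_class[OF assms(2)]
  by (rule UN_const_class[of x], simp add: assms(1), rule UN_const_class[of y])
    (simp_all add: assms(2), metis assms(3))

text \<open>The set-theoretic first isomorphism theorem, applied once to the carriers and once to
  the completed tensor squares.\<close>

lemma bij_betw_kernel_quotient:
  assumes "\<phi> ` S = T"
  shows "bij_betw (\<lambda>X. the_elem (\<phi> ` X)) (S // kernel_rel S \<phi>) T"
proof (rule bij_betwI')
  fix X Y
  assume "X \<in> S // kernel_rel S \<phi>" and "Y \<in> S // kernel_rel S \<phi>"
  then obtain x y where "x \<in> S" "X = kernel_rel S \<phi> `` {x}" "y \<in> S" "Y = kernel_rel S \<phi> `` {y}"
    by (elim quotient_kernel_relE)
  then show "the_elem (\<phi> ` X) = the_elem (\<phi> ` Y) \<longleftrightarrow> X = Y"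
    using kernel_class_eqI[of x S y \<phi>] the_elem_kernel_class[of x S \<phi>]
      the_elem_kernel_class[of y S \<phi>] by (simp, metis)
next
  fix X
  assume "X \<in> S // kernel_rel S \<phi>"
  then obtain x where "x \<in> S" "X = kernel_rel S \<phi> `` {x}"
    by (rule quotient_kernel_relE)
  then show "the_elem (\<phi> ` X) \<in> T"
    using assms by (auto simp: the_elem_kernel_class)
next
  fix t
  assume "t \<in> T"
  then obtain x where "x \<in> S" "t = \<phi> x"
    using assms by auto
  then show "\<exists>X\<in>S // kernel_rel S \<phi>. t = the_elem (\<phi> ` X)"
    by (intro bexI[of _ "kernel_rel S \<phi> `` {x}"])
      (simp_all add: the_elem_kernel_class quotientI)
qed

locale surj_bialg_hom =
  fixes A :: "('a, 's) bialg" and B :: "('b, 't) bialg"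
    and \<phi> :: "'a \<Rightarrow> 'b" and \<phi>2 :: "'s \<Rightarrow> 't"
  assumes closed: "bialg_closed A"
    and hom: "bialg_hom A B \<phi> \<phi>2"
    and surj: "\<phi> ` carr A = carr B"
    and surj2: "\<phi>2 ` tcarr A = tcarr B"
begin

lemma hom_simps:
  "x \<in> carr A \<Longrightarrow> y \<in> carr A \<Longrightarrow> \<phi> (add A x y) = add B (\<phi> x) (\<phi> y)"
  "s \<in> tcarr A \<Longrightarrow> t \<in> tcarr A \<Longrightarrow> \<phi>2 (tadd A s t) = tadd B (\<phi>2 s) (\<phi>2 t)"
  "x \<in> carr A \<Longrightarrow> y \<in> carr A \<Longrightarrow> \<phi>2 (tens A x y) = tens B (\<phi> x) (\<phi> y)"
  "x \<in> carr A \<Longrightarrow> y \<in> carr A \<Longrightarrow> \<phi> (mul A x y) = mul B (\<phi> x) (\<phi> y)"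
  "\<phi> (unt A n) = unt B n"
  "x \<in> carr A \<Longrightarrow> \<phi>2 (cop A x) = cop B (\<phi> x)"
  "x \<in> carr A \<Longrightarrow> cou A x = cou B (\<phi> x)"
  using hom by (simp_all add: bialg_hom_def)

lemma closed_simps:
  "x \<in> carr A \<Longrightarrow> y \<in> carr A \<Longrightarrow> add A x y \<in> carr A"
  "x \<in> carr A \<Longrightarrow> y \<in> carr A \<Longrightarrow> mul A x y \<in> carr A"
  "x \<in> carr A \<Longrightarrow> y \<in> carr A \<Longrightarrow> tens A x y \<in> tcarr A"
  "s \<in> tcarr A \<Longrightarrow> t \<in> tcarr A \<Longrightarrow> tadd A s t \<in> tcarr A"
  "unt A n \<in> carr A"
  "x \<in> carr A \<Longrightarrow> cop A x \<in> tcarr A"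
  using closed by (simp_all add: bialg_closed_def)

text \<open>Every element of \<open>B\<close> is an image, so closure is inherited from
  \<open>A\<close>. For the target this replaces an explicit expansion of products and coproducts of
  the \<open>Ltilde\<close>.\<close>

lemma target_closed: "bialg_closed B"
proof -
  have "\<phi> x \<in> carr B" if "x \<in> carr A" for x
    using that surj by auto
  moreover have "\<phi>2 x \<in> tcarr B" if "x \<in> tcarr A" for x
    using that surj2 by auto
  ultimately show ?thesis
    unfolding bialg_closed_def surj[symmetric] surj2[symmetric]
    by (simp add: hom_simps[symmetric] closed_simps)
qed

definition Q :: "('a set, 's set) bialg" where
  "Q = quot_bialg A (kernel_rel (carr A) \<phi>) (kernel_rel (tcarr A) \<phi>2)"

abbreviation cls :: "'a \<Rightarrow> 'a set" where
  "cls x \<equiv> kernel_rel (carr A) \<phi> `` {x}"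

abbreviation tcls :: "'s \<Rightarrow> 's set" where
  "tcls x \<equiv> kernel_rel (tcarr A) \<phi>2 `` {x}"

text \<open>Changing a representative moves the result of an operation only within a fibre, because
  the morphism carries the operation to \<open>B\<close>. Hence all classes in each union coincide,
  and the counit is constant on classes.\<close>

lemma quotient_simps:
  "x \<in> carr A \<Longrightarrow> y \<in> carr A \<Longrightarrow> add Q (cls x) (cls y) = cls (add A x y)"
  "s \<in> tcarr A \<Longrightarrow> t \<in> tcarr A \<Longrightarrow> tadd Q (tcls s) (tcls t) = tcls (tadd A s t)"
  "x \<in> carr A \<Longrightarrow> y \<in> carr A \<Longrightarrow> tens Q (cls x) (cls y) = tcls (tens A x y)"
  "x \<in> carr A \<Longrightarrow> y \<in> carr A \<Longrightarrow> mul Q (cls x) (cls y) = cls (mul A x y)"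
  "unt Q n = cls (unt A n)"
  "x \<in> carr A \<Longrightarrow> cop Q (cls x) = tcls (cop A x)"
  "x \<in> carr A \<Longrightarrow> cou Q (cls x) = cou A x"
proof -
  show "x \<in> carr A \<Longrightarrow> y \<in> carr A \<Longrightarrow> add Q (cls x) (cls y) = cls (add A x y)"
    by (simp add: Q_def quot_bialg_def, rule UN_UN_kernel_class)
      (simp_all add: kernel_rel_class hom_simps closed_simps)
  show "s \<in> tcarr A \<Longrightarrow> t \<in> tcarr A \<Longrightarrow> tadd Q (tcls s) (tcls t) = tcls (tadd A s t)"
    by (simp add: Q_def quot_bialg_def, rule UN_UN_kernel_class)
      (simp_all add: kernel_rel_class hom_simps closed_simps)
  show "x \<in> carr A \<Longrightarrow> y \<in> carr A \<Longrightarrow> tens Q (cls x) (cls y) = tcls (tens A x y)"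
    by (simp add: Q_def quot_bialg_def, rule UN_UN_kernel_class)
      (simp_all add: kernel_rel_class hom_simps closed_simps)
  show "x \<in> carr A \<Longrightarrow> y \<in> carr A \<Longrightarrow> mul Q (cls x) (cls y) = cls (mul A x y)"
    by (simp add: Q_def quot_bialg_def, rule UN_UN_kernel_class)
      (simp_all add: kernel_rel_class hom_simps closed_simps)
  show "unt Q n = cls (unt A n)"
    by (simp add: Q_def quot_bialg_def)
  show "x \<in> carr A \<Longrightarrow> cop Q (cls x) = tcls (cop A x)"
    by (simp add: Q_def quot_bialg_def, rule UN_kernel_class)
      (simp_all add: kernel_rel_class hom_simps closed_simps)
  show "x \<in> carr A \<Longrightarrow> cou Q (cls x) = cou A x"
    unfolding Q_def quot_bialg_def
    by (simp, rule the_elem_image_const) (simp_all add: kernel_rel_class hom_simps)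
qed

lemma quotient_carr: "carr Q = cls ` carr A" "tcarr Q = tcls ` tcarr A"
  by (auto simp: Q_def quot_bialg_def quotient_def)

lemma quotient_closed: "bialg_closed Q"
  unfolding bialg_closed_def quotient_carr by (simp add: quotient_simps closed_simps)

lemma quotient_iso: "bialg_iso Q B (\<lambda>X. the_elem (\<phi> ` X)) (\<lambda>X. the_elem (\<phi>2 ` X))"
proof -
  have "\<phi> x \<in> carr B" if "x \<in> carr A" for x
    using that surj by auto
  moreover have "\<phi>2 x \<in> tcarr B" if "x \<in> tcarr A" for x
    using that surj2 by auto
  ultimately have "bialg_hom Q B (\<lambda>X. the_elem (\<phi> ` X)) (\<lambda>X. the_elem (\<phi>2 ` X))"
    unfolding bialg_hom_def quotient_carr
    by (auto simp: quotient_simps the_elem_kernel_class closed_simps hom_simps)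
  moreover have "bij_betw (\<lambda>X. the_elem (\<phi> ` X)) (carr Q) (carr B)"
    "bij_betw (\<lambda>X. the_elem (\<phi>2 ` X)) (tcarr Q) (tcarr B)"
    using bij_betw_kernel_quotient[OF surj] bij_betw_kernel_quotient[OF surj2]
    by (simp_all add: Q_def quot_bialg_def)
  ultimately show ?thesis
    by (simp add: bialg_iso_def)
qed

end

section \<open>Infinite linear combinations and fibre sums\<close>

lemma lincomb_eq_sum:
  assumes "finite S" "S \<subseteq> A" "\<And>a. a \<in> A - S \<Longrightarrow> c a * F a b = 0"
  shows "lincomb A c F b = (\<Sum>a\<in>S. c a * F a b)"
  unfolding lincomb_def using assms by (intro sum.mono_neutral_left) auto

lemma lincomb_locally_finite:
  "locally_finite A F \<Longrightarrow> lincomb A c F b = (\<Sum>a\<in>{a \<in> A. F a b \<noteq> 0}. c a * F a b)"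
  by (rule lincomb_eq_sum) (auto simp: locally_finite_def)

lemma lincomb_add:
  "locally_finite A F \<Longrightarrow> lincomb A (f + g) F = lincomb A f F + lincomb A g F"
  by (rule ext) (simp add: lincomb_locally_finite sum.distrib distrib_right)

lemma lincomb_diff:
  "locally_finite A F \<Longrightarrow> lincomb A (f - g) F = lincomb A f F - lincomb A g F"
  by (rule ext) (simp add: lincomb_locally_finite sum_subtractf left_diff_distrib)

lemma cspan_locally_finite:
  assumes "locally_finite A F"
  shows "cspan A F = range (\<lambda>c. lincomb A c F)"
proof -
  have "finite {a \<in> A. c a * F a b \<noteq> 0}" for c b
    by (rule finite_subset[of _ "{a \<in> A. F a b \<noteq> 0}"])
      (use assms in \<open>auto simp: locally_finite_def\<close>)
  then show ?thesis
    by (auto simp: cspan_def)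
qed

lemma cspan_eq_zero:
  "f \<in> cspan A F \<Longrightarrow> (\<And>a. a \<in> A \<Longrightarrow> F a b = 0) \<Longrightarrow> f b = 0"
  by (auto simp: cspan_def lincomb_def intro!: sum.neutral)

text \<open>A finite sum of coordinates is a continuous functional: only the finitely many
  generators in \<open>S\<close> are visible in \<open>B\<close>, so the two summations can be
  exchanged.\<close>

lemma sum_cspan_eq_zero:
  assumes "f \<in> cspan A F" "finite B" "\<And>a. a \<in> A \<Longrightarrow> (\<Sum>b\<in>B. F a b) = 0"
  shows "sum f B = 0"
proof -
  obtain c where f: "f = lincomb A c F" and fin: "\<And>b. finite {a \<in> A. c a * F a b \<noteq> 0}"
    using assms(1) by (auto simp: cspan_def)
  define S where "S = (\<Union>b\<in>B. {a \<in> A. c a * F a b \<noteq> 0})"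
  have "sum f B = (\<Sum>b\<in>B. \<Sum>a\<in>S. c a * F a b)"
    unfolding f
  proof (intro sum.cong refl lincomb_eq_sum)
    show "finite S"
      using fin assms(2) by (auto simp: S_def)
  qed (auto simp: S_def)
  also have "\<dots> = (\<Sum>a\<in>S. c a * (\<Sum>b\<in>B. F a b))"
    by (subst sum.swap) (simp add: sum_distrib_left)
  also have "\<dots> = 0"
    using assms(3) by (intro sum.neutral) (auto simp: S_def)
  finally show ?thesis .
qed

section \<open>Grouping coefficients by fibres\<close>

definition fibre_sum :: "'x set \<Rightarrow> ('x \<Rightarrow> 'k) \<Rightarrow> ('x \<Rightarrow> int) \<Rightarrow> 'k \<Rightarrow> int" where
  "fibre_sum X \<kappa> f k = (\<Sum>x\<in>{x \<in> X. \<kappa> x = k}. f x)"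

lemma fibre_sum_diff: "fibre_sum X \<kappa> (f - g) k = fibre_sum X \<kappa> f k - fibre_sum X \<kappa> g k"
  by (simp add: fibre_sum_def sum_subtractf)

lemma locally_finite_comp:
  assumes "locally_finite K L" "\<kappa> \<in> X \<rightarrow> K" "\<And>k. finite {x \<in> X. \<kappa> x = k}"
  shows "locally_finite X (\<lambda>x. L (\<kappa> x))"
  unfolding locally_finite_def
proof
  fix b
  have "{x \<in> X. L (\<kappa> x) b \<noteq> 0} \<subseteq> (\<Union>k\<in>{k \<in> K. L k b \<noteq> 0}. {x \<in> X. \<kappa> x = k})"
    using assms(2) by auto
  moreover have "finite (\<Union>k\<in>{k \<in> K. L k b \<noteq> 0}. {x \<in> X. \<kappa> x = k})"
    using assms by (auto simp: locally_finite_def)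
  ultimately show "finite {x \<in> X. L (\<kappa> x) b \<noteq> 0}"
    by (rule finite_subset)
qed

text \<open>At a given coordinate finitely many \<open>k\<close> contribute, each with a finite
  fibre, so terms may be regrouped. This turns a combination over words into one over compositions,
  where independence is available.\<close>

lemma lincomb_comp:
  assumes "locally_finite K L" "\<kappa> \<in> X \<rightarrow> K" "\<And>k. finite {x \<in> X. \<kappa> x = k}"
  shows "lincomb X f (\<lambda>x. L (\<kappa> x)) = lincomb K (fibre_sum X \<kappa> f) L"
proof
  fix b
  let ?K = "{k \<in> K. L k b \<noteq> 0}"
  let ?X = "{x \<in> X. L (\<kappa> x) b \<noteq> 0}"
  have "finite ?K"
    using assms(1) by (auto simp: locally_finite_def)
  have "finite ?X"
    using locally_finite_comp[OF assms] by (auto simp: locally_finite_def)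
  have "lincomb X f (\<lambda>x. L (\<kappa> x)) b = (\<Sum>x\<in>?X. f x * L (\<kappa> x) b)"
    using locally_finite_comp[OF assms] by (rule lincomb_locally_finite)
  also have "\<dots> = (\<Sum>k\<in>?K. \<Sum>x\<in>{x \<in> ?X. \<kappa> x = k}. f x * L (\<kappa> x) b)"
    using assms(2) by (intro sum.group[symmetric] \<open>finite ?K\<close> \<open>finite ?X\<close>) auto
  also have "\<dots> = (\<Sum>k\<in>?K. fibre_sum X \<kappa> f k * L k b)"
    unfolding fibre_sum_def sum_distrib_right by (intro sum.cong) auto
  also have "\<dots> = lincomb K (fibre_sum X \<kappa> f) L b"
    using assms(1) by (rule lincomb_locally_finite[symmetric])
  finally show "lincomb X f (\<lambda>x. L (\<kappa> x)) b = lincomb K (fibre_sum X \<kappa> f) L b" .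
qed

definition independent_family :: "'k set \<Rightarrow> ('k \<Rightarrow> 'b \<Rightarrow> int) \<Rightarrow> bool" where
  "independent_family K L \<longleftrightarrow> (\<forall>c. lincomb K c L = 0 \<longrightarrow> (\<forall>k\<in>K. c k = 0))"

lemma lincomb_comp_eq_iff:
  assumes "locally_finite K L" "\<kappa> \<in> X \<rightarrow> K" "\<And>k. finite {x \<in> X. \<kappa> x = k}"
    and "independent_family K L"
  shows "lincomb X f (\<lambda>x. L (\<kappa> x)) = lincomb X g (\<lambda>x. L (\<kappa> x)) \<longleftrightarrow>
    (\<forall>k\<in>K. fibre_sum X \<kappa> (f - g) k = 0)" (is "?l \<longleftrightarrow> ?r")
proof -
  have "lincomb K (fibre_sum X \<kappa> (f - g)) L =
      lincomb X f (\<lambda>x. L (\<kappa> x)) - lincomb X g (\<lambda>x. L (\<kappa> x))"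
    using lincomb_comp[OF assms(1-3), of "f - g"]
      lincomb_diff[OF locally_finite_comp[OF assms(1-3)], of f g] by (rule trans[OF sym])
  then have "?l \<longleftrightarrow> lincomb K (fibre_sum X \<kappa> (f - g)) L = 0"
    by simp
  also have "\<dots> \<longleftrightarrow> ?r"
  proof
    show "lincomb K (fibre_sum X \<kappa> (f - g)) L = 0" if "\<forall>k\<in>K. fibre_sum X \<kappa> (f - g) k = 0"
      unfolding lincomb_def zero_fun_def using that by (intro ext sum.neutral) simp
  qed (use assms(4) in \<open>simp add: independent_family_def\<close>)
  finally show ?thesis .
qed

lemma lincomb_comp_image:
  assumes "locally_finite K L" "\<kappa> \<in> X \<rightarrow> K" "\<And>k. finite {x \<in> X. \<kappa> x = k}"
    and "\<And>k. k \<in> K \<Longrightarrow> r k \<in> X \<and> \<kappa> (r k) = k"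
  shows "(\<lambda>f. lincomb X f (\<lambda>x. L (\<kappa> x))) ` {f. \<forall>x. x \<notin> X \<longrightarrow> f x = 0} = cspan K L"
    (is "?\<Psi> ` ?C = _")
proof -
  have "lincomb K c L \<in> ?\<Psi> ` ?C" for c
  proof
    \<comment> \<open>The coefficient \<open>c k\<close> is put on the single chosen point
      \<open>r k\<close> of its fibre.\<close>
    define f where "f x = (if x \<in> X \<and> x = r (\<kappa> x) then c (\<kappa> x) else 0)" for x
    show "f \<in> ?C"
      by (simp add: f_def)
    have "fibre_sum X \<kappa> f k = c k" if "k \<in> K" for k
    proof -
      have "fibre_sum X \<kappa> f k = (\<Sum>x\<in>{x \<in> X. \<kappa> x = k}. if x = r k then c k else 0)"
        unfolding fibre_sum_def by (intro sum.cong) (auto simp: f_def)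
      then show ?thesis
        using assms(3) assms(4)[OF that] by simp
    qed
    then have "lincomb K c L = lincomb K (fibre_sum X \<kappa> f) L"
      by (simp add: lincomb_locally_finite[OF assms(1)] fun_eq_iff)
    then show "lincomb K c L = lincomb X f (\<lambda>x. L (\<kappa> x))"
      by (rule trans[OF _ lincomb_comp[OF assms(1-3), symmetric]])
  qed
  moreover have "?\<Psi> f \<in> range (\<lambda>c. lincomb K c L)" for f
    by (rule range_eqI, rule lincomb_comp[OF assms(1-3)])
  ultimately show ?thesis
    unfolding cspan_locally_finite[OF assms(1)]
    by (intro Set.equalityI image_subsetI) simp_all
qed

text \<open>The witness uses only the relations between each \<open>x\<close> and its representative \<open>\<rho> x\<close>.\<close>

lemma mem_cspan_differences:
  assumes "\<rho> \<in> X \<rightarrow> X" "\<And>x. finite {y \<in> X. \<rho> y = x}"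
    and "inj_on j X" "j \<in> X \<rightarrow> A" "\<And>x. x \<in> X \<Longrightarrow> F (j x) = delta x - delta (\<rho> x)"
    and "\<And>x. x \<notin> X \<Longrightarrow> f x = 0" "\<And>x. x \<in> X \<Longrightarrow> fibre_sum X \<rho> f x = 0"
  shows "f \<in> cspan A F"
proof -
  define c where "c a = (if a \<in> j ` X then f (inv_into X j a) else 0)" for a
  have c: "c (j x) = f x" if "x \<in> X" for x
    using assms(3) that by (simp add: c_def)
  \<comment> \<open>Coordinate \<open>b\<close> sees the generator of \<open>x\<close> only if
    \<open>x = b\<close> or \<open>\<rho> x = b\<close>; this finite set gives convergence and
    carries both sums below.\<close>
  define S where "S b = {x \<in> X. x = b \<or> \<rho> x = b}" for b
  have fin: "finite (S b)" for b
    by (rule finite_subset[of _ "insert b {y \<in> X. \<rho> y = b}"]) (auto simp: S_def assms(2))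
  have zero: "c a * F a b = 0" if "a \<notin> j ` S b" for a b
  proof (cases "a \<in> j ` X")
    case True
    then obtain x where "x \<in> X" "a = j x"
      by auto
    moreover from this that have "x \<noteq> b" "\<rho> x \<noteq> b"
      by (auto simp: S_def)
    ultimately show ?thesis
      by (simp add: assms(5) delta_def)
  qed (simp add: c_def)
  have "f b = lincomb A c F b" for b
  proof -
    have "lincomb A c F b = (\<Sum>a\<in>j ` S b. c a * F a b)"
      using fin assms(4) zero by (intro lincomb_eq_sum) (auto simp: S_def)
    also have "\<dots> = (\<Sum>x\<in>S b. f x * (delta x b - delta (\<rho> x) b))"
      using assms(3) by (subst sum.reindex) (auto simp: S_def inj_on_def c assms(5))
    also have "\<dots> = (\<Sum>x\<in>S b. f x * delta x b) - (\<Sum>x\<in>S b. f x * delta (\<rho> x) b)"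
      by (simp add: right_diff_distrib sum_subtractf)
    also have "(\<Sum>x\<in>S b. f x * delta x b) = f b"
    proof (cases "b \<in> X")
      case True
      have "(\<Sum>x\<in>S b. f x * delta x b) = (\<Sum>x\<in>{b}. f x * delta x b)"
        using fin True by (intro sum.mono_neutral_right) (auto simp: S_def delta_def)
      then show ?thesis
        by (simp add: delta_def)
    next
      case False
      then show ?thesis
        by (auto simp: S_def delta_def assms(6) intro!: sum.neutral)
    qed
    also have "(\<Sum>x\<in>S b. f x * delta (\<rho> x) b) = fibre_sum X \<rho> f b"
    proof -
      have "(\<Sum>x\<in>S b. f x * delta (\<rho> x) b) = (\<Sum>x\<in>{x \<in> X. \<rho> x = b}. f x * delta (\<rho> x) b)"
        using fin by (intro sum.mono_neutral_right) (auto simp: S_def delta_def)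
      then show ?thesis
        by (simp add: delta_def fibre_sum_def)
    qed
    also have "\<dots> = 0"
    proof (cases "b \<in> X")
      case False
      then have "{x \<in> X. \<rho> x = b} = {}"
        using assms(1) by auto
      then show ?thesis
        unfolding fibre_sum_def by (simp only: sum.empty)
    qed (rule assms(7))
    finally show ?thesis
      by simp
  qed
  moreover have "finite {a \<in> A. c a * F a b \<noteq> 0}" for b
    using zero by (intro finite_subset[OF _ finite_imageI[OF fin[of b], of j]]) auto
  ultimately show ?thesis
    by (auto simp: cspan_def)
qed

section \<open>The ideal of differences and its tensor analogue\<close>

lemma tensor_delta: "tensor (delta x) (delta y) = delta (x, y)"
  by (auto simp: tensor_def delta_def)

lemma tensor_diff_left: "tensor (f - g) h = tensor f h - tensor g h"
  by (auto simp: tensor_def left_diff_distrib)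

lemma tensor_diff_right: "tensor h (f - g) = tensor h f - tensor h g"
  by (auto simp: tensor_def right_diff_distrib)

text \<open>From left to right, each generator is a difference of two basis pairs in the same fibre.
  Conversely, summing \<open>f\<close> over fibres of the left factor leaves \<open>T\<close>,
  supported on representatives there. Then \<open>f - T\<close> is a combination of left
  differences, and the fibre sums of \<open>T\<close> in the right factor are double fibre sums of
  \<open>f\<close>, hence zero.\<close>

lemma tensor_ideal_eq:
  fixes X :: "'x set" and \<rho> :: "'x \<Rightarrow> 'x"
  assumes \<rho>: "\<rho> \<in> X \<rightarrow> X" "\<And>x. x \<in> X \<Longrightarrow> \<rho> (\<rho> x) = \<rho> x"
    and fin: "\<And>x. finite {y \<in> X. \<rho> y = x}"
    and R: "R = {(x, y). x \<in> X \<and> y \<in> X \<and> \<rho> x = \<rho> y}"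
  shows "{S + T | S T.
        S \<in> cspan (R \<times> X) (\<lambda>((w, u), v). tensor (delta w - delta u) (delta v)) \<and>
        T \<in> cspan (X \<times> R) (\<lambda>(v, (w, u)). tensor (delta v) (delta w - delta u))} =
     {f. (\<forall>p. p \<notin> X \<times> X \<longrightarrow> f p = 0) \<and>
       (\<forall>p\<in>X \<times> X. fibre_sum (X \<times> X) (map_prod \<rho> \<rho>) f p = 0)}" (is "?L = ?R")
proof (intro Set.equalityI subsetI)
  have fin2: "finite {p \<in> X \<times> X. map_prod \<rho> \<rho> p = q}" for q
  proof -
    have "{p \<in> X \<times> X. map_prod \<rho> \<rho> p = q} = {y \<in> X. \<rho> y = fst q} \<times> {y \<in> X. \<rho> y = snd q}"
      by (auto simp: map_prod_def)
    then show ?thesis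
      using fin by auto
  qed
  fix f
  assume "f \<in> ?L"
  then obtain S T where f: "f = S + T"
    and S: "S \<in> cspan (R \<times> X) (\<lambda>((w, u), v). tensor (delta w - delta u) (delta v))"
    and T: "T \<in> cspan (X \<times> R) (\<lambda>(v, (w, u)). tensor (delta v) (delta w - delta u))"
    by blast
  have "S p = 0" if "p \<notin> X \<times> X" for p
    by (rule cspan_eq_zero[OF S]) (use that in \<open>auto simp: R tensor_def delta_def split: prod.splits\<close>)
  moreover have "T p = 0" if "p \<notin> X \<times> X" for p
    by (rule cspan_eq_zero[OF T]) (use that in \<open>auto simp: R tensor_def delta_def split: prod.splits\<close>)
  moreover have "fibre_sum (X \<times> X) (map_prod \<rho> \<rho>) f q = 0" if q: "q \<in> X \<times> X" for q
  proof -
    have delta: "(\<Sum>p\<in>{p \<in> X \<times> X. map_prod \<rho> \<rho> p = q}. delta z p) =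
        of_bool (z \<in> X \<times> X \<and> map_prod \<rho> \<rho> z = q)" for z
      using fin2 by (simp add: delta_def of_bool_def)
    have "fibre_sum (X \<times> X) (map_prod \<rho> \<rho>) S q = 0"
      unfolding fibre_sum_def
      by (rule sum_cspan_eq_zero[OF S fin2])
        (auto simp: R tensor_diff_left tensor_delta sum_subtractf delta)
    moreover have "fibre_sum (X \<times> X) (map_prod \<rho> \<rho>) T q = 0"
      unfolding fibre_sum_def
      by (rule sum_cspan_eq_zero[OF T fin2])
        (auto simp: R tensor_diff_right tensor_delta sum_subtractf delta)
    ultimately show ?thesis
      by (simp add: f fibre_sum_def sum.distrib)
  qed
  ultimately show "f \<in> ?R"
    by (simp add: f)
next
  fix f
  assume "f \<in> ?R"
  then have supp: "\<And>p. p \<notin> X \<times> X \<Longrightarrow> f p = 0"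
    and zero: "\<And>p. p \<in> X \<times> X \<Longrightarrow> fibre_sum (X \<times> X) (map_prod \<rho> \<rho>) f p = 0"
    by blast+
  \<comment> \<open>Representatives are the fixed points of the idempotent \<rho>; the default 0
    elsewhere leaves at most one nonzero value per fibre of the left factor.\<close>
  define T where "T p = (if fst p \<in> X \<and> \<rho> (fst p) = fst p
      then fibre_sum X \<rho> (\<lambda>x. f (x, snd p)) (fst p) else 0)" for p
  have "f - T \<in> cspan (R \<times> X) (\<lambda>((w, u), v). tensor (delta w - delta u) (delta v))"
  proof (rule mem_cspan_differences[where \<rho> = "map_prod \<rho> id" and X = "X \<times> X"
        and j = "\<lambda>(x, y). ((x, \<rho> x), y)"])
    show "finite {p \<in> X \<times> X. map_prod \<rho> id p = q}" for q
    proof -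
      have "{p \<in> X \<times> X. map_prod \<rho> id p = q} = {y \<in> X. \<rho> y = fst q} \<times> ({snd q} \<inter> X)"
        by (auto simp: map_prod_def)
      then show ?thesis
        using fin by auto
    qed
    show "(f - T) p = 0" if "p \<notin> X \<times> X" for p
    proof -
      have "fibre_sum X \<rho> (\<lambda>x. f (x, snd p)) (fst p) = 0" if "fst p \<in> X"
        unfolding fibre_sum_def using that \<open>p \<notin> X \<times> X\<close>
        by (intro sum.neutral) (auto intro!: supp simp: mem_Times_iff)
      then show ?thesis
        using that by (auto simp: T_def supp)
    qed
    show "fibre_sum (X \<times> X) (map_prod \<rho> id) (f - T) q = 0" if "q \<in> X \<times> X" for q
    proof -
      obtain w v where q: "q = (w, v)" "w \<in> X" "v \<in> X"
        using \<open>q \<in> X \<times> X\<close> by auto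
      have eq: "{p \<in> X \<times> X. map_prod \<rho> id p = q} = (\<lambda>x. (x, v)) ` {x \<in> X. \<rho> x = w}"
        using q by (auto simp: map_prod_def)
      have sums: "fibre_sum (X \<times> X) (map_prod \<rho> id) h q = fibre_sum X \<rho> (\<lambda>x. h (x, v)) w" for h
        unfolding fibre_sum_def eq by (subst sum.reindex) (auto simp: inj_on_def)
      have "fibre_sum X \<rho> (\<lambda>x. T (x, v)) w = fibre_sum X \<rho> (\<lambda>x. f (x, v)) w"
      proof (cases "\<rho> w = w")
        case True
        have "fibre_sum X \<rho> (\<lambda>x. T (x, v)) w = (\<Sum>x\<in>{w}. T (x, v))"
          unfolding fibre_sum_def using fin True q(2)
          by (intro sum.mono_neutral_right) (auto simp: T_def)
        then show ?thesis
          using True q(2) by (simp add: T_def)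
      next
        case False
        then have "{x \<in> X. \<rho> x = w} = {}"
          using \<rho> by auto
        then show ?thesis
          unfolding fibre_sum_def by (simp only: sum.empty)
      qed
      then show ?thesis
        by (simp add: fibre_sum_diff sums)
    qed
  qed (use \<rho> in \<open>auto simp: R inj_on_def tensor_diff_left tensor_delta\<close>)
  moreover have "T \<in> cspan (X \<times> R) (\<lambda>(v, (w, u)). tensor (delta v) (delta w - delta u))"
  proof (rule mem_cspan_differences[where \<rho> = "map_prod id \<rho>" and X = "X \<times> X"
        and j = "\<lambda>(x, y). (x, (y, \<rho> y))"])
    show "finite {p \<in> X \<times> X. map_prod id \<rho> p = q}" for q
    proof -
      have "{p \<in> X \<times> X. map_prod id \<rho> p = q} = ({fst q} \<inter> X) \<times> {y \<in> X. \<rho> y = snd q}"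
        by (auto simp: map_prod_def)
      then show ?thesis
        using fin by auto
    qed
    show "T p = 0" if "p \<notin> X \<times> X" for p
    proof -
      have "fibre_sum X \<rho> (\<lambda>x. f (x, snd p)) (fst p) = 0" if "fst p \<in> X"
        unfolding fibre_sum_def using that \<open>p \<notin> X \<times> X\<close>
        by (intro sum.neutral) (auto intro!: supp simp: mem_Times_iff)
      then show ?thesis
        using that by (auto simp: T_def)
    qed
    show "fibre_sum (X \<times> X) (map_prod id \<rho>) T q = 0" if "q \<in> X \<times> X" for q
    proof -
      obtain w v where q: "q = (w, v)" "w \<in> X" "v \<in> X"
        using \<open>q \<in> X \<times> X\<close> by auto
      have eq: "{p \<in> X \<times> X. map_prod id \<rho> p = q} = (\<lambda>y. (w, y)) ` {y \<in> X. \<rho> y = v}"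
        using q by (auto simp: map_prod_def)
      have sums: "fibre_sum (X \<times> X) (map_prod id \<rho>) T q = fibre_sum X \<rho> (\<lambda>y. T (w, y)) v"
        unfolding fibre_sum_def eq by (subst sum.reindex) (auto simp: inj_on_def)
      show ?thesis
      proof (cases "\<rho> w = w")
        case True
        have "fibre_sum X \<rho> (\<lambda>y. T (w, y)) v =
            (\<Sum>y\<in>{y \<in> X. \<rho> y = v}. \<Sum>x\<in>{x \<in> X. \<rho> x = w}. f (x, y))"
          using True q(2) by (simp add: fibre_sum_def T_def)
        also have "\<dots> = (\<Sum>p\<in>{x \<in> X. \<rho> x = w} \<times> {y \<in> X. \<rho> y = v}. f p)"
          by (subst sum.swap) (simp add: sum.cartesian_product)
        also have "\<dots> = fibre_sum (X \<times> X) (map_prod \<rho> \<rho>) f q"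
          unfolding fibre_sum_def q by (intro sum.cong) (auto simp: map_prod_def)
        finally show ?thesis
          using zero[OF \<open>q \<in> X \<times> X\<close>] by (simp add: sums)
      next
        case False
        then show ?thesis
          by (simp add: sums, simp add: fibre_sum_def T_def)
      qed
    qed
  qed (use \<rho> in \<open>auto simp: R inj_on_def tensor_diff_right tensor_delta\<close>)
  moreover have "f = (f - T) + T"
    by simp
  ultimately show "f \<in> ?L"
    by blast
qed

lemma ideal_eq:
  assumes \<rho>: "\<rho> \<in> X \<rightarrow> X" "\<And>x. x \<in> X \<Longrightarrow> \<rho> (\<rho> x) = \<rho> x"
    and fin: "\<And>x. finite {y \<in> X. \<rho> y = x}"
    and R: "R = {(x, y). x \<in> X \<and> y \<in> X \<and> \<rho> x = \<rho> y}"
  shows "cspan R (\<lambda>(w, u). delta w - delta u) =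
     {f. (\<forall>x. x \<notin> X \<longrightarrow> f x = 0) \<and> (\<forall>x\<in>X. fibre_sum X \<rho> f x = 0)}" (is "?L = ?R")
proof (intro Set.equalityI subsetI)
  fix f
  assume f: "f \<in> ?L"
  have "f x = 0" if "x \<notin> X" for x
    by (rule cspan_eq_zero[OF f]) (use that in \<open>auto simp: R delta_def\<close>)
  moreover have "fibre_sum X \<rho> f x = 0" if x: "x \<in> X" for x
  proof -
    have delta: "(\<Sum>y\<in>{y \<in> X. \<rho> y = x}. delta z y) = of_bool (z \<in> X \<and> \<rho> z = x)" for z
      using fin by (simp add: delta_def of_bool_def)
    show ?thesis
      unfolding fibre_sum_def
      by (rule sum_cspan_eq_zero[OF f fin]) (auto simp: R sum_subtractf delta)
  qed
  ultimately show "f \<in> ?R"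
    by simp
next
  fix f
  assume "f \<in> ?R"
  then show "f \<in> ?L"
    by (intro mem_cspan_differences[where \<rho> = \<rho> and X = X and j = "\<lambda>x. (x, \<rho> x)"])
      (use \<rho> fin in \<open>auto simp: R inj_on_def\<close>)
qed

section \<open>Set sequences as increasing lists\<close>

definition mono_of :: "(nat \<times> nat) list \<Rightarrow> monomial" where
  "mono_of l = (\<Sum>p\<leftarrow>l. Poly_Mapping.single (fst p) 1)"

definition enc_lists :: "nat list \<Rightarrow> (nat \<times> nat) list set" where
  "enc_lists z = {l. sorted_wrt (<) l \<and> remdups_adj (map snd l) = z \<and> (\<forall>p\<in>set l. 1 \<le> fst p)}"

fun enc :: "nat set list \<Rightarrow> nat list \<Rightarrow> (nat \<times> nat) list" where
  "enc (s # \<rho>) (a # z) = map (\<lambda>r. (r, a)) (sorted_list_of_set s) @ enc \<rho> z"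
| "enc _ _ = []"

lemma mono_of_simps [simp]:
  "mono_of [] = 0"
  "mono_of (p # l) = Poly_Mapping.single (fst p) 1 + mono_of l"
  "mono_of (l @ l') = mono_of l + mono_of l'"
  by (simp_all add: mono_of_def)

lemma set_sequences_Nil [simp]: "set_sequences [] = {[]}"
  by (auto simp: set_sequences_def)

lemma set_sequences_Cons:
  "s # \<rho> \<in> set_sequences (a # z) \<longleftrightarrow>
    finite s \<and> s \<noteq> {} \<and> s \<subseteq> {1..} \<and> \<rho> \<in> set_sequences z \<and>
    (z \<noteq> [] \<longrightarrow> (a < hd z \<longrightarrow> Max s \<le> Min (hd \<rho>)) \<and> (hd z < a \<longrightarrow> Max s < Min (hd \<rho>)))"
  (is "?l \<longleftrightarrow> ?r")
proof -
  have all: "(\<forall>i. Q i) \<longleftrightarrow> Q 0 \<and> (\<forall>i. Q (Suc i))" for Q :: "nat \<Rightarrow> bool"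
    by (metis not0_implies_Suc)
  have *: "(\<forall>i. Suc i < length (a # z) \<longrightarrow> P i) \<longleftrightarrow>
      (z \<noteq> [] \<longrightarrow> P 0) \<and> (\<forall>i. Suc i < length z \<longrightarrow> P (Suc i))" for P
    by (subst all) auto
  show ?thesis
    unfolding set_sequences_def mem_Collect_eq *
    by (cases z; cases \<rho>) auto
qed

lemma enc_lists_Nil [simp]: "enc_lists [] = {[]}"
  by (auto simp: enc_lists_def)

lemma enc_lists_hd:
  assumes "l \<in> enc_lists z"
  shows "l = [] \<longleftrightarrow> z = []" "z \<noteq> [] \<Longrightarrow> snd (hd l) = hd z"
proof -
  show *: "l = [] \<longleftrightarrow> z = []"
    using assms by (auto simp: enc_lists_def)
  show "snd (hd l) = hd z" if "z \<noteq> []"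
    using that * assms hd_remdups_adj[of "map snd l"] by (auto simp: enc_lists_def hd_map)
qed

lemma remdups_adj_replicate_append:
  assumes "xs \<noteq> []" "set xs = {a}" "ys = [] \<or> hd ys \<noteq> a"
  shows "remdups_adj (xs @ ys) = a # remdups_adj ys"
proof -
  obtain n where n: "length xs = Suc n"
    using assms(1) by (cases xs) auto
  have "xs = replicate (Suc n) a"
    using assms(2) by (simp add: replicate_length_same flip: n)
  then have "remdups_adj xs = [a]" "last xs = a"
    by (simp_all only: remdups_adj_replicate last_replicate) auto
  then show ?thesis
    using assms(3) by (subst remdups_adj_append') auto
qed

lemma enc_lists_ConsI:
  assumes "l \<in> enc_lists z" "finite s" "s \<noteq> {}" "s \<subseteq> {1..}" "z \<noteq> [] \<Longrightarrow> a \<noteq> hd z"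
    and "z \<noteq> [] \<Longrightarrow> (Max s, a) < hd l"
  shows "map (\<lambda>r. (r, a)) (sorted_list_of_set s) @ l \<in> enc_lists (a # z)"
proof -
  let ?m = "map (\<lambda>r. (r, a)) (sorted_list_of_set s)"
  have "x < y" if "x \<in> set ?m" "y \<in> set l" for x y
  proof -
    have "z \<noteq> []"
      using that enc_lists_hd(1)[OF assms(1)] by auto
    have "x \<le> (Max s, a)"
      using that(1) assms(2) by auto
    also have "\<dots> < hd l"
      using assms(6) \<open>z \<noteq> []\<close> .
    also have "hd l \<le> y"
      using that(2) assms(1) by (cases l) (auto simp: enc_lists_def)
    finally show ?thesis .
  qed
  moreover have "sorted_wrt (<) ?m"
    by (simp add: sorted_wrt_map)
  moreover have "remdups_adj (map snd (?m @ l)) = a # remdups_adj (map snd l)"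
    unfolding map_append
    using assms enc_lists_hd[OF assms(1)] by (intro remdups_adj_replicate_append) (auto simp: hd_map)
  ultimately show ?thesis
    using assms by (auto simp: enc_lists_def sorted_wrt_append)
qed

text \<open>The first block is the maximal initial run of the letter \<open>a\<close>. With a
  constant letter, strict increase means strictly increasing indices, so the block is determined by
  its set of indices.\<close>

lemma enc_lists_ConsE:
  assumes "l \<in> enc_lists (a # z)"
  obtains s l' where "l = map (\<lambda>r. (r, a)) (sorted_list_of_set s) @ l'" "l' \<in> enc_lists z"
    "finite s" "s \<noteq> {}" "s \<subseteq> {1..}" "z = [] \<or> (Max s, a) < hd l'"
proof -
  define m where "m = takeWhile (\<lambda>p. snd p = a) l"
  define l' where "l' = dropWhile (\<lambda>p. snd p = a) l"
  define s where "s = fst ` set m"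
  have l: "l = m @ l'"
    by (simp add: m_def l'_def)
  have sorted: "sorted_wrt (<) m" "sorted_wrt (<) l'" and less: "\<And>x y. x \<in> set m \<Longrightarrow> y \<in> set l' \<Longrightarrow> x < y"
    and pos: "\<And>p. p \<in> set l \<Longrightarrow> 1 \<le> fst p"
    and red: "remdups_adj (map snd l) = a # z"
    using assms by (auto simp: enc_lists_def l sorted_wrt_append)
  have snd_m: "snd p = a" if "p \<in> set m" for p
    using that by (auto simp: m_def dest: set_takeWhileD)
  have "m \<noteq> []"
    using enc_lists_hd[OF assms] by (cases l) (auto simp: m_def)
  have "map (\<lambda>r. (r, a)) (map fst m) = m"
    unfolding map_map by (rule map_idI) (simp add: snd_m prod_eq_iff)
  moreover have "sorted_list_of_set s = map fst m"
  proof -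
    have "sorted_wrt (<) (map fst m)"
      using sorted(1) unfolding sorted_wrt_map
      by (rule sorted_wrt_mono_rel[rotated]) (auto simp: less_prod_def' snd_m)
    then show ?thesis
      unfolding s_def by (metis list.set_map sorted_list_of_set.idem_if_sorted_distinct strict_sorted_iff)
  qed
  ultimately have m: "m = map (\<lambda>r. (r, a)) (sorted_list_of_set s)"
    by simp
  have hd_l': "l' = [] \<or> hd (map snd l') \<noteq> a"
    using hd_dropWhile[of "\<lambda>p. snd p = a" l] by (fold l'_def) (auto simp: hd_map)
  have "remdups_adj (map snd m @ map snd l') = a # remdups_adj (map snd l')"
  proof (rule remdups_adj_replicate_append)
    show "set (map snd m) = {a}"
      using \<open>m \<noteq> []\<close> snd_m by (cases m) (auto simp del: split_paired_All)
  qed (use \<open>m \<noteq> []\<close> hd_l' in auto)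
  then have "remdups_adj (map snd l') = z"
    using red by (simp add: l)
  then have l': "l' \<in> enc_lists z"
    using sorted(2) pos by (auto simp: enc_lists_def l)
  have "finite s" "s \<noteq> {}"
    using \<open>m \<noteq> []\<close> by (auto simp: s_def)
  moreover have "s \<subseteq> {1..}"
    using pos by (auto simp: s_def l)
  moreover have "(Max s, a) < hd l'" if "z \<noteq> []"
  proof (rule less)
    have "(Max s, a) \<in> (\<lambda>r. (r, a)) ` s"
      using \<open>finite s\<close> \<open>s \<noteq> {}\<close> by auto
    then show "(Max s, a) \<in> set m"
      by (simp add: m \<open>finite s\<close>)
    show "hd l' \<in> set l'"
      using that enc_lists_hd(1)[OF l'] by auto
  qed
  ultimately show ?thesis
    using that l' l m by blast
qed

lemma enc_unique:
  fixes a :: nat and l :: "(nat \<times> nat) list"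
  assumes "map (\<lambda>r. (r, a)) (sorted_list_of_set s) @ l = map (\<lambda>r. (r, a)) (sorted_list_of_set s') @ l'"
    and "l = [] \<or> snd (hd l) \<noteq> a" "l' = [] \<or> snd (hd l') \<noteq> a" "finite s" "finite s'"
  shows "s = s'" "l = l'"
proof -
  have *: "takeWhile (\<lambda>p. snd p = a) (map (\<lambda>r. (r, a)) (sorted_list_of_set t) @ k) =
      map (\<lambda>r. (r, a)) (sorted_list_of_set t)"
    if "k = [] \<or> snd (hd k) \<noteq> a" for t and k :: "(nat \<times> nat) list"
    using that by (subst takeWhile_append2) (auto, cases k, auto)
  have eq: "map (\<lambda>r. (r, a)) (sorted_list_of_set s) = map (\<lambda>r. (r, a)) (sorted_list_of_set s')"
    using arg_cong[OF assms(1), of "takeWhile (\<lambda>p. snd p = a)"]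
    unfolding *[OF assms(2)] *[OF assms(3)] .
  show "l = l'"
    using assms(1) unfolding eq by simp
  have "set (sorted_list_of_set s) = set (sorted_list_of_set s')"
    using arg_cong[OF eq, of "map fst"] by (simp add: comp_def)
  then show "s = s'"
    using assms(4,5) by simp
qed

lemma hd_enc:
  assumes "\<rho> \<in> set_sequences z" "z \<noteq> []"
  shows "hd (enc \<rho> z) = (Min (hd \<rho>), hd z)"
proof -
  obtain a z' s \<rho>' where eq: "z = a # z'" "\<rho> = s # \<rho>'"
    using assms by (cases z; cases \<rho>) (auto simp: set_sequences_def)
  have "finite s" "s \<noteq> {}"
    using assms(1) by (auto simp: eq set_sequences_Cons)
  then have "sorted_list_of_set s \<noteq> []" "hd (sorted_list_of_set s) = Min s"
    by (auto simp: sorted_list_of_set_nonempty)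
  then show ?thesis
    by (simp add: eq hd_append hd_map)
qed

lemma set_sequences_ConsE:
  assumes "\<rho> \<in> set_sequences (a # z)"
  obtains s \<rho>' where "\<rho> = s # \<rho>'"
  using assms by (cases \<rho>) (auto simp: set_sequences_def)

text \<open>\<open>distinct_adj\<close> keeps neighbouring blocks from merging into one run, so
  blocks can be read off the list; it also excludes equal neighbours, on which
  \<open>set_sequences\<close> imposes no condition.\<close>

lemma bij_betw_enc:
  "distinct_adj z \<Longrightarrow> bij_betw (\<lambda>\<rho>. enc \<rho> z) (set_sequences z) (enc_lists z)"
proof (induction z)
  case Nil
  then show ?case
    by (simp add: bij_betw_def)
next
  case (Cons a z)
  have dist: "distinct_adj z" and ne: "z \<noteq> [] \<Longrightarrow> a \<noteq> hd z"
    using Cons.prems by (auto simp: distinct_adj_Cons)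
  note IH = Cons.IH[OF dist]
  have mem: "enc \<rho> z \<in> enc_lists z" if "\<rho> \<in> set_sequences z" for \<rho>
    using IH that by (auto simp: bij_betw_def)
  have hd: "enc \<rho> z = [] \<or> snd (hd (enc \<rho> z)) \<noteq> a" if "\<rho> \<in> set_sequences z" for \<rho>
    using enc_lists_hd[OF mem[OF that]] ne by auto
  \<comment> \<open>At one boundary the two implications on \<open>Max\<close> and
    \<open>Min\<close> become a single lexicographic comparison with the head of the rest.\<close>
  have cond: "s # \<rho> \<in> set_sequences (a # z) \<longleftrightarrow>
      finite s \<and> s \<noteq> {} \<and> s \<subseteq> {1..} \<and> \<rho> \<in> set_sequences z \<and>
      (z \<noteq> [] \<longrightarrow> (Max s, a) < hd (enc \<rho> z))" for s \<rho>
    unfolding set_sequences_Cons using ne hd_enc[of \<rho> z] by (auto simp: less_prod_def)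
  show ?case
    unfolding bij_betw_def
  proof
    show "inj_on (\<lambda>\<rho>. enc \<rho> (a # z)) (set_sequences (a # z))"
    proof (rule inj_onI)
      fix \<rho> \<rho>'
      assume *: "\<rho> \<in> set_sequences (a # z)" "\<rho>' \<in> set_sequences (a # z)"
        and eq: "enc \<rho> (a # z) = enc \<rho>' (a # z)"
      obtain s \<sigma> s' \<sigma>' where \<rho>: "\<rho> = s # \<sigma>" "\<rho>' = s' # \<sigma>'"
        using * by (elim set_sequences_ConsE)
      have \<sigma>: "finite s" "finite s'" "\<sigma> \<in> set_sequences z" "\<sigma>' \<in> set_sequences z"
        using * by (auto simp: \<rho> set_sequences_Cons)
      have "s = s'" "enc \<sigma> z = enc \<sigma>' z"
        using enc_unique[OF eq[unfolded \<rho> enc.simps]] \<sigma> hd by auto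
      then show "\<rho> = \<rho>'"
        using IH \<sigma> by (auto simp: \<rho> bij_betw_def inj_on_def)
    qed
    show "(\<lambda>\<rho>. enc \<rho> (a # z)) ` set_sequences (a # z) = enc_lists (a # z)"
    proof (intro Set.equalityI subsetI)
      fix l
      assume "l \<in> (\<lambda>\<rho>. enc \<rho> (a # z)) ` set_sequences (a # z)"
      then obtain \<rho> where "\<rho> \<in> set_sequences (a # z)" "l = enc \<rho> (a # z)"
        by blast
      moreover from this obtain s \<sigma> where "\<rho> = s # \<sigma>"
        by (elim set_sequences_ConsE)
      ultimately show "l \<in> enc_lists (a # z)"
        using ne mem by (auto simp: cond intro!: enc_lists_ConsI)
    next
      fix l
      assume "l \<in> enc_lists (a # z)"
      then obtain s l' where l: "l = map (\<lambda>r. (r, a)) (sorted_list_of_set s) @ l'" "l' \<in> enc_lists z"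
        "finite s" "s \<noteq> {}" "s \<subseteq> {1..}" "z = [] \<or> (Max s, a) < hd l'"
        by (rule enc_lists_ConsE)
      obtain \<sigma> where "\<sigma> \<in> set_sequences z" "l' = enc \<sigma> z"
        using IH l(2) by (auto simp: bij_betw_def)
      then have "s # \<sigma> \<in> set_sequences (a # z)" "l = enc (s # \<sigma>) (a # z)"
        using l by (auto simp: cond)
      then show "l \<in> (\<lambda>\<rho>. enc \<rho> (a # z)) ` set_sequences (a # z)"
        by blast
    qed
  qed
qed

lemma mono_of_enc:
  "\<rho> \<in> set_sequences z \<Longrightarrow> mono_of (enc \<rho> z) = set_monomial \<rho>"
proof (induction z arbitrary: \<rho>)
  case Nil
  then show ?case
    by (simp add: set_monomial_def)
next
  case (Cons a z)
  obtain s \<sigma> where \<rho>: "\<rho> = s # \<sigma>"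
    using Cons.prems by (elim set_sequences_ConsE)
  have "finite s" "\<sigma> \<in> set_sequences z"
    using Cons.prems by (auto simp: \<rho> set_sequences_Cons)
  moreover have "mono_of (map (\<lambda>r. (r, a)) (sorted_list_of_set s)) = (\<Sum>r\<in>s. Poly_Mapping.single r 1)"
    using \<open>finite s\<close> by (simp add: mono_of_def comp_def sum_list_distinct_conv_sum_set)
  ultimately show ?case
    using Cons.IH by (simp add: \<rho> set_monomial_def)
qed

section \<open>Counting increasing lists with a given monomial\<close>

definition words_count :: "nat list \<Rightarrow> monomial \<Rightarrow> nat" where
  "words_count z M = card {l \<in> enc_lists z. mono_of l = M}"

lemma card_set_sequences:
  assumes "distinct_adj z"
  shows "card {\<sigma> \<in> set_sequences z. set_monomial \<sigma> = M} = words_count z M"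
proof -
  have "bij_betw (\<lambda>\<rho>. enc \<rho> z) {\<sigma> \<in> set_sequences z. set_monomial \<sigma> = M} {l \<in> enc_lists z. mono_of l = M}"
  proof (rule bij_betw_subset[OF bij_betw_enc[OF assms]])
    have eq: "(\<lambda>\<rho>. enc \<rho> z) ` set_sequences z = enc_lists z"
      using bij_betw_enc[OF assms] by (simp add: bij_betw_def)
    show "(\<lambda>\<rho>. enc \<rho> z) ` {\<sigma> \<in> set_sequences z. set_monomial \<sigma> = M} = {l \<in> enc_lists z. mono_of l = M}"
      unfolding eq[symmetric] by (auto simp: mono_of_enc image_iff cong: conj_cong)
  qed auto
  then show ?thesis
    unfolding words_count_def by (rule bij_betw_same_card)
qed

section \<open>Compositions and descent sets\<close>

lemma Dset_Nil [simp]: "Dset [] = {}"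
  by (simp add: Dset_def)

lemma Dset_Cons: "Dset (a # \<alpha>) = (if \<alpha> = [] then {} else insert a ((+) a ` Dset \<alpha>))"
proof (cases "\<alpha> = []")
  case False
  then have eq: "{1..<length (a # \<alpha>)} = insert 1 (Suc ` {1..<length \<alpha>})"
    by auto
  show ?thesis
    using False unfolding Dset_def eq
    by (simp add: image_image del: image_Suc_atLeastLessThan)
qed (simp add: Dset_def)

lemma Dset_pos: "0 \<notin> set \<alpha> \<Longrightarrow> x \<in> Dset \<alpha> \<Longrightarrow> 0 < x"
  by (cases \<alpha>) (auto simp: Dset_Cons split: if_splits)

lemma Dset_less: "0 \<notin> set \<alpha> \<Longrightarrow> x \<in> Dset \<alpha> \<Longrightarrow> x < sum_list \<alpha>"
proof (induction \<alpha> arbitrary: x)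
  case (Cons a \<alpha>)
  moreover have "\<alpha> \<noteq> [] \<Longrightarrow> 0 < sum_list \<alpha>"
    using Cons.prems(1) by (cases \<alpha>) auto
  ultimately show ?case
    by (auto simp: Dset_Cons split: if_splits)
qed (simp add: Dset_def)

text \<open>The first part is the least element of \<open>Dset\<close>, so it can be read off and
  removed; when only one part remains, the total decides.\<close>

lemma Dset_eqD:
  assumes "0 \<notin> set \<alpha>" "0 \<notin> set \<beta>" "sum_list \<alpha> = sum_list \<beta>" "Dset \<alpha> = Dset \<beta>"
  shows "\<alpha> = \<beta>"
  using assms
proof (induction \<alpha> arbitrary: \<beta>)
  case Nil
  then show ?case
    by (cases \<beta>) auto
next
  case (Cons a \<alpha>)
  obtain b \<beta>' where \<beta>: "\<beta> = b # \<beta>'"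
    using Cons.prems by (cases \<beta>) auto
  show ?case
  proof (cases "\<alpha> = [] \<or> \<beta>' = []")
    case True
    then show ?thesis
      using Cons.prems by (auto simp: \<beta> Dset_Cons split: if_splits)
  next
    case False
    then have eq: "insert a ((+) a ` Dset \<alpha>) = insert b ((+) b ` Dset \<beta>')"
      using Cons.prems by (simp add: \<beta> Dset_Cons)
    have "a = b"
    proof (rule antisym)
      have "b \<in> insert a ((+) a ` Dset \<alpha>)" "a \<in> insert b ((+) b ` Dset \<beta>')"
        using eq by auto
      then show "a \<le> b" "b \<le> a"
        by auto
    qed
    moreover have "a \<notin> (+) a ` Dset \<alpha>" "b \<notin> (+) b ` Dset \<beta>'"
      using Dset_pos[of \<alpha> 0] Dset_pos[of \<beta>' 0] Cons.prems(1,2) by (auto simp: \<beta>)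
    ultimately have "(+) a ` Dset \<alpha> = (+) a ` Dset \<beta>'"
      using eq insert_ident by metis
    then have "Dset \<alpha> = Dset \<beta>'"
      by (simp add: inj_image_eq_iff)
    then show ?thesis
      using Cons.IH[of \<beta>'] Cons.prems \<open>a = b\<close> by (simp add: \<beta>)
  qed
qed

text \<open>The least element of \<open>D\<close> becomes the first part; the rest, shifted down by
  it, is treated recursively.\<close>

lemma ex_composition_Dset:
  "D \<subseteq> {1..<m} \<Longrightarrow> \<exists>\<alpha>\<in>compositions_of m. Dset \<alpha> = D"
proof (induction m arbitrary: D rule: less_induct)
  case (less m)
  show ?case
  proof (cases "D = {}")
    case True
    \<comment> \<open>Parts are positive, so the total 0 calls for the empty composition instead of
      \<open>[0]\<close>.\<close>
    then show ?thesis
      by (intro bexI[of _ "if m = 0 then [] else [m]"]) (auto simp: Dset_def compositions_of_def)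
  next
    case False
    define a where "a = Min D"
    have fin: "finite D"
      using less.prems finite_subset by blast
    then have a: "a \<in> D" and le: "\<And>x. x \<in> D \<Longrightarrow> a \<le> x"
      using False by (auto simp: a_def)
    have "0 < a" "a < m"
      using a less.prems by auto
    have "(\<lambda>x. x - a) ` (D - {a}) \<subseteq> {1..<m - a}"
    proof (rule image_subsetI)
      fix x
      assume "x \<in> D - {a}"
      then have "a < x" "x < m"
        using le[of x] less.prems by auto
      then show "x - a \<in> {1..<m - a}"
        by auto
    qed
    moreover have "m - a < m"
      using \<open>0 < a\<close> \<open>a < m\<close> by simp
    ultimately obtain \<alpha> where \<alpha>: "\<alpha> \<in> compositions_of (m - a)" "Dset \<alpha> = (\<lambda>x. x - a) ` (D - {a})"
      using less.IH by blast
    have "\<alpha> \<noteq> []"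
      using \<alpha>(1) \<open>a < m\<close> by (auto simp: compositions_of_def)
    have "(+) a ` Dset \<alpha> = D - {a}"
      unfolding \<alpha>(2) image_image using le by (simp cong: image_cong_simp)
    then have "Dset (a # \<alpha>) = D"
      using a \<open>\<alpha> \<noteq> []\<close> by (auto simp: Dset_Cons)
    moreover have "a # \<alpha> \<in> compositions_of m"
      using \<alpha>(1) \<open>0 < a\<close> \<open>a < m\<close> by (auto simp: compositions_of_def)
    ultimately show ?thesis
      by blast
  qed
qed

lemma bij_betw_Dset: "bij_betw Dset (compositions_of m) (Pow {1..<m})"
proof (rule bij_betw_imageI)
  show "inj_on Dset (compositions_of m)"
    by (rule inj_onI) (auto simp: compositions_of_def intro: Dset_eqD)
  have "Dset \<alpha> \<subseteq> {1..<m}" if "\<alpha> \<in> compositions_of m" for \<alpha>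
    using that Dset_pos[of \<alpha>] Dset_less[of \<alpha>] by (auto simp: compositions_of_def Suc_le_eq)
  moreover have "D \<in> Dset ` compositions_of m" if "D \<subseteq> {1..<m}" for D
    using ex_composition_Dset[OF that] by auto
  ultimately show "Dset ` compositions_of m = Pow {1..<m}"
    unfolding Set.set_eq_iff Pow_iff image_iff by blast
qed

section \<open>Descent sets of words\<close>

lemma Des_subset: "Des w \<subseteq> {1..<length w}"
  by (auto simp: Des_def)

lemma comp_of_word:
  "comp_of_word w \<in> compositions_of (length w)" "Dset (comp_of_word w) = Des w"
proof -
  have inj: "inj_on Dset (compositions_of (length w))"
    and mem: "Des w \<in> Dset ` compositions_of (length w)"
    using bij_betw_Dset[of "length w"] Des_subset by (simp_all add: bij_betw_def)
  show "comp_of_word w \<in> compositions_of (length w)"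
    unfolding comp_of_word_def by (rule the_inv_into_into[OF inj mem order_refl])
  show "Dset (comp_of_word w) = Des w"
    unfolding comp_of_word_def by (rule f_the_inv_into_f[OF inj mem])
qed

lemma comp_of_word_eq_iff:
  "comp_of_word w = comp_of_word u \<longleftrightarrow> length w = length u \<and> Des w = Des u"
proof
  assume eq: "comp_of_word w = comp_of_word u"
  then have "length w = length u"
    using comp_of_word(1)[of w] comp_of_word(1)[of u] by (simp add: compositions_of_def)
  then show "length w = length u \<and> Des w = Des u"
    using eq comp_of_word(2) by metis
qed (simp add: comp_of_word_def)

lemma Des_snoc: "Des (w @ [x]) = Des w \<union> (if w \<noteq> [] \<and> last w > x then {length w} else {})"
proof (cases w rule: rev_cases)
  case (snoc v y)
  then show ?thesis
    by (auto simp: Des_def nth_append less_Suc_eq split: if_splits)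
qed (simp add: Des_def)

lemma Des_map_mono: "(\<And>x y. f x < f y \<longleftrightarrow> x < y) \<Longrightarrow> Des (map f w) = Des w"
  by (auto simp: Des_def)

text \<open>The permutation grows by one letter at the end: a new maximum creates no descent, while
  a new minimum, after the other letters are shifted up, creates one at position
  \<open>m\<close>.\<close>

lemma ex_permutation_Des:
  "D \<subseteq> {1..<m} \<Longrightarrow> \<exists>w. distinct w \<and> set w = {1..m} \<and> Des w = D"
proof (induction m arbitrary: D)
  case 0
  then show ?case
    by (intro exI[of _ "[]"]) (auto simp: Des_def)
next
  case (Suc m)
  have "D - {m} \<subseteq> {1..<m}"
    using Suc.prems by (auto simp: less_Suc_eq)
  then obtain w where w: "distinct w" "set w = {1..m}" "Des w = D - {m}"
    using Suc.IH by blast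
  have len: "length w = m"
    using w(1,2) distinct_card by fastforce
  show ?case
  proof (cases "m \<in> D")
    case True
    then have "w \<noteq> []"
      using Suc.prems len by auto
    then have "1 \<le> last w"
      using w(2) last_in_set[of w] by auto
    have "Des (map Suc w @ [1]) = D"
      using True w(3) \<open>w \<noteq> []\<close> \<open>1 \<le> last w\<close> len by (auto simp: Des_snoc Des_map_mono last_map)
    moreover have "distinct (map Suc w @ [1])" "set (map Suc w @ [1]) = {1..Suc m}"
      using w(1,2) by (auto simp: distinct_map image_Suc_atLeastAtMost)
    ultimately show ?thesis
      by blast
  next
    case False
    have "\<not> (w \<noteq> [] \<and> last w > Suc m)"
      using w(2) last_in_set[of w] by fastforce
    then have "Des (w @ [Suc m]) = D"
      using False w(3) by (auto simp: Des_snoc)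
    moreover have "distinct (w @ [Suc m])" "set (w @ [Suc m]) = {1..Suc m}"
      using w(1,2) by auto
    ultimately show ?thesis
      by blast
  qed
qed

lemma perm_of_comp:
  assumes "\<alpha> \<in> compositions"
  shows "distinct (perm_of_comp \<alpha>)" "set (perm_of_comp \<alpha>) = {1..sum_list \<alpha>}"
    "length (perm_of_comp \<alpha>) = sum_list \<alpha>" "comp_of_word (perm_of_comp \<alpha>) = \<alpha>"
proof -
  have \<alpha>: "\<alpha> \<in> compositions_of (sum_list \<alpha>)"
    using assms by (auto simp: compositions_def compositions_of_def)
  then have "Dset \<alpha> \<subseteq> {1..<sum_list \<alpha>}"
    using bij_betw_Dset by (auto simp: bij_betw_def)
  then obtain w where w: "distinct w" "set w = {1..sum_list \<alpha>}" "Des w = Dset \<alpha>"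
    using ex_permutation_Des by blast
  have "length w = sum_list \<alpha>"
    using w(1,2) distinct_card by fastforce
  then have "comp_of_word w = \<alpha>"
    using comp_of_word[of w] \<alpha> w(3) by (intro Dset_eqD) (simp_all add: compositions_of_def)
  then have "w \<in> permutations_of_set {1..sum_list \<alpha>} \<and> comp_of_word w = \<alpha>"
    using w(1,2) by (simp add: permutations_of_set_def)
  then have *: "perm_of_comp \<alpha> \<in> permutations_of_set {1..sum_list \<alpha>} \<and>
      comp_of_word (perm_of_comp \<alpha>) = \<alpha>"
    unfolding perm_of_comp_def by (rule someI)
  then show dist: "distinct (perm_of_comp \<alpha>)" and set: "set (perm_of_comp \<alpha>) = {1..sum_list \<alpha>}"
    unfolding permutations_of_set_def by blast+
  show "comp_of_word (perm_of_comp \<alpha>) = \<alpha>"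
    using * by blast
  show "length (perm_of_comp \<alpha>) = sum_list \<alpha>"
    using distinct_card[OF dist] by (simp add: set)
qed

text \<open>The conditions compare neighbouring letters only, and \<open>distinct_adj\<close> makes
  every non-descent an ascent, so the descent set fixes both kinds of inequality.\<close>

lemma set_sequences_cong:
  assumes "distinct_adj w" "distinct_adj u" "length w = length u" "Des w = Des u"
  shows "set_sequences w = set_sequences u"
proof -
  have Des: "v ! Suc i < v ! i \<longleftrightarrow> Suc i \<in> Des v" if "Suc i < length v" for v i
    using that by (auto simp: Des_def)
  have less: "v ! i < v ! Suc i \<longleftrightarrow> Suc i \<notin> Des v" if "Suc i < length v" "distinct_adj v" for v i
    using distinct_adj_nth[OF that(2,1)] Des[OF that(1)] by auto
  have "(w ! i < w ! Suc i \<longleftrightarrow> u ! i < u ! Suc i) \<and> (w ! Suc i < w ! i \<longleftrightarrow> u ! Suc i < u ! i)"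
    if "Suc i < length u" for i
    using that Des[of i w] Des[of i u] less[of i w] less[of i u] assms by simp
  then show ?thesis
    unfolding set_sequences_def assms(3) by (intro Collect_cong conj_cong refl) metis
qed

lemma distinct_imp_distinct_adj: "distinct w \<Longrightarrow> distinct_adj w"
  by (induction w rule: induct_list012) auto

lemma compositions_comp_of_word [simp]: "comp_of_word w \<in> compositions"
  using comp_of_word(1) by (auto simp: compositions_def)

lemma sum_list_comp_of_word [simp]: "sum_list (comp_of_word w) = length w"
  using comp_of_word(1)[of w] by (simp add: compositions_of_def)

lemma Des_perm_of_comp: "Des (perm_of_comp (comp_of_word w)) = Des w"
  using perm_of_comp(4)[of "comp_of_word w"] by (simp add: comp_of_word_eq_iff)

text \<open>\<open>Ltilde\<close> is defined through an arbitrarily chosen permutation; since only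
  descents enter, its coefficients may be counted on the word itself, repeated letters
  included.\<close>

lemma psi_word_eq:
  assumes "distinct_adj w"
  shows "psi_word w M = int (words_count w M)"
proof -
  let ?p = "perm_of_comp (comp_of_word w)"
  have "set_sequences ?p = set_sequences w"
    using perm_of_comp[of "comp_of_word w"] assms
    by (intro set_sequences_cong) (auto simp: Des_perm_of_comp distinct_imp_distinct_adj)
  then show ?thesis
    by (simp add: psi_word_def Ltilde_def card_set_sequences[OF assms])
qed

lemma Ltilde_eq:
  assumes "\<alpha> \<in> compositions"
  shows "Ltilde \<alpha> = psi_word (perm_of_comp \<alpha>)"
  using perm_of_comp(4)[OF assms] by (simp add: psi_word_def)

section \<open>Linear independence\<close>

definition deg :: "monomial \<Rightarrow> nat" where
  "deg M = (\<Sum>k\<in>Poly_Mapping.keys M. Poly_Mapping.lookup M k)"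

lemma deg_superset:
  "finite K \<Longrightarrow> Poly_Mapping.keys M \<subseteq> K \<Longrightarrow> deg M = (\<Sum>k\<in>K. Poly_Mapping.lookup M k)"
  unfolding deg_def by (rule sum.mono_neutral_left) (auto simp: in_keys_iff)

lemma deg_add [simp]: "deg (M + N) = deg M + deg N"
  using Poly_Mapping.keys_add[of M N]
  by (simp add: deg_superset[of "Poly_Mapping.keys M \<union> Poly_Mapping.keys N"] lookup_add sum.distrib)

lemma deg_zero [simp]: "deg 0 = 0"
  by (simp add: deg_def)

lemma deg_single [simp]: "deg (Poly_Mapping.single r n) = n"
  by (simp add: deg_def)

lemma deg_mono_of [simp]: "deg (mono_of l) = length l"
  by (induction l) simp_all

lemma lookup_mono_of: "Poly_Mapping.lookup (mono_of l) r = count (mset (map fst l)) r"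
  by (induction l) (auto simp: lookup_add lookup_single)

lemma keys_mono_of: "Poly_Mapping.keys (mono_of l) = fst ` set l"
proof -
  have "r \<in> Poly_Mapping.keys (mono_of l) \<longleftrightarrow> r \<in># mset (map fst l)" for r
    unfolding in_keys_iff lookup_mono_of by (simp add: count_eq_zero_iff)
  then show ?thesis
    by auto
qed

text \<open>Factors of \<open>M\<close> have their support in that of \<open>M\<close> and exponents
  at most \<open>deg M\<close>. Without finiteness the sum in \<open>series_mult\<close> would be 0
  by convention.\<close>

lemma finite_monomial_splits: "finite {(A, B). A + B = (M :: monomial)}"
proof -
  have "finite {A. \<exists>B. A + B = M}"
  proof (rule finite_imageD[of Poly_Mapping.lookup])
    let ?F = "{f. \<forall>k. (k \<in> Poly_Mapping.keys M \<longrightarrow> f k \<in> {..deg M}) \<and>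
        (k \<notin> Poly_Mapping.keys M \<longrightarrow> f k = (0::nat))}"
    have "finite ?F"
      by (rule finite_set_of_finite_funs) simp_all
    moreover have "Poly_Mapping.lookup ` {A. \<exists>B. A + B = M} \<subseteq> ?F"
    proof (rule image_subsetI)
      fix A
      assume "A \<in> {A. \<exists>B. A + B = M}"
      then obtain B where M: "M = A + B"
        by blast
      have "Poly_Mapping.lookup A k \<le> deg M" for k
      proof (cases "k \<in> Poly_Mapping.keys A")
        case True
        then have "Poly_Mapping.lookup A k \<le> deg A"
          unfolding deg_def by (intro member_le_sum) auto
        then show ?thesis
          by (simp add: M)
      qed (simp add: in_keys_iff)
      moreover have "Poly_Mapping.lookup A k = 0" if "k \<notin> Poly_Mapping.keys M" for k
        using that by (simp add: M in_keys_iff lookup_add)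
      ultimately show "Poly_Mapping.lookup A \<in> ?F"
        by simp
    qed
    ultimately show "finite (Poly_Mapping.lookup ` {A. \<exists>B. A + B = M})"
      by (rule rev_finite_subset)
  qed (rule inj_onI, rule poly_mapping_eq_iff[THEN iffD2])
  then have "finite ((\<lambda>A. (A, M - A)) ` {A. \<exists>B. A + B = M})"
    by simp
  moreover have "{(A, B). A + B = M} \<subseteq> (\<lambda>A. (A, M - A)) ` {A. \<exists>B. A + B = M}"
    by auto
  ultimately show ?thesis
    by (rule rev_finite_subset)
qed

lemma enc_lists_length: "l \<in> enc_lists z \<Longrightarrow> length z \<le> length l"
  using remdups_adj_length[of "map snd l"] by (auto simp: enc_lists_def)

lemma enc_lists_set: "l \<in> enc_lists z \<Longrightarrow> snd ` set l = set z"
  unfolding enc_lists_def mem_Collect_eq by (metis remdups_adj_set list.set_map)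

lemma finite_enc_lists: "finite {l \<in> enc_lists z. mono_of l = M}"
proof (rule finite_subset)
  show "{l \<in> enc_lists z. mono_of l = M} \<subseteq>
      {l. set l \<subseteq> Poly_Mapping.keys M \<times> set z \<and> length l = deg M}"
  proof
    fix l
    assume "l \<in> {l \<in> enc_lists z. mono_of l = M}"
    then have l: "l \<in> enc_lists z" "M = mono_of l"
      by simp_all
    show "l \<in> {l. set l \<subseteq> Poly_Mapping.keys M \<times> set z \<and> length l = deg M}"
      using subset_fst_snd[of "set l"] by (simp add: l(2) keys_mono_of enc_lists_set[OF l(1)])
  qed
  show "finite {l. set l \<subseteq> Poly_Mapping.keys M \<times> set z \<and> length l = deg M}"
    by (rule finite_lists_length_eq) simp
qed

text \<open>Every letter of \<open>z\<close> consumes at least one pair of the list. This degree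
  bound is the source of the convergence of \<open>psi\<close> and of the truncations by word length
  below.\<close>

lemma words_count_eq_0: "deg M < length z \<Longrightarrow> words_count z M = 0"
proof -
  assume "deg M < length z"
  then have empty: "{l \<in> enc_lists z. mono_of l = M} = {}"
    by (auto dest: enc_lists_length)
  show ?thesis
    unfolding words_count_def empty by simp
qed

lemma mpermsD:
  assumes "w \<in> mperms"
  shows "distinct_adj w" "set w = {1..card (set w)}" "set w \<subseteq> {1..length w}"
proof -
  obtain n where n: "set w = {1..n}" "distinct_adj w"
    using assms by (auto simp: mperms_def mperm_def)
  then show "distinct_adj w" "set w = {1..card (set w)}"
    by simp_all
  show "set w \<subseteq> {1..length w}"
    using card_length[of w] n(1) by auto
qed

text \<open>Letters fill an initial interval and are therefore bounded by the length. Bounding the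
  number of distinct letters would not suffice, as 12, 121, 1212, ... show.\<close>

lemma finite_mperms_length: "finite {w \<in> mperms. length w \<le> d}"
proof (rule finite_subset)
  show "{w \<in> mperms. length w \<le> d} \<subseteq> {w. set w \<subseteq> {1..d} \<and> length w \<le> d}"
    using mpermsD(3) by fastforce
  show "finite {w. set w \<subseteq> {1..d} \<and> length w \<le> d}"
    by (rule finite_lists_length_le) simp
qed

lemma finite_compositions_sum: "finite {\<alpha> \<in> compositions. sum_list \<alpha> \<le> d}"
proof -
  have "finite (compositions_of m)" for m
    using bij_betw_Dset[of m] by (simp add: bij_betw_finite)
  moreover have "{\<alpha> \<in> compositions. sum_list \<alpha> \<le> d} = (\<Union>m\<in>{..d}. compositions_of m)"
    by (auto simp: compositions_def compositions_of_def)
  ultimately show ?thesis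
    by simp
qed

lemma perm_of_comp_in_mperms: "\<alpha> \<in> compositions \<Longrightarrow> perm_of_comp \<alpha> \<in> mperms"
  using perm_of_comp[of \<alpha>] by (auto simp: mperms_def mperm_def distinct_imp_distinct_adj)

lemma Ltilde_words_count:
  "\<alpha> \<in> compositions \<Longrightarrow> Ltilde \<alpha> M = int (words_count (perm_of_comp \<alpha>) M)"
  using perm_of_comp[of \<alpha>] by (simp add: Ltilde_eq psi_word_eq distinct_imp_distinct_adj)

lemma locally_finite_Ltilde: "locally_finite compositions Ltilde"
  unfolding locally_finite_def
proof
  fix M
  have "{\<alpha> \<in> compositions. Ltilde \<alpha> M \<noteq> 0} \<subseteq> {\<alpha> \<in> compositions. sum_list \<alpha> \<le> deg M}"
  proof (rule Collect_mono, rule impI, elim conjE)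
    fix \<alpha>
    assume "\<alpha> \<in> compositions" "Ltilde \<alpha> M \<noteq> 0"
    then show "\<alpha> \<in> compositions \<and> sum_list \<alpha> \<le> deg M"
      using words_count_eq_0[of M "perm_of_comp \<alpha>"] perm_of_comp(3)[of \<alpha>]
      by (cases "sum_list \<alpha> \<le> deg M") (simp_all add: Ltilde_words_count)
  qed
  then show "finite {\<alpha> \<in> compositions. Ltilde \<alpha> M \<noteq> 0}"
    using finite_compositions_sum finite_subset by blast
qed

section \<open>Tensor products of locally finite and independent families\<close>

lemma locally_finite_tensor:
  assumes "locally_finite K L" "locally_finite K' L'"
  shows "locally_finite (K \<times> K') (\<lambda>(a, b). tensor (L a) (L' b))"
  unfolding locally_finite_def
proof
  fix p :: "'b \<times> 'd"
  have "{x \<in> K \<times> K'. (case x of (a, b) \<Rightarrow> tensor (L a) (L' b)) p \<noteq> 0} =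
      {a \<in> K. L a (fst p) \<noteq> 0} \<times> {b \<in> K'. L' b (snd p) \<noteq> 0}"
    by (cases p) (auto simp: tensor_def)
  then show "finite {x \<in> K \<times> K'. (case x of (a, b) \<Rightarrow> tensor (L a) (L' b)) p \<noteq> 0}"
    using assms by (simp add: locally_finite_def)
qed

text \<open>Fixing the second coordinate \<open>N\<close> gives a relation in the first family, so
  its coefficients vanish; as \<open>N\<close> varies, these are the coordinates of a relation in
  the second family.\<close>

lemma independent_family_tensor:
  assumes "locally_finite K L" "locally_finite K' L'"
    and "independent_family K L" "independent_family K' L'"
  shows "independent_family (K \<times> K') (\<lambda>(a, b). tensor (L a) (L' b))"
  unfolding independent_family_def
proof (intro allI impI ballI)
  fix c q
  assume zero: "lincomb (K \<times> K') c (\<lambda>(a, b). tensor (L a) (L' b)) = 0" and q: "q \<in> K \<times> K'"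
  have "lincomb K (\<lambda>a. lincomb K' (\<lambda>b. c (a, b)) L' N) L = 0" for N
  proof
    fix M
    let ?S = "{a \<in> K. L a M \<noteq> 0}" and ?T = "{b \<in> K'. L' b N \<noteq> 0}"
    have fin: "finite ?S" "finite ?T"
      using assms by (simp_all add: locally_finite_def)
    have "lincomb K (\<lambda>a. lincomb K' (\<lambda>b. c (a, b)) L' N) L M =
        (\<Sum>a\<in>?S. (\<Sum>b\<in>?T. c (a, b) * L' b N) * L a M)"
      by (simp add: lincomb_locally_finite[OF assms(1)] lincomb_locally_finite[OF assms(2)])
    also have "\<dots> = (\<Sum>(a, b)\<in>?S \<times> ?T. c (a, b) * (L a M * L' b N))"
      by (simp add: sum.cartesian_product[symmetric] sum_distrib_right sum_distrib_left ac_simps)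
    also have "\<dots> = (\<Sum>p\<in>?S \<times> ?T. c p * (case p of (a, b) \<Rightarrow> tensor (L a) (L' b)) (M, N))"
      by (intro sum.cong) (auto simp: tensor_def)
    also have "\<dots> = lincomb (K \<times> K') c (\<lambda>(a, b). tensor (L a) (L' b)) (M, N)"
      using fin by (intro lincomb_eq_sum[symmetric]) (auto simp: tensor_def)
    finally show "lincomb K (\<lambda>a. lincomb K' (\<lambda>b. c (a, b)) L' N) L M = 0 M"
      by (simp add: zero)
  qed
  then have "lincomb K' (\<lambda>b. c (fst q, b)) L' N = 0" for N
    using assms(3)[unfolded independent_family_def, rule_format] q by (metis mem_Times_iff)
  then have "lincomb K' (\<lambda>b. c (fst q, b)) L' = 0"
    by (simp add: fun_eq_iff)
  then show "c q = 0"
    using assms(4)[unfolded independent_family_def, rule_format] q by (metis mem_Times_iff prod.collapse)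
qed

text \<open>
  The witness is the sequence of singletons that increases by one exactly at the positions in the
  descent set: the leading monomial of the fundamental quasisymmetric function.
\<close>

definition lead_list :: "nat list \<Rightarrow> (nat \<times> nat) list" where
  "lead_list w = map (\<lambda>i. (Suc (card {j \<in> Des w. j \<le> i}), w ! i)) [0..<length w]"

lemma finite_Des [simp]: "finite (Des w)"
  using Des_subset finite_subset by blast

lemma card_Des_Suc:
  "card {j \<in> Des w. j \<le> Suc i} = card {j \<in> Des w. j \<le> i} + of_bool (Suc i \<in> Des w)"
proof (cases "Suc i \<in> Des w")
  case True
  then have "{j \<in> Des w. j \<le> Suc i} = insert (Suc i) {j \<in> Des w. j \<le> i}"
    by (auto simp: le_Suc_eq)
  then show ?thesis
    using True by simp
next
  case False
  then have "{j \<in> Des w. j \<le> Suc i} = {j \<in> Des w. j \<le> i}"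
    by (auto simp: le_Suc_eq)
  then show ?thesis
    using False by simp
qed

lemma sorted_fst: "sorted_wrt (<) (l :: (nat \<times> nat) list) \<Longrightarrow> sorted (map fst l)"
  unfolding sorted_wrt_map by (rule sorted_wrt_mono_rel[of l "(<)"]) (auto simp: less_prod_def')

text \<open>At a descent the index rises; elsewhere it stays and the letter rises. Consecutive pairs
  increase in either case.\<close>

lemma lead_list:
  assumes "distinct w"
  shows "lead_list w \<in> enc_lists w"
proof -
  have "map snd (lead_list w) = w"
    by (simp add: lead_list_def comp_def map_nth)
  then have "remdups_adj (map snd (lead_list w)) = w"
    using assms distinct_adj_altdef distinct_imp_distinct_adj by metis
  moreover have "sorted_wrt (<) (lead_list w)"
  proof -
    have "lead_list w ! i < lead_list w ! Suc i" if "Suc i < length w" for i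
    proof (cases "Suc i \<in> Des w")
      case True
      then show ?thesis
        using that by (simp add: lead_list_def card_Des_Suc)
    next
      case False
      moreover have "w ! i \<noteq> w ! Suc i"
        using that assms by (simp add: nth_eq_iff_index_eq)
      ultimately have "w ! i < w ! Suc i"
        using that by (auto simp: Des_def)
      then show ?thesis
        using that False by (simp add: lead_list_def card_Des_Suc)
    qed
    then show ?thesis
      by (simp add: sorted_wrt_iff_nth_Suc_transp lead_list_def)
  qed
  ultimately show ?thesis
    by (auto simp: enc_lists_def lead_list_def)
qed

lemma words_count_lead_list_self:
  assumes "distinct w"
  shows "words_count w (mono_of (lead_list w)) \<noteq> 0"
  unfolding words_count_def using lead_list[OF assms] finite_enc_lists by (auto simp: card_eq_0_iff)

text \<open>The degree is \<open>length w\<close>, so for \<open>u\<close> at least as long nothing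
  is contracted: the list spells \<open>u\<close>, and its indices are those of
  \<open>lead_list w\<close>. At a descent of \<open>u\<close> the index must rise, and it rises
  only at descents of \<open>w\<close>.\<close>

lemma words_count_lead_list_triangular:
  assumes "words_count u (mono_of (lead_list w)) \<noteq> 0" "length w \<le> length u"
  shows "length u = length w" "Des u \<subseteq> Des w"
proof -
  have "{l \<in> enc_lists u. mono_of l = mono_of (lead_list w)} \<noteq> {}"
    using assms(1) unfolding words_count_def by (metis card.empty)
  then obtain l where l: "l \<in> enc_lists u" "mono_of l = mono_of (lead_list w)"
    by auto
  have "deg (mono_of l) = deg (mono_of (lead_list w))"
    by (simp only: l(2))
  then have len: "length l = length w"
    by (simp add: lead_list_def)
  then show eq: "length u = length w"
    using enc_lists_length[OF l(1)] assms(2) by simp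
  have "sorted_wrt (<) l" "remdups_adj (map snd l) = u"
    using l(1) by (simp_all add: enc_lists_def)
  then have u: "map snd l = u"
    using eq len distinct_adj_altdef distinct_adj_conv_length_remdups_adj by (metis length_map)
  \<comment> \<open>Equal monomials give equal multisets of indices, and both index sequences are
    sorted.\<close>
  have "mset (map fst l) = mset (map fst (lead_list w))"
    using l(2) by (intro multiset_eqI) (metis lookup_mono_of)
  moreover have "sorted (map fst (lead_list w))"
    unfolding lead_list_def
    by (auto simp: sorted_iff_nth_mono intro!: card_mono)
  ultimately have fst_eq: "map fst l = map fst (lead_list w)"
    using sorted_fst[OF \<open>sorted_wrt (<) l\<close>] by (metis properties_for_sort)
  show "Des u \<subseteq> Des w"
  proof
    fix j
    assume "j \<in> Des u"
    then obtain i where i: "j = Suc i" "Suc i < length u" "u ! Suc i < u ! i"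
      by (cases j) (auto simp: Des_def)
    then have "snd (l ! Suc i) < snd (l ! i)"
      using len eq u by (metis Suc_lessD nth_map)
    moreover have "l ! i < l ! Suc i"
      using \<open>sorted_wrt (<) l\<close> i len eq by (simp add: sorted_wrt_nth_less)
    ultimately have "fst (l ! i) < fst (l ! Suc i)"
      by (auto simp: less_prod_def')
    then have "map fst (lead_list w) ! i < map fst (lead_list w) ! Suc i"
      using i len eq by (simp flip: fst_eq)
    then show "j \<in> Des w"
      using i eq by (simp add: lead_list_def card_Des_Suc)
  qed
qed

text \<open>Compositions are ordered by size and then by number of descents. At the leading monomial
  of \<alpha> every other contributing composition is smaller: it has smaller sum, or the same sum
  and a proper subset of the descents.\<close>

lemma independent_family_Ltilde: "independent_family compositions Ltilde"
  unfolding independent_family_def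
proof (intro allI impI ballI)
  fix c \<alpha>
  assume zero: "lincomb compositions c Ltilde = 0"
  assume "\<alpha> \<in> compositions"
  then show "c \<alpha> = 0"
  proof (induction "(sum_list \<alpha>, card (Dset \<alpha>))" arbitrary: \<alpha> rule: less_induct)
    case (less \<alpha>)
    note \<alpha> = less.prems
    let ?p = "perm_of_comp \<alpha>"
    let ?M = "mono_of (lead_list ?p)"
    have Des: "Des (perm_of_comp \<beta>) = Dset \<beta>" if "\<beta> \<in> compositions" for \<beta>
      using comp_of_word(2)[of "perm_of_comp \<beta>"] perm_of_comp(4)[OF that] by simp
    have "c \<beta> * Ltilde \<beta> ?M = 0" if \<beta>: "\<beta> \<in> compositions - {\<alpha>}" for \<beta>
    proof (rule ccontr)
      assume nz: "c \<beta> * Ltilde \<beta> ?M \<noteq> 0"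
      then have count: "words_count (perm_of_comp \<beta>) ?M \<noteq> 0"
        using \<beta> by (auto simp: Ltilde_words_count)
      have "(sum_list \<beta>, card (Dset \<beta>)) < (sum_list \<alpha>, card (Dset \<alpha>))"
      proof (cases "sum_list \<beta> < sum_list \<alpha>")
        case False
        then have "sum_list \<beta> = sum_list \<alpha>" "Dset \<beta> \<subseteq> Dset \<alpha>"
          using words_count_lead_list_triangular[OF count] \<alpha> \<beta> by (auto simp: perm_of_comp Des)
        moreover from this have "Dset \<beta> \<noteq> Dset \<alpha>"
          using \<alpha> \<beta> Dset_eqD[of \<beta> \<alpha>] by (auto simp: compositions_def compositions_of_def)
        moreover have "finite (Dset \<alpha>)"
          by (simp add: Dset_def)
        ultimately show ?thesis
          by (simp add: psubset_card_mono psubsetI)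
      qed simp
      then show False
        using less.hyps[of \<beta>] \<beta> nz by simp
    qed
    then have "lincomb compositions c Ltilde ?M = (\<Sum>\<beta>\<in>{\<alpha>}. c \<beta> * Ltilde \<beta> ?M)"
      using \<alpha> by (intro lincomb_eq_sum) auto
    moreover have "Ltilde \<alpha> ?M \<noteq> 0"
      using words_count_lead_list_self perm_of_comp(1)[OF \<alpha>] by (simp add: Ltilde_words_count[OF \<alpha>])
    ultimately show ?case
      by (simp add: zero)
  qed
qed

section \<open>The product\<close>

lemma multiword_iff:
  assumes "distinct u"
  shows "multiword w u \<longleftrightarrow> remdups_adj w = u"
proof
  assume "multiword w u"
  then obtain t where t: "mono_on {..<length w} t" "t ` {..<length w} = {..<length u}"
    "\<And>j. j < length w \<Longrightarrow> w ! j = u ! t j"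
    by (auto simp: multiword_def)
  have less: "t j < length u" if "j < length w" for j
    using t(2) that by blast
  \<comment> \<open>\<open>remdups_adj_altdef\<close> asks for a monotone map on all naturals, so
    \<open>t\<close> is continued by the constant \<open>length u\<close>.\<close>
  define f where "f i = (if i < length w then t i else length u)" for i
  have "incseq f"
    using t(1) less by (auto simp: f_def incseq_def mono_on_def less_imp_le)
  moreover have "f ` {0..<length w} = {0..<length u}"
    using t(2) by (simp add: f_def atLeast0LessThan)
  moreover have "\<forall>i<length w. w ! i = u ! f i"
    by (simp add: f_def t(3))
  moreover have "\<forall>i. i + 1 < length w \<longrightarrow> (w ! i = w ! (i + 1)) = (f i = f (i + 1))"
    using less assms by (simp add: f_def t(3) nth_eq_iff_index_eq)
  ultimately show "remdups_adj w = u"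
    unfolding remdups_adj_altdef by blast
next
  assume "remdups_adj w = u"
  then obtain f where "incseq f" "f ` {0..<length w} = {0..<length u}" "\<forall>i<length w. w ! i = u ! f i"
    unfolding remdups_adj_altdef by blast
  then show "multiword w u"
    unfolding multiword_def
    by (intro exI[of _ f]) (simp add: atLeast0LessThan mono_on_def incseq_def)
qed

text \<open>Restricting a contracted word can create new equal neighbours, but a final contraction
  removes them. This links restrictions of a star word to restrictions of the uncontracted
  list.\<close>

lemma remdups_adj_filter: "remdups_adj (filter P (remdups_adj xs)) = remdups_adj (filter P xs)"
proof (induction xs rule: remdups_adj.induct)
  case (3 x y xs)
  have cong: "remdups_adj (x # a) = remdups_adj (x # b)" if "remdups_adj a = remdups_adj b" for a b
    using that by (simp only: remdups_adj_Cons)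
  show ?case
  proof (cases "x = y")
    case True
    have "remdups_adj (filter P (x # x # xs)) = remdups_adj (filter P (x # xs))"
      by simp
    then show ?thesis
      using 3(1)[OF True] True by simp
  next
    case False
    have "remdups_adj (filter P (remdups_adj (x # y # xs))) =
        remdups_adj (filter P (x # remdups_adj (y # xs)))"
      using False by simp
    also have "\<dots> = remdups_adj (filter P (x # y # xs))"
      using 3(2)[OF False] cong[OF 3(2)[OF False]]
      by (cases "P x") (simp_all only: filter.simps(2)[of P x] if_True if_False)
    finally show ?thesis .
  qed
qed simp_all

lemma remdups_adj_map_inj_on:
  "inj_on f (set xs) \<Longrightarrow> remdups_adj (map f xs) = map f (remdups_adj xs)"
  by (induction xs rule: remdups_adj.induct) (auto simp: inj_on_def)

lemma star_distinct_iff: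
  assumes "distinct u" "distinct v"
  shows "z \<in> star_distinct u v \<longleftrightarrow> set z \<subseteq> set u \<union> set v \<and> distinct_adj z \<and>
    remdups_adj (filter (\<lambda>a. a \<in> set u) z) = u \<and> remdups_adj (filter (\<lambda>a. a \<in> set v) z) = v"
  using assms by (simp add: star_distinct_def multiword_iff)

lemma star_distinct_map:
  assumes "distinct u" "distinct v" "inj_on f (set u \<union> set v)"
  shows "star_distinct (map f u) (map f v) = map f ` star_distinct u v"
proof -
  have inj: "inj_on f (set u)" "inj_on f (set v)"
    using assms(3) by (auto intro: inj_on_subset)
  have dist: "distinct (map f u)" "distinct (map f v)"
    using assms(1,2) inj by (simp_all add: distinct_map)
  have filter: "filter (\<lambda>a. a \<in> set (map f x)) (map f z) = map f (filter (\<lambda>a. a \<in> set x) z)"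
    if "set z \<subseteq> set u \<union> set v" "set x \<subseteq> set u \<union> set v" for x z
    using that assms(3) by (auto simp: filter_map comp_def inj_on_def intro!: filter_cong arg_cong[of _ _ "map f"])
  have remdups: "remdups_adj (filter (\<lambda>a. a \<in> set (map f x)) (map f z)) = map f x \<longleftrightarrow>
      remdups_adj (filter (\<lambda>a. a \<in> set x) z) = x"
    if "set z \<subseteq> set u \<union> set v" "set x \<subseteq> set u \<union> set v" for x z
  proof -
    have "inj_on f (set z)"
      using that assms(3) by (auto intro: inj_on_subset)
    then have "remdups_adj (filter (\<lambda>a. a \<in> set (map f x)) (map f z)) =
        map f (remdups_adj (filter (\<lambda>a. a \<in> set x) z))"
      unfolding filter[OF that] by (intro remdups_adj_map_inj_on) (auto intro: inj_on_subset)
    moreover have "inj_on f (set (remdups_adj (filter (\<lambda>a. a \<in> set x) z)) \<union> set x)"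
      by (rule inj_on_subset[OF assms(3)]) (use that in auto)
    ultimately show ?thesis
      by (simp add: inj_on_map_eq_map)
  qed
  have iff: "map f z \<in> star_distinct (map f u) (map f v) \<longleftrightarrow> z \<in> star_distinct u v"
    if "set z \<subseteq> set u \<union> set v" for z
  proof -
    have "distinct_adj (map f z) \<longleftrightarrow> distinct_adj z"
      using that assms(3) by (intro distinct_adj_map_iff) (auto intro: inj_on_subset)
    moreover have "f ` set z \<subseteq> f ` set u \<union> f ` set v"
      using that by auto
    ultimately show ?thesis
      unfolding star_distinct_iff[OF assms(1,2)] star_distinct_iff[OF dist]
      using that by (simp add: remdups del: set_map) simp
  qed
  show ?thesis
  proof (intro Set.equalityI subsetI)
    fix y
    assume y: "y \<in> star_distinct (map f u) (map f v)"
    then have "set y \<subseteq> f ` (set u \<union> set v)"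
      by (auto simp: star_distinct_def)
    then have "y \<in> map f ` lists (set u \<union> set v)"
      unfolding lists_image[symmetric] by auto
    then obtain z where "set z \<subseteq> set u \<union> set v" "y = map f z"
      by auto
    then show "y \<in> map f ` star_distinct u v"
      using y iff by blast
  next
    fix y
    assume "y \<in> map f ` star_distinct u v"
    then obtain z where "z \<in> star_distinct u v" "y = map f z"
      by blast
    moreover from this have "set z \<subseteq> set u \<union> set v"
      by (simp add: star_distinct_def)
    ultimately show "y \<in> star_distinct (map f u) (map f v)"
      using iff by blast
  qed
qed

lemma finite_star_distinct_length: "finite {z \<in> star_distinct u v. length z \<le> d}"
proof (rule finite_subset)
  show "{z \<in> star_distinct u v. length z \<le> d} \<subseteq> {z. set z \<subseteq> set u \<union> set v \<and> length z \<le> d}"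
    by (auto simp: star_distinct_def)
  show "finite {z. set z \<subseteq> set u \<union> set v \<and> length z \<le> d}"
    by (rule finite_lists_length_le) simp
qed

lemma mono_of_filter: "mono_of l = mono_of (filter P l) + mono_of (filter (\<lambda>x. \<not> P x) l)"
  by (induction l) (simp_all add: ac_simps)

text \<open>A strictly increasing list amounts to its finite set of pairs, so two lists merge
  uniquely into the sorted list of their union. Disjoint alphabets ensure that no pair is shared:
  monomials multiply, and each part is recovered by its letters.\<close>

lemma bij_betw_restrict:
  fixes p q :: "nat list"
  assumes "distinct p" "distinct q" "set p \<inter> set q = {}"
  shows "bij_betw (\<lambda>l. (filter (\<lambda>x. snd x \<in> set p) l, filter (\<lambda>x. snd x \<in> set q) l))
    {l. \<exists>z\<in>star_distinct p q. l \<in> enc_lists z \<and> mono_of l = M}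
    {(l, l'). l \<in> enc_lists p \<and> l' \<in> enc_lists q \<and> mono_of l + mono_of l' = M}"
    (is "bij_betw ?f ?L ?R")
proof (rule bij_betw_imageI)
  have set: "snd ` set l \<subseteq> set p \<union> set q" if "z \<in> star_distinct p q" "l \<in> enc_lists z" for l z
    using enc_lists_set[OF that(2)] that(1) by (simp add: star_distinct_def)
  show "inj_on ?f ?L"
  proof (rule inj_onI)
    fix l l'
    assume *: "l \<in> ?L" "l' \<in> ?L" "?f l = ?f l'"
    have "set l = set (filter (\<lambda>x. snd x \<in> set p) l) \<union> set (filter (\<lambda>x. snd x \<in> set q) l)"
      "set l' = set (filter (\<lambda>x. snd x \<in> set p) l') \<union> set (filter (\<lambda>x. snd x \<in> set q) l')"
      using *(1,2) set by fastforce+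
    then have "set l' = set l"
      using *(3) by (simp only: prod.inject)
    moreover have "sorted_wrt (<) l" "sorted_wrt (<) l'"
      using *(1,2) by (auto simp: enc_lists_def)
    ultimately show "l = l'"
      by (metis strict_sorted_equal)
  qed
  have restrict: "filter (\<lambda>x. snd x \<in> set r) l \<in> enc_lists r"
    if "sorted_wrt (<) l" "\<forall>x\<in>set l. 1 \<le> fst x"
      "remdups_adj (filter (\<lambda>a. a \<in> set r) (remdups_adj (map snd l))) = r" for r l
    using that unfolding remdups_adj_filter
    by (auto simp: enc_lists_def filter_map comp_def sorted_wrt_filter)
  have split: "mono_of l = mono_of (filter (\<lambda>x. snd x \<in> set p) l) + mono_of (filter (\<lambda>x. snd x \<in> set q) l)"
    if "snd ` set l \<subseteq> set p \<union> set q" for l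
  proof -
    have "filter (\<lambda>x. \<not> snd x \<in> set p) l = filter (\<lambda>x. snd x \<in> set q) l"
      using that assms(3) by (intro filter_cong) auto
    then show ?thesis
      using mono_of_filter[of l "\<lambda>x. snd x \<in> set p"] by simp
  qed
  show "?f ` ?L = ?R"
  proof (intro Set.equalityI subsetI)
    fix y
    assume "y \<in> ?f ` ?L"
    then obtain l z where y: "y = ?f l" and l: "z \<in> star_distinct p q" "l \<in> enc_lists z" "mono_of l = M"
      by blast
    have z: "sorted_wrt (<) l" "\<forall>x\<in>set l. 1 \<le> fst x" "z = remdups_adj (map snd l)"
      using l(2) by (auto simp: enc_lists_def)
    have "remdups_adj (filter (\<lambda>a. a \<in> set p) z) = p" "remdups_adj (filter (\<lambda>a. a \<in> set q) z) = q"
      using l(1) by (simp_all add: star_distinct_iff[OF assms(1,2)])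
    then show "y \<in> ?R"
      using restrict[OF z(1,2)] split[OF set[OF l(1,2)]] l(3) by (simp add: y z(3))
  next
    fix y
    assume "y \<in> ?R"
    then obtain l1 l2 where y: "y = (l1, l2)" and
      l: "l1 \<in> enc_lists p" "l2 \<in> enc_lists q" "mono_of l1 + mono_of l2 = M"
      by blast
    define l where "l = sorted_list_of_set (set l1 \<union> set l2)"
    have sorted: "sorted_wrt (<) l" and set_l: "set l = set l1 \<union> set l2"
      by (simp_all add: l_def)
    have snd: "snd ` set l1 = set p" "snd ` set l2 = set q"
      by (rule enc_lists_set[OF l(1)], rule enc_lists_set[OF l(2)])
    have "filter (\<lambda>x. snd x \<in> set p) l = l1"
    proof (rule strict_sorted_equal)
      show "set (filter (\<lambda>x. snd x \<in> set p) l) = set l1"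
        using snd assms(3) by (auto simp: set_l)
    qed (use sorted l(1) in \<open>auto simp: enc_lists_def sorted_wrt_filter\<close>)
    moreover have "filter (\<lambda>x. snd x \<in> set q) l = l2"
    proof (rule strict_sorted_equal)
      show "set (filter (\<lambda>x. snd x \<in> set q) l) = set l2"
        using snd assms(3) by (auto simp: set_l)
    qed (use sorted l(2) in \<open>auto simp: enc_lists_def sorted_wrt_filter\<close>)
    ultimately have f: "?f l = y"
      by (simp add: y)
    have filters: "remdups_adj (filter (\<lambda>a. a \<in> set r) (remdups_adj (map snd l))) =
        remdups_adj (map snd (filter (\<lambda>x. snd x \<in> set r) l))" for r
      by (simp add: remdups_adj_filter filter_map comp_def)
    have set_p_q: "snd ` set l \<subseteq> set p \<union> set q"
      by (simp add: set_l image_Un snd)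
    have "remdups_adj (map snd l) \<in> star_distinct p q"
      unfolding star_distinct_iff[OF assms(1,2)] filters
      using f l(1,2) set_p_q by (simp add: y enc_lists_def)
    moreover have "l \<in> enc_lists (remdups_adj (map snd l))"
      using sorted l(1,2) by (auto simp: enc_lists_def set_l)
    moreover have "mono_of l = M"
      using split[OF set_p_q] f l(3) by (simp add: y)
    ultimately have "l \<in> ?L"
      by blast
    then show "y \<in> ?f ` ?L"
      using f by blast
  qed
qed

text \<open>Each list belongs to exactly one word, its own contraction, so the counts add up to one
  disjoint union. Words longer than \<open>deg M\<close> contribute nothing; cutting them off makes
  the index set finite.\<close>

lemma sum_words_count_star:
  fixes p q :: "nat list"
  assumes "distinct p" "distinct q" "set p \<inter> set q = {}"
  shows "(\<Sum>z\<in>{z \<in> star_distinct p q. length z \<le> deg M}. words_count z M) =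
    (\<Sum>(A, B)\<in>{(A, B). A + B = M}. words_count p A * words_count q B)"
proof -
  let ?S = "{z \<in> star_distinct p q. length z \<le> deg M}"
  have "(\<Sum>z\<in>?S. words_count z M) = card (\<Union>z\<in>?S. {l \<in> enc_lists z. mono_of l = M})"
    unfolding words_count_def
  proof (rule card_UN_disjoint[symmetric])
    show "\<forall>z\<in>?S. \<forall>z'\<in>?S. z \<noteq> z' \<longrightarrow>
        {l \<in> enc_lists z. mono_of l = M} \<inter> {l \<in> enc_lists z'. mono_of l = M} = {}"
      by (auto simp: enc_lists_def)
  qed (simp_all add: finite_star_distinct_length finite_enc_lists)
  also have "(\<Union>z\<in>?S. {l \<in> enc_lists z. mono_of l = M}) =
      {l. \<exists>z\<in>star_distinct p q. l \<in> enc_lists z \<and> mono_of l = M}"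
    using enc_lists_length by fastforce
  also have "card \<dots> = card {(l, l'). l \<in> enc_lists p \<and> l' \<in> enc_lists q \<and> mono_of l + mono_of l' = M}"
    by (rule bij_betw_same_card[OF bij_betw_restrict[OF assms]])
  also have "{(l, l'). l \<in> enc_lists p \<and> l' \<in> enc_lists q \<and> mono_of l + mono_of l' = M} =
      (\<Union>(A, B)\<in>{(A, B). A + B = M}.
        {l \<in> enc_lists p. mono_of l = A} \<times> {l \<in> enc_lists q. mono_of l = B})"
    by auto
  also have "card \<dots> = (\<Sum>(A, B)\<in>{(A, B). A + B = M}. words_count p A * words_count q B)"
    by (subst card_UN_disjoint)
      (auto simp: finite_monomial_splits finite_enc_lists words_count_def card_cartesian_product
        intro!: sum.cong)
  finally show ?thesis .
qed

section \<open>Star products of words with repeated letters\<close>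

abbreviation position_words :: "nat \<Rightarrow> nat \<Rightarrow> (nat + nat) list set" where
  "position_words m n \<equiv> star_distinct (map Inl [0..<m]) (map Inr [0..<n])"

lemma distinct_positions: "distinct (map Inl [0..<m])" "distinct (map Inr [0..<m])"
  by (simp_all add: distinct_map)

text \<open>Filtering removes nothing between the two letters and contraction does not merge them,
  since they differ. The pair thus shows up in the contracted restriction, which is known for star
  words.\<close>

lemma remdups_adj_filter_adjacent:
  assumes "Suc i < length z" "P (z ! i)" "P (z ! Suc i)" "z ! i \<noteq> z ! Suc i"
  obtains s t where "remdups_adj (filter P z) = s @ z ! i # z ! Suc i # t"
proof -
  have "z = (take i z @ [z ! i]) @ z ! Suc i # drop (Suc (Suc i)) z"
    using assms(1) by (simp add: Cons_nth_drop_Suc)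
  then have "filter P z = (filter P (take i z) @ [z ! i]) @ z ! Suc i # filter P (drop (Suc (Suc i)) z)"
    using assms(2,3) by (metis append.assoc append_Cons append_Nil filter.simps(2) filter_append)
  then have "remdups_adj (filter P z) = remdups_adj (filter P (take i z) @ [z ! i]) @
      remdups_adj (z ! Suc i # filter P (drop (Suc (Suc i)) z))"
    using assms(4) by (simp only:) (rule remdups_adj_append', simp)
  moreover have "\<exists>s. remdups_adj (filter P (take i z) @ [z ! i]) = s @ [z ! i]"
    using last_remdups_adj[of "filter P (take i z) @ [z ! i]"]
    by (metis append_butlast_last_id last_snoc remdups_adj_Nil_iff snoc_eq_iff_butlast)
  moreover have "\<exists>t. remdups_adj (z ! Suc i # filter P (drop (Suc (Suc i)) z)) = z ! Suc i # t"
    by (metis remdups_adj_Cons_alt)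
  ultimately show thesis
    using that by auto
qed

lemma consecutive_in_map_upt:
  assumes "map f [0..<n] = s @ c # d # t" "inj f"
  shows "\<exists>k. Suc k < n \<and> c = f k \<and> d = f (Suc k)"
proof (intro exI conjI)
  have "length (map f [0..<n]) = length (s @ c # d # t)"
    by (simp only: assms(1))
  then show "Suc (length s) < n"
    by simp
  then show "c = f (length s)" "d = f (Suc (length s))"
    using arg_cong[OF assms(1), of "\<lambda>l. l ! length s"]
      arg_cong[OF assms(1), of "\<lambda>l. l ! Suc (length s)"] by (simp_all add: nth_append)
qed

text \<open>The restriction to one factor contracts to the positions 0, 1, 2, ..., so neighbours
  from the same factor are \<open>k\<close> and \<open>Suc k\<close> in this order. Other neighbours
  come from different factors, where the comparison is settled by the alphabets.\<close>

lemma position_words_adjacent: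
  assumes "z \<in> position_words m n" "Suc i < length z"
  obtains (left) k where "Suc k < m" "z ! i = Inl k" "z ! Suc i = Inl (Suc k)"
  | (right) k where "Suc k < n" "z ! i = Inr k" "z ! Suc i = Inr (Suc k)"
  | (up) a b where "a < m" "b < n" "z ! i = Inl a" "z ! Suc i = Inr b"
  | (down) a b where "a < m" "b < n" "z ! i = Inr b" "z ! Suc i = Inl a"
proof -
  have z: "set z \<subseteq> Inl ` {..<m} \<union> Inr ` {..<n}" "distinct_adj z"
    "remdups_adj (filter (\<lambda>c. c \<in> Inl ` {..<m}) z) = map Inl [0..<m]"
    "remdups_adj (filter (\<lambda>c. c \<in> Inr ` {..<n}) z) = map Inr [0..<n]"
    using assms(1) unfolding star_distinct_iff[OF distinct_positions]
    by (simp_all add: atLeast0LessThan)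
  have ne: "z ! i \<noteq> z ! Suc i"
    using z(2) assms(2) by (rule distinct_adj_nth)
  have mem: "z ! i \<in> Inl ` {..<m} \<union> Inr ` {..<n}" "z ! Suc i \<in> Inl ` {..<m} \<union> Inr ` {..<n}"
    by (rule subsetD[OF z(1) nth_mem], use assms(2) in simp)+
  consider "z ! i \<in> Inl ` {..<m}" "z ! Suc i \<in> Inl ` {..<m}"
    | "z ! i \<in> Inr ` {..<n}" "z ! Suc i \<in> Inr ` {..<n}"
    | "z ! i \<in> Inl ` {..<m}" "z ! Suc i \<in> Inr ` {..<n}"
    | "z ! i \<in> Inr ` {..<n}" "z ! Suc i \<in> Inl ` {..<m}"
    using mem by blast
  then show thesis
  proof cases
    case 1
    obtain s t where "map Inl [0..<m] = s @ z ! i # z ! Suc i # t"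
      using remdups_adj_filter_adjacent[of i z "\<lambda>c. c \<in> Inl ` {..<m}", OF assms(2) 1 ne]
      unfolding z(3) .
    then show thesis
      using consecutive_in_map_upt[of Inl m s "z ! i" "z ! Suc i" t] left by auto
  next
    case 2
    obtain s t where "map Inr [0..<n] = s @ z ! i # z ! Suc i # t"
      using remdups_adj_filter_adjacent[of i z "\<lambda>c. c \<in> Inr ` {..<n}", OF assms(2) 2 ne]
      unfolding z(4) .
    then show thesis
      using consecutive_in_map_upt[of Inr n s "z ! i" "z ! Suc i" t] right by auto
  next
    case 3
    then show thesis
      using up by auto
  next
    case 4
    then show thesis
      using down by auto
  qed
qed

definition letter :: "'a list \<Rightarrow> 'a list \<Rightarrow> nat + nat \<Rightarrow> 'a" where
  "letter u v = case_sum (\<lambda>i. u ! i) (\<lambda>j. v ! j)"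

lemma letter_simps [simp]: "letter u v (Inl i) = u ! i" "letter u v (Inr j) = v ! j"
  by (simp_all add: letter_def)

lemma star_letter:
  "star u v x = int (card {z \<in> position_words (length u) (length v). map (letter u v) z = x})"
  by (simp add: star_def letter_def)

lemma position_words_set:
  assumes "z \<in> position_words m n"
  shows "set z = Inl ` {..<m} \<union> Inr ` {..<n}"
proof -
  have *: "set z \<subseteq> Inl ` {..<m} \<union> Inr ` {..<n}"
    "remdups_adj (filter (\<lambda>c. c \<in> Inl ` {..<m}) z) = map Inl [0..<m]"
    "remdups_adj (filter (\<lambda>c. c \<in> Inr ` {..<n}) z) = map Inr [0..<n]"
    using assms unfolding star_distinct_iff[OF distinct_positions]
    by (simp_all add: atLeast0LessThan)
  have "set (filter (\<lambda>c. c \<in> Inl ` {..<m}) z) = Inl ` {..<m}"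
    "set (filter (\<lambda>c. c \<in> Inr ` {..<n}) z) = Inr ` {..<n}"
    using arg_cong[OF *(2), of set] arg_cong[OF *(3), of set]
    unfolding remdups_adj_set by (simp_all add: atLeast0LessThan)
  then show ?thesis
    using *(1) by (auto simp del: set_filter) (auto simp: set_eq_iff)
qed

lemma length_position_words:
  assumes "z \<in> position_words m n"
  shows "m \<le> length z" "n \<le> length z"
proof -
  have "card (Inl ` {..<m} :: (nat + nat) set) \<le> card (set z)"
    "card (Inr ` {..<n} :: (nat + nat) set) \<le> card (set z)"
    unfolding position_words_set[OF assms] by (auto intro!: card_mono)
  then show "m \<le> length z" "n \<le> length z"
    using card_length[of z] by (auto simp: card_image)
qed

lemma set_map_letter:
  assumes "z \<in> position_words (length u) (length v)"
  shows "set (map (letter u v) z) = set u \<union> set v"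
proof -
  have "(!) x ` {..<length x} = set x" for x :: "'a list"
    by (auto simp: set_conv_nth)
  then show ?thesis
    by (simp add: position_words_set[OF assms] image_Un image_image)
qed

text \<open>
  Only adjacent letters are compared in a descent set, so the letters of \<open>u\<close> and \<open>v\<close> may be
  replaced by those of any words with the same descents.
\<close>

lemma map_letter_adjacent:
  assumes "z \<in> position_words (length u) (length v)"
    and "distinct_adj u" "distinct_adj v" "\<And>a b. a \<in> set u \<Longrightarrow> b \<in> set v \<Longrightarrow> a < b"
    and "distinct_adj u'" "distinct_adj v'" "\<And>a b. a \<in> set u' \<Longrightarrow> b \<in> set v' \<Longrightarrow> a < b"
    and "length u' = length u" "length v' = length v" "Des u' = Des u" "Des v' = Des v"
    and "Suc i < length z"
  shows "letter u v (z ! i) \<noteq> letter u v (z ! Suc i)"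
    "letter u v (z ! Suc i) < letter u v (z ! i) \<longleftrightarrow> letter u' v' (z ! Suc i) < letter u' v' (z ! i)"
proof -
  have Des: "x ! Suc k < x ! k \<longleftrightarrow> Suc k \<in> Des x" if "Suc k < length x" for x k
    using that by (auto simp: Des_def)
  have "letter u v (z ! i) \<noteq> letter u v (z ! Suc i) \<and>
      (letter u v (z ! Suc i) < letter u v (z ! i) \<longleftrightarrow> letter u' v' (z ! Suc i) < letter u' v' (z ! i))"
    using assms(1,12)
  proof (cases rule: position_words_adjacent)
    case (left k)
    then show ?thesis
      using distinct_adj_nth[OF assms(2), of k] Des[of k u] Des[of k u'] assms(8,10) by simp
  next
    case (right k)
    then show ?thesis
      using distinct_adj_nth[OF assms(3), of k] Des[of k v] Des[of k v'] assms(9,11) by simp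
  next
    case (up a b)
    then show ?thesis
      using assms(4)[of "u ! a" "v ! b"] assms(7)[of "u' ! a" "v' ! b"] assms(8,9) by simp
  next
    case (down a b)
    then show ?thesis
      using assms(4)[of "u ! a" "v ! b"] assms(7)[of "u' ! a" "v' ! b"] assms(8,9) by simp
  qed
  then show "letter u v (z ! i) \<noteq> letter u v (z ! Suc i)"
    "letter u v (z ! Suc i) < letter u v (z ! i) \<longleftrightarrow> letter u' v' (z ! Suc i) < letter u' v' (z ! i)"
    by blast+
qed

lemma Des_map_letter:
  assumes "z \<in> position_words (length u) (length v)"
    and "distinct_adj u" "distinct_adj v" "\<And>a b. a \<in> set u \<Longrightarrow> b \<in> set v \<Longrightarrow> a < b"
    and "distinct_adj u'" "distinct_adj v'" "\<And>a b. a \<in> set u' \<Longrightarrow> b \<in> set v' \<Longrightarrow> a < b"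
    and "length u' = length u" "length v' = length v" "Des u' = Des u" "Des v' = Des v"
  shows "Des (map (letter u v) z) = Des (map (letter u' v') z)"
proof -
  have "Suc i \<in> Des (map (letter u v) z) \<longleftrightarrow> Suc i \<in> Des (map (letter u' v') z)" for i
    using map_letter_adjacent(2)[OF assms, of i] by (auto simp: Des_def)
  moreover have "0 \<notin> Des x" for x
    by (simp add: Des_def)
  ultimately show ?thesis
    unfolding set_eq_iff by (metis not0_implies_Suc)
qed

lemma distinct_adj_map_letter:
  assumes "z \<in> position_words (length u) (length v)"
    and "distinct_adj u" "distinct_adj v" "\<And>a b. a \<in> set u \<Longrightarrow> b \<in> set v \<Longrightarrow> a < (b :: nat)"
  shows "distinct_adj (map (letter u v) z)"
  unfolding distinct_adj_conv_nth
  using map_letter_adjacent(1)[OF assms assms(2-4)] by auto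

lemma inj_on_letter:
  assumes "distinct p" "distinct q" "set p \<inter> set q = {}"
  shows "inj_on (letter p q) (Inl ` {..<length p} \<union> Inr ` {..<length q})"
proof (rule inj_onI)
  fix x y
  assume "x \<in> Inl ` {..<length p} \<union> Inr ` {..<length q}" "y \<in> Inl ` {..<length p} \<union> Inr ` {..<length q}"
    and "letter p q x = letter p q y"
  moreover have "p ! i \<noteq> q ! j" "q ! j \<noteq> p ! i" if "i < length p" "j < length q" for i j
    using assms(3) nth_mem[OF that(1)] nth_mem[OF that(2)] by auto
  ultimately show "x = y"
    using assms(1,2) by (auto simp: nth_eq_iff_index_eq)
qed

lemma star_distinct_letter:
  assumes "distinct p" "distinct q" "set p \<inter> set q = {}"
  shows "star_distinct p q = map (letter p q) ` position_words (length p) (length q)"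
proof -
  have "map (letter p q) (map Inl [0..<length p]) = p" "map (letter p q) (map Inr [0..<length q]) = q"
    by (simp_all add: comp_def map_nth)
  then show ?thesis
    using star_distinct_map[OF distinct_positions(1)[of "length p"] distinct_positions(2)[of "length q"],
        of "letter p q"] inj_on_letter[OF assms] by (simp add: atLeast0LessThan)
qed

text \<open>Different position words may yield the same word, and \<open>star\<close> counts how
  many, so the sum over words becomes one over position words. There the factors are exchanged for
  permutations with the same descents, for which substitution is injective and the distinct-letter
  count applies.\<close>

lemma sum_star_psi_word:
  assumes w: "distinct_adj w" and u: "distinct_adj u" and less: "\<And>a b. a \<in> set w \<Longrightarrow> b \<in> set u \<Longrightarrow> a < b"
    and fin: "finite W" and W: "\<And>z. z \<in> position_words (length w) (length u) \<Longrightarrow>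
      length z \<le> deg M \<Longrightarrow> map (letter w u) z \<in> W"
  shows "(\<Sum>x\<in>W. star w u x * psi_word x M) =
    (\<Sum>(A, B)\<in>{(A, B). A + B = M}. psi_word w A * psi_word u B)"
proof -
  define p where "p = perm_of_comp (comp_of_word w)"
  \<comment> \<open>The shift by \<open>length w\<close> puts the letters of \<open>q\<close> above
    those of \<open>p\<close>, just as the letters of \<open>u\<close> lie above those of
    \<open>w\<close>.\<close>
  define q where "q = map ((+) (length w)) (perm_of_comp (comp_of_word u))"
  have p: "distinct p" "set p \<subseteq> {1..length w}" "length p = length w" "Des p = Des w"
    using perm_of_comp[of "comp_of_word w"] by (simp_all add: p_def Des_perm_of_comp)
  have q: "distinct q" "set q \<subseteq> {length w<..}" "length q = length u" "Des q = Des u"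
    using perm_of_comp[of "comp_of_word u"]
    by (auto simp: q_def Des_perm_of_comp Des_map_mono distinct_map)
  have pq: "a < b" if "a \<in> set p" "b \<in> set q" for a b
    using that p(2) q(2) by fastforce
  then have disj: "set p \<inter> set q = {}"
    by fastforce
  note adj = distinct_imp_distinct_adj[OF p(1)] distinct_imp_distinct_adj[OF q(1)]
  let ?Z = "position_words (length w) (length u)"
  let ?Zd = "{z \<in> ?Z. length z \<le> deg M}"
  have psi_eq: "psi_word (map (letter w u) z) M = int (words_count (map (letter p q) z) M)"
    if "z \<in> ?Z" for z
  proof -
    have "Des (map (letter w u) z) = Des (map (letter p q) z)"
      by (rule Des_map_letter) (use that w u less adj pq p q in auto)
    then have "psi_word (map (letter w u) z) = psi_word (map (letter p q) z)"
      by (simp add: psi_word_def comp_of_word_def)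
    moreover have "distinct_adj (map (letter p q) z)"
      by (rule distinct_adj_map_letter) (use that adj pq p q in auto)
    ultimately show ?thesis
      by (simp add: psi_word_eq)
  qed
  have fin_Zd: "finite ?Zd"
    by (rule finite_star_distinct_length)
  have "(\<Sum>x\<in>W. star w u x * psi_word x M) =
      (\<Sum>x\<in>W. \<Sum>z\<in>{z \<in> ?Zd. map (letter w u) z = x}. psi_word (map (letter w u) z) M)"
  proof (rule sum.cong[OF refl])
    fix x
    show "star w u x * psi_word x M =
        (\<Sum>z\<in>{z \<in> ?Zd. map (letter w u) z = x}. psi_word (map (letter w u) z) M)"
    proof (cases "length x \<le> deg M")
      case True
      then have "{z \<in> ?Z. map (letter w u) z = x} = {z \<in> ?Zd. map (letter w u) z = x}"
        by auto
      then show ?thesis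
        by (simp add: star_letter)
    next
      case False
      then have empty: "{z \<in> ?Zd. map (letter w u) z = x} = {}"
        by auto
      \<comment> \<open>A nonzero multiplicity supplies a position word and, through
        \<open>psi_eq\<close>, a count that vanishes for reasons of degree.\<close>
      have "star w u x * psi_word x M = 0"
      proof (cases "star w u x = 0")
        case False
        then obtain z where "z \<in> ?Z" "map (letter w u) z = x"
          unfolding star_letter by (metis (mono_tags, lifting) card.empty empty_Collect_eq of_nat_0)
        then show ?thesis
          using psi_eq[of z] \<open>\<not> length x \<le> deg M\<close> by (auto intro!: words_count_eq_0)
      qed simp
      then show ?thesis
        unfolding empty by simp
    qed
  qed
  also have "\<dots> = (\<Sum>z\<in>?Zd. psi_word (map (letter w u) z) M)"
    using W by (intro sum.group fin fin_Zd) auto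
  also have "\<dots> = (\<Sum>z\<in>?Zd. int (words_count (map (letter p q) z) M))"
    by (intro sum.cong refl psi_eq) simp
  also have "\<dots> = (\<Sum>y\<in>map (letter p q) ` ?Zd. int (words_count y M))"
  proof (subst sum.reindex)
    show "inj_on (map (letter p q)) ?Zd"
    proof (rule inj_onI)
      fix z z'
      assume "z \<in> ?Zd" "z' \<in> ?Zd" and eq: "map (letter p q) z = map (letter p q) z'"
      then have mem: "z \<in> ?Z" "z' \<in> ?Z"
        by blast+
      have "set z \<union> set z' = Inl ` {..<length p} \<union> Inr ` {..<length q}"
        unfolding position_words_set[OF mem(1)] position_words_set[OF mem(2)] p(3) q(3) by simp
      then show "z = z'"
        using eq inj_on_letter[OF p(1) q(1) disj] by (metis map_inj_on)
    qed
  qed simp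
  also have "map (letter p q) ` ?Zd = {y \<in> star_distinct p q. length y \<le> deg M}"
    unfolding star_distinct_letter[OF p(1) q(1) disj] p(3) q(3) by auto
  also have "(\<Sum>y\<in>{y \<in> star_distinct p q. length y \<le> deg M}. int (words_count y M)) =
      int (\<Sum>(A, B)\<in>{(A, B). A + B = M}. words_count p A * words_count q B)"
    unfolding sum_words_count_star[OF p(1) q(1) disj, symmetric] by simp
  also have "\<dots> = (\<Sum>(A, B)\<in>{(A, B). A + B = M}. psi_word p A * psi_word q B)"
    by (simp add: psi_word_eq adj case_prod_unfold)
  also have "psi_word p = psi_word w"
    by (simp add: psi_word_def comp_of_word_def p)
  also have "psi_word q = psi_word u"
    by (simp add: psi_word_def comp_of_word_def q)
  finally show ?thesis .
qed

section \<open>The product of m-permutations\<close>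

lemma Des_shift: "Des (map (\<lambda>a. a + n) u) = Des u"
  by (rule Des_map_mono) simp

lemma psi_word_shift: "psi_word (map (\<lambda>a. a + n) u) = psi_word u"
  by (simp add: psi_word_def comp_of_word_def Des_shift)

text \<open>The shifted letters of \<open>u\<close> continue the interval of letters of
  \<open>w\<close>, so the letters of each term again fill an initial interval. Every position of
  each factor occurs in the term, whence the length bounds that make the product converge.\<close>

lemma mMR_mul_word_nonzero:
  assumes "w \<in> mperms" "u \<in> mperms" "mMR_mul_word (w, u) x \<noteq> 0"
  shows "x \<in> mperms" "length w \<le> length x" "length u \<le> length x"
proof -
  let ?n = "card (set w)" and ?m = "card (set u)"
  let ?u = "map (\<lambda>a. a + ?n) u"
  obtain z where z: "z \<in> position_words (length w) (length ?u)" "x = map (letter w ?u) z"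
    using assms(3) unfolding mMR_mul_word_def prod.case star_letter
    by (metis (mono_tags, lifting) card.empty empty_Collect_eq of_nat_0)
  have w: "distinct_adj w" "set w = {1..?n}" and u: "distinct_adj u" "set u = {1..?m}"
    using mpermsD(1,2) assms(1,2) by blast+
  have set_u: "set ?u = {?n + 1..?n + ?m}"
    unfolding set_map by (subst u(2)) (simp add: add.commute)
  have "set x = {1..?n + ?m}"
    unfolding z(2) set_map_letter[OF z(1)] set_u by (subst w(2)) auto
  moreover have "distinct_adj x"
    unfolding z(2)
  proof (rule distinct_adj_map_letter[OF z(1) w(1)])
    show "distinct_adj ?u"
      using u(1) by (intro distinct_adj_mapI) (auto simp: inj_on_def)
    show "a < b" if "a \<in> set w" "b \<in> set ?u" for a b
      using that unfolding set_u by (subst (asm) w(2)) auto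
  qed
  ultimately show "x \<in> mperms"
    by (auto simp: mperms_def mperm_def)
  show "length w \<le> length x" "length u \<le> length x"
    using length_position_words[OF z(1)] by (simp_all add: z(2))
qed

lemma locally_finite_mMR_mul_word: "locally_finite (mperms \<times> mperms) mMR_mul_word"
  unfolding locally_finite_def
proof
  fix x
  have "{p \<in> mperms \<times> mperms. mMR_mul_word p x \<noteq> 0} \<subseteq>
      {w \<in> mperms. length w \<le> length x} \<times> {w \<in> mperms. length w \<le> length x}"
    using mMR_mul_word_nonzero(2,3) by auto
  then show "finite {p \<in> mperms \<times> mperms. mMR_mul_word p x \<noteq> 0}"
    by (rule finite_subset) (simp add: finite_mperms_length)
qed

lemma sum_mMR_mul_word:
  assumes "w \<in> mperms" "u \<in> mperms"
  shows "(\<Sum>x\<in>{x \<in> mperms. length x \<le> deg M}. mMR_mul_word (w, u) x * psi_word x M) =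
    (\<Sum>(A, B)\<in>{(A, B). A + B = M}. psi_word w A * psi_word u B)"
proof -
  let ?u = "map (\<lambda>a. a + card (set w)) u"
  have w: "distinct_adj w" "set w = {1..card (set w)}" and u: "distinct_adj u" "set u = {1..card (set u)}"
    using mpermsD(1,2) assms by blast+
  have less: "a < b" if ab: "a \<in> set w" "b \<in> set ?u" for a b
  proof -
    obtain c where "c \<in> set u" "b = c + card (set w)"
      using ab(2) by auto
    moreover from this have "1 \<le> c"
      by (subst (asm) u(2)) simp
    moreover have "a \<le> card (set w)"
      using ab(1) by (subst (asm) w(2)) simp
    ultimately show ?thesis
      by simp
  qed
  have "(\<Sum>x\<in>{x \<in> mperms. length x \<le> deg M}. star w ?u x * psi_word x M) =
      (\<Sum>(A, B)\<in>{(A, B). A + B = M}. psi_word w A * psi_word ?u B)"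
  proof (rule sum_star_psi_word)
    show "distinct_adj w" by (rule w(1))
    show "distinct_adj ?u"
      using u(1) by (intro distinct_adj_mapI) (auto simp: inj_on_def)
    show "finite {x \<in> mperms. length x \<le> deg M}"
      by (rule finite_mperms_length)
  next
    fix z
    assume z: "z \<in> position_words (length w) (length ?u)" "length z \<le> deg M"
    let ?x = "map (letter w ?u) z"
    \<comment> \<open>Cardinality is 0 for infinite sets, so finiteness is required before a member
      of the set yields a nonzero multiplicity.\<close>
    have "finite {z \<in> position_words (length w) (length ?u). map (letter w ?u) z = ?x}"
      by (rule finite_subset[OF _ finite_star_distinct_length[of _ _ "length z"]])
        (auto dest: map_eq_imp_length_eq)
    then have "mMR_mul_word (w, u) ?x \<noteq> 0"
      using z(1) by (auto simp: mMR_mul_word_def star_letter card_eq_0_iff)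
    then show "?x \<in> {x \<in> mperms. length x \<le> deg M}"
      using mMR_mul_word_nonzero(1)[OF assms] z(2) by simp
  qed (rule less)
  then show ?thesis
    by (simp add: mMR_mul_word_def psi_word_shift)
qed

section \<open>The coproduct\<close>

definition standardizes :: "nat list \<Rightarrow> nat list \<Rightarrow> bool" where
  "standardizes w v \<longleftrightarrow> v \<in> mperms \<and> length v = length w \<and>
     (\<forall>i<length w. \<forall>j<length w. w ! i \<le> w ! j \<longleftrightarrow> v ! i \<le> v ! j)"

lemma card_image_cong_iff:
  assumes "\<And>j k. j \<in> J \<Longrightarrow> k \<in> J \<Longrightarrow> f j = f k \<longleftrightarrow> g j = g k"
  shows "card (f ` J) = card (g ` J)"
proof (rule bij_betw_same_card)
  show "bij_betw (\<lambda>y. g (inv_into J f y)) (f ` J) (g ` J)"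
  proof (rule bij_betw_imageI)
    have "g (inv_into J f (f j)) = g j" if "j \<in> J" for j
      using that assms[of "inv_into J f (f j)" j] by (simp add: f_inv_into_f inv_into_into)
    then show "inj_on (\<lambda>y. g (inv_into J f y)) (f ` J)" "(\<lambda>y. g (inv_into J f y)) ` f ` J = g ` J"
      using assms by (auto simp: inj_on_def image_image)
  qed
qed

text \<open>The letters of \<open>v\<close> fill an initial interval, so \<open>v ! i\<close> is the
  number of distinct letters of \<open>v\<close> not exceeding it; this number can be computed in
  \<open>w\<close>, which has the same relative order. Hence \<open>v\<close> is forced.\<close>

lemma standardizes_nth:
  assumes "standardizes w v" "i < length w"
  shows "v ! i = card ((!) w ` {j. j < length w \<and> w ! j \<le> w ! i})"
proof -
  let ?J = "{j. j < length w \<and> w ! j \<le> w ! i}"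
  have v: "v \<in> mperms" "length v = length w"
    and le: "\<And>i j. i < length w \<Longrightarrow> j < length w \<Longrightarrow> w ! i \<le> w ! j \<longleftrightarrow> v ! i \<le> v ! j"
    using assms(1) by (auto simp: standardizes_def)
  have set: "set v = {1..card (set v)}"
    using mpermsD(2)[OF v(1)] .
  have "v ! i \<in> set v"
    using assms(2) v(2) by simp
  then have "v ! i \<le> card (set v)"
    by (subst (asm) set) simp
  then have "{1..v ! i} = {b \<in> {1..card (set v)}. b \<le> v ! i}"
    by auto
  also have "\<dots> = {b \<in> set v. b \<le> v ! i}"
    by (subst (2) set) simp
  also have "\<dots> = (!) v ` ?J"
    using le assms(2) v(2) by (auto simp: in_set_conv_nth)
  finally have "v ! i = card ((!) v ` ?J)"
    by (metis card_atLeastAtMost diff_Suc_1 One_nat_def)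
  also have "\<dots> = card ((!) w ` ?J)"
    using le by (intro card_image_cong_iff) (simp add: order_eq_iff)
  finally show ?thesis .
qed

lemma standardizes_unique:
  assumes "standardizes w v" "standardizes w v'"
  shows "v = v'"
proof (rule nth_equalityI)
  have len: "length v = length w" "length v' = length w"
    using assms by (simp_all add: standardizes_def)
  then show "length v = length v'"
    by simp
  show "v ! i = v' ! i" if "i < length v" for i
    using that len standardizes_nth[OF assms(1)] standardizes_nth[OF assms(2)] by simp
qed

text \<open>Each letter is replaced by its rank among the distinct letters; injectivity of the rank
  preserves distinct neighbours.\<close>

lemma ex_standardizes:
  assumes "distinct_adj w"
  shows "\<exists>v. standardizes w v"
proof -
  define rank where "rank a = card {b \<in> set w. b \<le> a}" for a
  have mono: "rank a < rank b" if "a < b" "b \<in> set w" for a b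
    unfolding rank_def
  proof (rule psubset_card_mono)
    have "{x \<in> set w. x \<le> a} \<subseteq> {x \<in> set w. x \<le> b}" "b \<in> {x \<in> set w. x \<le> b}" "b \<notin> {x \<in> set w. x \<le> a}"
      using that by auto
    then show "{x \<in> set w. x \<le> a} \<subset> {x \<in> set w. x \<le> b}"
      by blast
  qed simp
  have le: "a \<le> b \<longleftrightarrow> rank a \<le> rank b" if "a \<in> set w" "b \<in> set w" for a b
    using that mono[of a b] mono[of b a] by (cases a b rule: linorder_cases) auto
  have inj: "inj_on rank (set w)"
    using le by (auto simp: inj_on_def order_eq_iff)
  have "rank ` set w = {1..card (set w)}"
  proof (rule card_subset_eq)
    show "rank ` set w \<subseteq> {1..card (set w)}"
    proof (rule image_subsetI)
      fix a
      assume "a \<in> set w"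
      then have "{b \<in> set w. b \<le> a} \<noteq> {}"
        by auto
      then have "rank a \<noteq> 0"
        by (simp add: rank_def)
      moreover have "rank a \<le> card (set w)"
        unfolding rank_def by (intro card_mono) auto
      ultimately show "rank a \<in> {1..card (set w)}"
        by simp
    qed
    show "card (rank ` set w) = card {1..card (set w)}"
      using inj by (simp add: card_image)
  qed simp
  moreover have "distinct_adj (map rank w)"
    using assms inj by (rule distinct_adj_mapI)
  ultimately have "map rank w \<in> mperms"
    by (auto simp: mperms_def mperm_def)
  then have "standardizes w (map rank w)"
    using le by (simp add: standardizes_def)
  then show ?thesis ..
qed

lemma st:
  assumes "distinct_adj w"
  shows "st w \<in> mperms" "length (st w) = length w" "Des (st w) = Des w"
proof -
  have "st w = (THE v. standardizes w v)"
    by (simp add: st_def standardizes_def)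
  then have st: "standardizes w (st w)"
    using ex_standardizes[OF assms] standardizes_unique by (metis theI)
  then show "st w \<in> mperms" "length (st w) = length w"
    by (simp_all add: standardizes_def)
  have "st w ! i < st w ! j \<longleftrightarrow> w ! i < w ! j" if "i < length w" "j < length w" for i j
    using st that by (simp add: standardizes_def flip: not_le)
  then show "Des (st w) = Des w"
    unfolding Des_def \<open>length (st w) = length w\<close> by auto
qed

lemma psi_word_st: "distinct_adj w \<Longrightarrow> psi_word (st w) = psi_word w"
  by (simp add: psi_word_def comp_of_word_def st)

section \<open>Cutting a word between letters or through a letter\<close>

definition overlap_append :: "'a list \<Rightarrow> 'a list \<Rightarrow> 'a list" where
  "overlap_append u v = (if u \<noteq> [] \<and> v \<noteq> [] \<and> last u = hd v then u @ tl v else u @ v)"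

text \<open>Contraction is local except at the seam, where a letter shared by both parts loses one
  copy. This is the source of the overlapping cuts in the coproduct.\<close>

lemma remdups_adj_append_overlap:
  "remdups_adj (a @ b) = overlap_append (remdups_adj a) (remdups_adj b)"
proof (cases "a \<noteq> [] \<and> b \<noteq> [] \<and> last a = hd b")
  case True
  then obtain a' x b' where ab: "a = a' @ [x]" "b = x # b'"
    by (metis append_butlast_last_id list.collapse)
  have "remdups_adj (a @ b) = remdups_adj a @ tl (remdups_adj b)"
    using remdups_adj_append[of a' x "x # b'"] by (simp add: ab)
  then show ?thesis
    using True by (simp add: overlap_append_def)
next
  case False
  then show ?thesis
    by (subst remdups_adj_append') (auto simp: overlap_append_def)
qed

definition splittings :: "'a list \<Rightarrow> ('a list \<times> 'a list) set" where
  "splittings z = {(u, v). distinct_adj u \<and> distinct_adj v \<and> overlap_append u v = z}"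

text \<open>Merging happens exactly when the parts share their boundary letter, so each preimage of
  \<open>z\<close> is a cut between two letters or a cut through a letter that is kept in both
  halves.\<close>

lemma splittings_eq:
  assumes "distinct_adj z"
  shows "splittings z = (\<lambda>i. (take i z, drop i z)) ` {0..length z} \<union>
    (\<lambda>i. (take i z, drop (i - 1) z)) ` {1..length z}" (is "_ = ?A \<union> ?B")
proof (intro Set.equalityI subsetI)
  fix p
  assume "p \<in> splittings z"
  then obtain u v where p: "p = (u, v)" and uv: "overlap_append u v = z"
    by (auto simp: splittings_def)
  show "p \<in> ?A \<union> ?B"
  proof (cases "u \<noteq> [] \<and> v \<noteq> [] \<and> last u = hd v")
    case True
    then have z: "z = u @ tl v"
      using uv by (simp add: overlap_append_def)
    have "z = butlast u @ v"
      using True by (simp add: z) (metis append_butlast_last_id append_assoc append_Cons append_Nil list.collapse)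
    then have "drop (length u - 1) z = v"
      by simp
    then have "p = (take (length u) z, drop (length u - 1) z)"
      by (simp add: p z)
    moreover have "length u \<in> {1..length z}"
      using True by (cases v) (simp_all add: z Suc_le_eq)
    ultimately show ?thesis
      by blast
  next
    case False
    then have z: "z = u @ v"
      using uv by (auto simp: overlap_append_def)
    then have "p = (take (length u) z, drop (length u) z)" "length u \<in> {0..length z}"
      by (simp_all add: p)
    then show ?thesis
      by blast
  qed
next
  have dist: "distinct_adj (take i z)" "distinct_adj (drop i z)" for i
    using assms distinct_adj_appendD1[of "take i z" "drop i z"]
      distinct_adj_appendD2[of "take i z" "drop i z"] by simp_all
  fix p
  assume "p \<in> ?A \<union> ?B"
  then consider i where "i \<le> length z" "p = (take i z, drop i z)"
    | i where "1 \<le> i" "i \<le> length z" "p = (take i z, drop (i - 1) z)"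
    by auto
  then show "p \<in> splittings z"
  proof cases
    case 1
    \<comment> \<open>Distinct neighbours in \<open>z\<close> prevent the halves of a plain cut from
      being merged.\<close>
    have "overlap_append (take i z) (drop i z) = z"
      using assms distinct_adj_append_iff[of "take i z" "drop i z"] by (auto simp: overlap_append_def)
    then show ?thesis
      using dist by (simp add: 1 splittings_def)
  next
    case 2
    then obtain k where k: "i = Suc k" "k < length z"
      by (cases i) auto
    have "last (take i z) = hd (drop k z)"
      using k by (simp add: take_Suc_conv_app_nth hd_drop_conv_nth)
    moreover have "take i z \<noteq> []" "drop k z \<noteq> []"
      using k by auto
    moreover have "tl (drop k z) = drop i z"
      by (simp add: k(1) drop_Suc tl_drop)
    ultimately have "overlap_append (take i z) (drop k z) = z"
      by (simp add: overlap_append_def)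
    then show ?thesis
      using dist by (simp add: 2(3) splittings_def k(1))
  qed
qed

lemma finite_splittings: "distinct_adj z \<Longrightarrow> finite (splittings z)"
  by (simp add: splittings_eq)

text \<open>No pair arises twice: plain cuts have total length \<open>length z\<close>, cuts through
  a letter one more, and within each kind the length of the left half determines
  \<open>i\<close>.\<close>

lemma sum_splittings:
  assumes "distinct_adj z"
  shows "(\<Sum>(u, v)\<in>splittings z. g u v) =
    (\<Sum>i=0..length z. g (take i z) (drop i z)) + (\<Sum>i=1..length z. g (take i z) (drop (i - 1) z))"
proof -
  let ?A = "(\<lambda>i. (take i z, drop i z)) ` {0..length z}"
  let ?B = "(\<lambda>i. (take i z, drop (i - 1) z)) ` {1..length z}"
  have len: "\<And>p. p \<in> ?A \<Longrightarrow> length (fst p) + length (snd p) = length z"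
    "\<And>p. p \<in> ?B \<Longrightarrow> length (fst p) + length (snd p) = Suc (length z)"
    by auto
  have "?A \<inter> ?B = {}"
    using len by (metis (no_types, lifting) disjoint_iff n_not_Suc_n)
  then have "(\<Sum>(u, v)\<in>splittings z. g u v) = (\<Sum>(u, v)\<in>?A. g u v) + (\<Sum>(u, v)\<in>?B. g u v)"
    unfolding splittings_eq[OF assms] by (intro sum.union_disjoint) auto
  moreover have "inj_on (\<lambda>i. (take i z, drop i z)) {0..length z}"
    "inj_on (\<lambda>i. (take i z, drop (i - 1) z)) {1..length z}"
    by (auto intro!: inj_onI dest!: arg_cong[of "take _ z" _ length])
  ultimately show ?thesis
    by (simp add: sum.reindex)
qed

section \<open>Renaming two ordered sets of variables\<close>

lemma rename_superset:
  "finite K \<Longrightarrow> Poly_Mapping.keys M \<subseteq> K \<Longrightarrow>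
    rename d M = (\<Sum>r\<in>K. Poly_Mapping.single (d r) (Poly_Mapping.lookup M r))"
  unfolding rename_def by (rule sum.mono_neutral_left) (auto simp: in_keys_iff)

lemma rename_add: "rename d (A + B) = rename d A + rename d B"
proof -
  let ?K = "Poly_Mapping.keys A \<union> Poly_Mapping.keys B"
  have "Poly_Mapping.keys (A + B) \<subseteq> ?K"
    by (rule Poly_Mapping.keys_add)
  then show ?thesis
    by (simp add: rename_superset[of ?K] lookup_add single_add sum.distrib)
qed

lemma rename_mono_of: "rename d (mono_of l) = mono_of (map (map_prod d id) l)"
proof (induction l)
  case Nil
  then show ?case
    by (simp add: rename_def)
next
  case (Cons p l)
  have "rename d (Poly_Mapping.single (fst p) 1) = Poly_Mapping.single (d (fst p)) 1"
    by (simp add: rename_def)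
  then show ?case
    by (simp add: rename_add Cons.IH)
qed

lemma lookup_rename:
  assumes "inj_on d X" "finite X" "Poly_Mapping.keys M \<subseteq> X"
  shows "r \<in> X \<Longrightarrow> Poly_Mapping.lookup (rename d M) (d r) = Poly_Mapping.lookup M r"
    "k \<notin> d ` X \<Longrightarrow> Poly_Mapping.lookup (rename d M) k = 0"
proof -
  have eq: "Poly_Mapping.lookup (rename d M) k = (\<Sum>s\<in>X. if d s = k then Poly_Mapping.lookup M s else 0)" for k
    by (simp add: rename_superset[OF assms(2,3)] lookup_sum lookup_single when_def)
  show "Poly_Mapping.lookup (rename d M) (d r) = Poly_Mapping.lookup M r" if "r \<in> X"
  proof -
    have "Poly_Mapping.lookup (rename d M) (d r) = (\<Sum>s\<in>X. if s = r then Poly_Mapping.lookup M s else 0)"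
      unfolding eq using assms(1) that by (intro sum.cong) (auto simp: inj_on_def)
    then show ?thesis
      using assms(2) that by simp
  qed
  show "Poly_Mapping.lookup (rename d M) k = 0" if "k \<notin> d ` X"
    unfolding eq using that by (intro sum.neutral) auto
qed

lemma deg_rename [simp]: "deg (rename d M) = deg M"
proof -
  have "deg (sum f K) = (\<Sum>r\<in>K. deg (f r))" if "finite K" for f :: "nat \<Rightarrow> monomial" and K
    using that by (induction K) simp_all
  then show ?thesis
    by (simp add: rename_def) (simp add: deg_def)
qed

definition increasing_lists :: "monomial \<Rightarrow> (nat \<times> nat) list set" where
  "increasing_lists M = {l. sorted_wrt (<) l \<and> mono_of l = M}"

text \<open>When 0 is absent from the monomial, positivity of the indices is automatic. The renaming
  argument therefore need not follow it through each list.\<close>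

lemma enc_lists_monomial:
  assumes "0 \<notin> Poly_Mapping.keys M"
  shows "{l \<in> enc_lists z. mono_of l = M} = {l \<in> increasing_lists M. remdups_adj (map snd l) = z}"
proof -
  have "\<forall>p\<in>set l. 1 \<le> fst p" if "mono_of l = M" for l
    using assms unfolding that[symmetric] keys_mono_of by (metis One_nat_def Suc_leI image_eqI not_gr_zero)
  then show ?thesis
    by (auto simp: enc_lists_def increasing_lists_def)
qed

lemma map_prod_rename_sorted:
  fixes d :: "nat \<Rightarrow> nat"
  assumes "strict_mono_on X d" "fst ` set l \<subseteq> X" "sorted_wrt (<) (l :: (nat \<times> nat) list)"
  shows "sorted_wrt (<) (map (map_prod d id) l)"
  unfolding sorted_wrt_map
proof (rule sorted_wrt_mono_rel[OF _ assms(3)])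
  fix x y
  assume "x \<in> set l" "y \<in> set l" "x < y"
  moreover from this have "fst x \<in> X" "fst y \<in> X"
    using assms(2) by auto
  ultimately show "map_prod d id x < map_prod d id y"
    using assms(1) by (auto simp: strict_mono_on_def less_prod_def')
qed

lemma map_prod_rename_sorted_iff:
  fixes d :: "nat \<Rightarrow> nat"
  assumes "strict_mono_on X d" "fst ` set l \<subseteq> X"
  shows "sorted_wrt (<) (map (map_prod d id) l) \<longleftrightarrow> sorted_wrt (<) (l :: (nat \<times> nat) list)"
proof
  assume "sorted_wrt (<) (map (map_prod d id) l)"
  then show "sorted_wrt (<) l"
    unfolding sorted_wrt_map
  proof (rule sorted_wrt_mono_rel[rotated])
    fix x y
    assume "x \<in> set l" "y \<in> set l" "map_prod d id x < map_prod d id y"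
    moreover from this have "fst x \<in> X" "fst y \<in> X"
      using assms(2) by auto
    ultimately show "x < y"
      using strict_mono_on_less[OF assms(1), of "fst x" "fst y"]
        strict_mono_on_eqD[OF assms(1), of "fst x" "fst y"]
      by (auto simp: less_prod_def')
  qed
qed (rule map_prod_rename_sorted[OF assms])

text \<open>
  An increasing list over the ordered variables \<open>x\<^sub>1 < x\<^sub>2 < \<dots> < y\<^sub>1 < y\<^sub>2 < \<dots>\<close> is an increasing
  list over the \<open>x\<close>'s followed by one over the \<open>y\<close>'s; \<open>d\<close> and \<open>e\<close> realise this order in the
  positive integers.
\<close>

lemma bij_betw_rename:
  assumes d: "strict_mono_on X d" and e: "strict_mono_on Y e"
    and de: "\<And>r s. r \<in> X \<Longrightarrow> s \<in> Y \<Longrightarrow> d r < e s"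
    and X: "X = Poly_Mapping.keys M" and Y: "Y = Poly_Mapping.keys N"
  shows "bij_betw (\<lambda>(l, l'). map (map_prod d id) l @ map (map_prod e id) l')
    (increasing_lists M \<times> increasing_lists N) (increasing_lists (rename d M + rename e N))"
    (is "bij_betw ?f ?L ?R")
proof (rule bij_betw_imageI)
  have inj: "inj_on d X" "inj_on e Y"
    using d e by (simp_all add: strict_mono_on_imp_inj_on)
  have fin: "finite X" "finite Y"
    by (simp_all add: X Y)
  have fst: "fst ` set l \<subseteq> X" "fst ` set l' \<subseteq> Y" "length l = deg M" "length l' = deg N"
    if "l \<in> increasing_lists M" "l' \<in> increasing_lists N" for l l'
  proof -
    have "M = mono_of l" "N = mono_of l'"
      using that by (simp_all add: increasing_lists_def)
    then show "fst ` set l \<subseteq> X" "fst ` set l' \<subseteq> Y" "length l = deg M" "length l' = deg N"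
      by (simp_all add: X Y keys_mono_of)
  qed
  have map_inj: "l = l'"
    if "map (map_prod c id) l = map (map_prod c id) l'" "inj_on c Z" "fst ` set l \<subseteq> Z" "fst ` set l' \<subseteq> Z"
    for c :: "nat \<Rightarrow> nat" and Z and l l' :: "(nat \<times> nat) list"
  proof (rule map_inj_on[OF that(1)])
    show "inj_on (map_prod c id) (set l \<union> set l')"
      by (rule inj_on_subset[OF map_prod_inj_on[OF that(2) inj_on_id[of UNIV]]]) (use that(3,4) in auto)
  qed
  show "inj_on ?f ?L"
  proof (rule inj_onI)
    fix p q
    assume pq: "p \<in> ?L" "q \<in> ?L" and eq: "?f p = ?f q"
    obtain l l' k k' where p: "p = (l, l')" "q = (k, k')"
      by fastforce
    have mem: "l \<in> increasing_lists M" "l' \<in> increasing_lists N" "k \<in> increasing_lists M" "k' \<in> increasing_lists N"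
      using pq by (simp_all add: p)
    have "map (map_prod d id) l = map (map_prod d id) k" "map (map_prod e id) l' = map (map_prod e id) k'"
      using eq fst(3)[OF mem(1,2)] fst(3)[OF mem(3,4)] by (simp_all add: p)
    then have "l = k" "l' = k'"
      using map_inj inj fst(1,2)[OF mem(1,2)] fst(1,2)[OF mem(3,4)] by blast+
    then show "p = q"
      by (simp add: p)
  qed
  show "?f ` ?L = ?R"
  proof (intro Set.equalityI subsetI)
    fix l
    assume "l \<in> ?f ` ?L"
    then obtain a b where ab: "a \<in> increasing_lists M" "b \<in> increasing_lists N"
      and l: "l = map (map_prod d id) a @ map (map_prod e id) b"
      by auto
    have "x < y" if x: "x \<in> set (map (map_prod d id) a)" and y: "y \<in> set (map (map_prod e id) b)" for x y
    proof -
      obtain x' y' where "x' \<in> set a" "x = map_prod d id x'" "y' \<in> set b" "y = map_prod e id y'"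
        using x y by auto
      moreover from this have "fst x' \<in> X" "fst y' \<in> Y"
        using fst(1,2)[OF ab] by auto
      ultimately show ?thesis
        using de[of "fst x'" "fst y'"] by (simp add: less_prod_def')
    qed
    moreover have "sorted_wrt (<) (map (map_prod d id) a)" "sorted_wrt (<) (map (map_prod e id) b)"
      using ab d e fst(1,2)[OF ab]
      by (auto simp: increasing_lists_def intro!: map_prod_rename_sorted)
    ultimately have "sorted_wrt (<) l"
      by (auto simp: l sorted_wrt_append)
    moreover have "mono_of l = rename d M + rename e N"
      using ab by (simp add: l increasing_lists_def flip: rename_mono_of)
    ultimately show "l \<in> ?R"
      by (simp add: increasing_lists_def)
  next
    fix l
    assume "l \<in> ?R"
    then have sorted: "sorted_wrt (<) l" and mono: "mono_of l = rename d M + rename e N"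
      by (simp_all add: increasing_lists_def)
    have disj: "d ` X \<inter> e ` Y = {}"
      using de by fastforce
    define a where "a = filter (\<lambda>p. fst p \<in> d ` X) l"
    define b where "b = filter (\<lambda>p. fst p \<notin> d ` X) l"
    have "fst ` set l \<subseteq> d ` X \<union> e ` Y"
    proof
      fix k
      assume "k \<in> fst ` set l"
      then have "Poly_Mapping.lookup (rename d M + rename e N) k \<noteq> 0"
        unfolding mono[symmetric] keys_mono_of[symmetric] by (simp add: in_keys_iff)
      then show "k \<in> d ` X \<union> e ` Y"
        using lookup_rename(2)[OF inj(1) fin(1), of M k] lookup_rename(2)[OF inj(2) fin(2), of N k]
        by (auto simp: lookup_add X Y)
    qed
    then have fst_a: "fst ` set a \<subseteq> d ` X" and fst_b: "fst ` set b \<subseteq> e ` Y"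
      by (auto simp: a_def b_def)
    \<comment> \<open>All values of \<open>d\<close> lie below those of \<open>e\<close>, so the
      increasing list \<open>l\<close> is its part over the first variables followed by its part
      over the second.\<close>
    have "sorted_wrt (<) (a @ b)"
      unfolding sorted_wrt_append
    proof (intro conjI ballI)
      fix x y
      assume "x \<in> set a" "y \<in> set b"
      then have "fst x \<in> d ` X" "fst y \<in> e ` Y"
        using fst_a fst_b by auto
      then have "fst x < fst y"
        using de by auto
      then show "x < y"
        by (simp add: less_prod_def')
    qed (use sorted in \<open>simp_all add: a_def b_def sorted_wrt_filter\<close>)
    moreover have "set (a @ b) = set l"
      by (auto simp: a_def b_def)
    ultimately have l: "l = a @ b"
      using sorted by (intro strict_sorted_equal) auto
    have ex: "\<exists>a'. fst ` set a' \<subseteq> Z \<and> a = map (map_prod c id) a'"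
      if sub: "fst ` set a \<subseteq> c ` Z" for c :: "nat \<Rightarrow> nat" and Z and a :: "(nat \<times> nat) list"
    proof -
      have "set a \<subseteq> map_prod c id ` (Z \<times> UNIV)"
      proof
        fix p
        assume "p \<in> set a"
        then obtain z where "z \<in> Z" "fst p = c z"
          using sub by blast
        then show "p \<in> map_prod c id ` (Z \<times> UNIV)"
          by (intro image_eqI[of _ _ "(z, snd p)"]) (auto simp: prod_eq_iff)
      qed
      then have "a \<in> map (map_prod c id) ` lists (Z \<times> UNIV)"
        unfolding lists_image[symmetric] by auto
      then show ?thesis
        by fastforce
    qed
    obtain a' where a': "fst ` set a' \<subseteq> X" "a = map (map_prod d id) a'"
      using ex[OF fst_a] by blast
    obtain b' where b': "fst ` set b' \<subseteq> Y" "b = map (map_prod e id) b'"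
      using ex[OF fst_b] by blast
    have ren: "rename d (mono_of a') + rename e (mono_of b') = rename d M + rename e N"
      using mono by (simp add: l a'(2) b'(2) rename_mono_of)
    have keys: "Poly_Mapping.keys (mono_of a') \<subseteq> X" "Poly_Mapping.keys (mono_of b') \<subseteq> Y"
      "Poly_Mapping.keys M \<subseteq> X" "Poly_Mapping.keys N \<subseteq> Y"
      using a'(1) b'(1) by (simp_all add: keys_mono_of X Y)
    \<comment> \<open>The images of \<open>d\<close> and \<open>e\<close> are disjoint, so comparing
      exponents at \<open>d r\<close> isolates the first summand.\<close>
    have "mono_of a' = M"
    proof (rule poly_mapping_eqI)
      fix r
      show "Poly_Mapping.lookup (mono_of a') r = Poly_Mapping.lookup M r"
      proof (cases "r \<in> X")
        case True
        then have "d r \<notin> e ` Y"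
          using disj by auto
        then show ?thesis
          using arg_cong[OF ren, of "\<lambda>A. Poly_Mapping.lookup A (d r)"] True
          by (simp add: lookup_add lookup_rename(1)[OF inj(1) fin(1) keys(1)]
              lookup_rename(1)[OF inj(1) fin(1) keys(3)] lookup_rename(2)[OF inj(2) fin(2) keys(2)]
              lookup_rename(2)[OF inj(2) fin(2) keys(4)])
      next
        case False
        then show ?thesis
          using keys(1,3) by (metis in_keys_iff subsetD)
      qed
    qed
    moreover have "mono_of b' = N"
    proof (rule poly_mapping_eqI)
      fix r
      show "Poly_Mapping.lookup (mono_of b') r = Poly_Mapping.lookup N r"
      proof (cases "r \<in> Y")
        case True
        then have "e r \<notin> d ` X"
          using disj by auto
        then show ?thesis
          using arg_cong[OF ren, of "\<lambda>A. Poly_Mapping.lookup A (e r)"] True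
          by (simp add: lookup_add lookup_rename(2)[OF inj(1) fin(1) keys(1)]
              lookup_rename(2)[OF inj(1) fin(1) keys(3)] lookup_rename(1)[OF inj(2) fin(2) keys(2)]
              lookup_rename(1)[OF inj(2) fin(2) keys(4)])
      next
        case False
        then show ?thesis
          using keys(2,4) by (metis in_keys_iff subsetD)
      qed
    qed
    moreover have "sorted_wrt (<) a'" "sorted_wrt (<) b'"
      using sorted map_prod_rename_sorted_iff[OF d a'(1)] map_prod_rename_sorted_iff[OF e b'(1)]
      by (simp_all add: l a'(2) b'(2) sorted_wrt_append)
    ultimately show "l \<in> ?f ` ?L"
      by (intro image_eqI[of _ _ "(a', b')"]) (simp_all add: increasing_lists_def l a'(2) b'(2))
  qed
qed

text \<open>A pair of increasing lists spells two words, and the joined list spells their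
  overlapping concatenation; grouping by the two words gives the sum over splittings. The right side
  mentions neither \<open>d\<close> nor \<open>e\<close>, which is quasisymmetry.\<close>

lemma words_count_rename:
  assumes "strict_mono_on (Poly_Mapping.keys M) d" "strict_mono_on (Poly_Mapping.keys N) e"
    and "\<And>r. r \<in> Poly_Mapping.keys M \<Longrightarrow> 0 < d r" "\<And>s. s \<in> Poly_Mapping.keys N \<Longrightarrow> 0 < e s"
    and "\<And>r s. r \<in> Poly_Mapping.keys M \<Longrightarrow> s \<in> Poly_Mapping.keys N \<Longrightarrow> d r < e s"
    and "0 \<notin> Poly_Mapping.keys M" "0 \<notin> Poly_Mapping.keys N" and z: "distinct_adj z"
  shows "words_count z (rename d M + rename e N) =
    (\<Sum>(u, v)\<in>splittings z. words_count u M * words_count v N)"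
proof -
  let ?f = "\<lambda>(l, l'). map (map_prod d id) l @ map (map_prod e id) l'"
  let ?L = "{p \<in> increasing_lists M \<times> increasing_lists N.
      overlap_append (remdups_adj (map snd (fst p))) (remdups_adj (map snd (snd p))) = z}"
  let ?R = "{l \<in> increasing_lists (rename d M + rename e N). remdups_adj (map snd l) = z}"
  note bij = bij_betw_rename[OF assms(1,2,5) refl refl]
  have keys: "0 \<notin> Poly_Mapping.keys (rename d M + rename e N)"
  proof -
    have "0 \<notin> d ` Poly_Mapping.keys M" "0 \<notin> e ` Poly_Mapping.keys N"
      using assms(3,4) by fastforce+
    then show ?thesis
      using lookup_rename(2)[OF strict_mono_on_imp_inj_on[OF assms(1)], of M 0]
        lookup_rename(2)[OF strict_mono_on_imp_inj_on[OF assms(2)], of N 0]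
      by (simp add: in_keys_iff lookup_add)
  qed
  have snd: "remdups_adj (map snd (?f p)) =
      overlap_append (remdups_adj (map snd (fst p))) (remdups_adj (map snd (snd p)))"
    for p :: "(nat \<times> nat) list \<times> (nat \<times> nat) list"
    by (simp add: case_prod_unfold remdups_adj_append_overlap comp_def)
  have img: "?f ` (increasing_lists M \<times> increasing_lists N) = increasing_lists (rename d M + rename e N)"
    using bij by (simp add: bij_betw_def)
  have "bij_betw ?f ?L ?R"
  proof (rule bij_betw_subset[OF bij])
    show "?f ` ?L = ?R"
      unfolding img[symmetric] using snd by (auto simp: image_iff)
  qed auto
  then have "words_count z (rename d M + rename e N) = card ?L"
    unfolding words_count_def enc_lists_monomial[OF keys] by (rule bij_betw_same_card[symmetric])
  also have "?L = (\<Union>(u, v)\<in>splittings z. {l \<in> enc_lists u. mono_of l = M} \<times> {l \<in> enc_lists v. mono_of l = N})"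
    unfolding enc_lists_monomial[OF assms(6)] enc_lists_monomial[OF assms(7)]
    by (auto simp: splittings_def distinct_adj_remdups_adj)
  also have "card \<dots> = (\<Sum>(u, v)\<in>splittings z. words_count u M * words_count v N)"
  proof (subst card_UN_disjoint)
    show "(\<Sum>p\<in>splittings z. card (case p of (u, v) \<Rightarrow>
        {l \<in> enc_lists u. mono_of l = M} \<times> {l \<in> enc_lists v. mono_of l = N})) =
      (\<Sum>(u, v)\<in>splittings z. words_count u M * words_count v N)"
      by (intro sum.cong) (auto simp: words_count_def card_cartesian_product)
    show "\<forall>p\<in>splittings z. \<forall>q\<in>splittings z. p \<noteq> q \<longrightarrow>
      (case p of (u, v) \<Rightarrow> {l \<in> enc_lists u. mono_of l = M} \<times> {l \<in> enc_lists v. mono_of l = N}) \<inter>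
      (case q of (u, v) \<Rightarrow> {l \<in> enc_lists u. mono_of l = M} \<times> {l \<in> enc_lists v. mono_of l = N}) = {}"
      by (auto simp: enc_lists_def)
  qed (use z in \<open>auto simp: finite_splittings finite_enc_lists\<close>)
  finally show ?thesis .
qed

section \<open>The bialgebra morphism\<close>

abbreviation short_mperms :: "nat \<Rightarrow> nat list set" where
  "short_mperms d \<equiv> {w \<in> mperms. length w \<le> d}"

lemma psi_word_eq_0: "w \<in> mperms \<Longrightarrow> deg M < length w \<Longrightarrow> psi_word w M = 0"
  using mpermsD(1)[of w] by (simp add: psi_word_eq words_count_eq_0)

lemma psi_word_length: "psi_word w M \<noteq> 0 \<Longrightarrow> w \<in> mperms \<Longrightarrow> length w \<le> deg M"
  using psi_word_eq_0 not_le by blast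

lemma psi_word_0:
  assumes "0 \<in> Poly_Mapping.keys M" "distinct_adj w"
  shows "psi_word w M = 0"
proof -
  have empty: "{l \<in> enc_lists w. mono_of l = M} = {}"
    using assms(1) by (force simp: enc_lists_def keys_mono_of)
  show ?thesis
    unfolding psi_word_eq[OF assms(2)] words_count_def empty by simp
qed

text \<open>The bound \<open>d\<close> is left free so that one finite index set can serve several
  monomials at once, such as the factors of a product.\<close>

lemma psi_eq_sum:
  assumes "deg M \<le> d"
  shows "psi f M = (\<Sum>w\<in>short_mperms d. f w * psi_word w M)"
  unfolding psi_def using assms
  by (intro lincomb_eq_sum finite_mperms_length) (auto intro: psi_word_eq_0)

lemma psi_tensor_eq_sum:
  assumes "deg M \<le> d" "deg N \<le> d"
  shows "psi_tensor T (M, N) =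
    (\<Sum>p\<in>short_mperms d \<times> short_mperms d. T p * (psi_word (fst p) M * psi_word (snd p) N))"
proof -
  have "psi_tensor T (M, N) = (\<Sum>p\<in>short_mperms d \<times> short_mperms d.
      T p * (case p of (w, u) \<Rightarrow> tensor (psi_word w) (psi_word u)) (M, N))"
    unfolding psi_tensor_def using assms
    by (intro lincomb_eq_sum finite_cartesian_product finite_mperms_length)
      (auto simp: tensor_def intro: order_trans[OF psi_word_length])
  then show ?thesis
    by (simp add: tensor_def case_prod_unfold)
qed

text \<open>At \<open>M\<close> only words of length at most \<open>deg M\<close> matter, and the
  factors of such a term are no longer than the term itself. All sums become finite, and exchanging
  them reduces the claim to pairs of basis words.\<close>

lemma psi_mul: "psi (mul mMR f g) = series_mult (psi f) (psi g)"
proof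
  fix M
  let ?W = "short_mperms (deg M)"
  have mul: "mul mMR f g x = (\<Sum>p\<in>?W \<times> ?W. tensor f g p * mMR_mul_word p x)" if "x \<in> ?W" for x
  proof -
    have "tensor f g p * mMR_mul_word p x = 0" if "p \<in> mperms \<times> mperms - ?W \<times> ?W" for p
    proof -
      have "mMR_mul_word p x = 0"
        using that \<open>x \<in> ?W\<close> mMR_mul_word_nonzero(2,3)[of "fst p" "snd p" x]
        by (cases p) fastforce
      then show ?thesis
        by simp
    qed
    then show ?thesis
      unfolding mMR_def bialg.simps
      by (intro lincomb_eq_sum finite_cartesian_product finite_mperms_length) auto
  qed
  have "psi (mul mMR f g) M =
      (\<Sum>x\<in>?W. \<Sum>p\<in>?W \<times> ?W. tensor f g p * (mMR_mul_word p x * psi_word x M))"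
    by (simp add: psi_eq_sum[OF order_refl] mul sum_distrib_right mult.assoc)
  also have "\<dots> = (\<Sum>p\<in>?W \<times> ?W. tensor f g p * (\<Sum>x\<in>?W. mMR_mul_word p x * psi_word x M))"
    by (subst sum.swap) (simp add: sum_distrib_left)
  also have "\<dots> = (\<Sum>p\<in>?W \<times> ?W. tensor f g p *
      (\<Sum>(A, B)\<in>{(A, B). A + B = M}. psi_word (fst p) A * psi_word (snd p) B))"
    by (intro sum.cong refl arg_cong2[of _ _ _ _ "(*)"]) (auto simp: sum_mMR_mul_word)
  also have "\<dots> = (\<Sum>(A, B)\<in>{(A, B). A + B = M}. \<Sum>p\<in>?W \<times> ?W.
      tensor f g p * (psi_word (fst p) A * psi_word (snd p) B))"
    unfolding sum_distrib_left case_prod_unfold by (rule sum.swap)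
  also have "\<dots> = (\<Sum>(A, B)\<in>{(A, B). A + B = M}. psi f A * psi g B)"
  proof (intro sum.cong refl, clarify)
    fix A B
    assume "M = A + B"
    then have le: "deg A \<le> deg M" "deg B \<le> deg M"
      by simp_all
    have "psi f A * psi g B = (\<Sum>w\<in>?W. \<Sum>u\<in>?W. (f w * psi_word w A) * (g u * psi_word u B))"
      by (simp only: psi_eq_sum[OF le(1)] psi_eq_sum[OF le(2)] sum_product)
    also have "\<dots> = (\<Sum>p\<in>?W \<times> ?W. tensor f g p * (psi_word (fst p) A * psi_word (snd p) B))"
      unfolding sum.cartesian_product
      by (intro sum.cong refl) (simp add: tensor_def case_prod_unfold ac_simps)
    finally show "(\<Sum>p\<in>short_mperms (deg (A + B)) \<times> short_mperms (deg (A + B)).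
        tensor f g p * (psi_word (fst p) A * psi_word (snd p) B)) = psi f A * psi g B"
      by (simp only: \<open>M = A + B\<close>)
  qed
  finally show "psi (mul mMR f g) M = series_mult (psi f) (psi g) M"
    by (simp add: series_mult_def)
qed

text \<open>The halves of a cut cover \<open>z\<close>, with one letter possibly counted twice; a
  given pair therefore occurs only in coproducts of words of bounded length.\<close>

lemma mMR_cop_word_nonzero:
  assumes "z \<in> mperms" "mMR_cop_word z p \<noteq> 0"
  shows "p \<in> mperms \<times> mperms" "length z \<le> length (fst p) + length (snd p)"
proof -
  have dist: "distinct_adj (take i z)" "distinct_adj (drop i z)" for i
    using mpermsD(1)[OF assms(1)] distinct_adj_appendD1[of "take i z" "drop i z"]
      distinct_adj_appendD2[of "take i z" "drop i z"] by simp_all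
  have "(\<exists>i\<in>{0..length z}. delta (st (take i z), st (drop i z)) p \<noteq> 0) \<or>
      (\<exists>i\<in>{1..length z}. delta (st (take i z), st (drop (i - 1) z)) p \<noteq> 0)"
  proof (rule ccontr)
    assume "\<not> ?thesis"
    then have "mMR_cop_word z p = 0"
      unfolding mMR_cop_word_def by simp
    then show False
      using assms(2) by simp
  qed
  then obtain i j where "j \<le> i" "i \<le> length z" "p = (st (take i z), st (drop j z))"
  proof (elim disjE bexE)
    fix i
    assume "i \<in> {0..length z}" "delta (st (take i z), st (drop i z)) p \<noteq> 0"
    then show thesis
      by (intro that[of i i]) (simp_all add: delta_def)
  next
    fix i
    assume "i \<in> {1..length z}" "delta (st (take i z), st (drop (i - 1) z)) p \<noteq> 0"
    then show thesis
      by (intro that[of "i - 1" i]) (simp_all add: delta_def)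
  qed
  then show "p \<in> mperms \<times> mperms" "length z \<le> length (fst p) + length (snd p)"
    by (simp_all add: st dist)
qed

lemma locally_finite_mMR_cop_word: "locally_finite mperms mMR_cop_word"
  unfolding locally_finite_def
proof
  fix p
  have "{z \<in> mperms. mMR_cop_word z p \<noteq> 0} \<subseteq> short_mperms (length (fst p) + length (snd p))"
    using mMR_cop_word_nonzero(2) by auto
  then show "finite {z \<in> mperms. mMR_cop_word z p \<noteq> 0}"
    by (rule finite_subset) (rule finite_mperms_length)
qed

lemma sum_mMR_cop_word:
  assumes "z \<in> mperms" "deg M \<le> d" "deg N \<le> d"
  shows "(\<Sum>p\<in>short_mperms d \<times> short_mperms d. mMR_cop_word z p * (psi_word (fst p) M * psi_word (snd p) N)) =
    (\<Sum>(u, v)\<in>splittings z. psi_word u M * psi_word v N)"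
proof -
  let ?P = "short_mperms d \<times> short_mperms d"
  let ?g = "\<lambda>p. psi_word (fst p) M * psi_word (snd p) N"
  have z: "distinct_adj z"
    using mpermsD(1)[OF assms(1)] .
  have dist: "distinct_adj (take i z)" "distinct_adj (drop i z)" for i
    using z distinct_adj_appendD1[of "take i z" "drop i z"]
      distinct_adj_appendD2[of "take i z" "drop i z"] by simp_all
  have fin: "finite ?P"
    by (intro finite_cartesian_product finite_mperms_length)
  have delta: "(\<Sum>p\<in>?P. delta (st (take i z), st (drop j z)) p * ?g p) =
      psi_word (take i z) M * psi_word (drop j z) N" for i j
  proof -
    let ?q = "(st (take i z), st (drop j z))"
    have "(\<Sum>p\<in>?P. delta ?q p * ?g p) = (\<Sum>p\<in>?P. if p = ?q then ?g p else 0)"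
      by (intro sum.cong) (simp_all add: delta_def)
    also have "\<dots> = (if ?q \<in> ?P then ?g ?q else 0)"
      using fin by (rule sum.delta)
    \<comment> \<open>If a half is too long for the truncated index set, its coefficient vanishes by
      degree, so nothing is lost.\<close>
    also have "\<dots> = ?g ?q"
    proof (cases "?q \<in> ?P")
      case False
      then have "deg M < length (st (take i z)) \<or> deg N < length (st (drop j z))"
        using assms(2,3) st(1)[OF dist(1)] st(1)[OF dist(2)] by auto
      then have "?g ?q = 0"
        using psi_word_eq_0[OF st(1)[OF dist(1)]] psi_word_eq_0[OF st(1)[OF dist(2)]] by auto
      then show ?thesis
        using False by simp
    qed simp
    finally show ?thesis
      by (simp add: psi_word_st dist)
  qed
  have "(\<Sum>p\<in>?P. mMR_cop_word z p * ?g p) =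
      (\<Sum>i=0..length z. \<Sum>p\<in>?P. delta (st (take i z), st (drop i z)) p * ?g p) +
      (\<Sum>i=1..length z. \<Sum>p\<in>?P. delta (st (take i z), st (drop (i - 1) z)) p * ?g p)"
    unfolding mMR_cop_word_def distrib_right sum.distrib sum_distrib_right
    by (subst sum.swap, subst (2) sum.swap) (rule refl)
  then show ?thesis
    unfolding delta sum_splittings[OF z] .
qed

text \<open>The \<open>THE\<close> in \<open>series_xy\<close> pins down a value only if some
  admissible renaming exists. The sum of \<open>X\<close> bounds all elements of \<open>X\<close>,
  also when \<open>X\<close> is empty, so adding it to positive numbers clears
  \<open>X\<close>.\<close>

lemma ex_separating_shifts:
  fixes X Y :: "nat set"
  assumes "finite X" "finite Y" "0 \<notin> X" "0 \<notin> Y"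
  shows "\<exists>d e. strict_mono_on X d \<and> strict_mono_on Y e \<and> (\<forall>r\<in>X. 0 < d r) \<and> (\<forall>s\<in>Y. 0 < e s) \<and>
    (\<forall>r\<in>X. \<forall>s\<in>Y. (d r :: nat) < e s)"
proof (intro exI conjI ballI)
  show "strict_mono_on X id" "strict_mono_on Y ((+) (\<Sum>X))"
    by (auto simp: strict_mono_on_def)
  show "0 < id r" if "r \<in> X" for r
    using that assms(3) by (cases r) auto
  show "0 < \<Sum>X + s" if "s \<in> Y" for s
    using that assms(4) by (cases s) auto
  show "id r < \<Sum>X + s" if "r \<in> X" "s \<in> Y" for r s
  proof -
    have "r \<le> \<Sum>X"
      using assms(1) that(1) member_le_sum[of r X "\<lambda>x. x"] by simp
    moreover have "0 < s"
      using that(2) assms(4) by (cases s) auto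
    ultimately show ?thesis
      by simp
  qed
qed

text \<open>By \<open>words_count_rename\<close> all admissible renamings give the same coefficient,
  so a value as required by \<open>THE\<close> exists; one admissible renaming makes it
  unique.\<close>

lemma series_xy_psi:
  assumes "0 \<notin> Poly_Mapping.keys M" "0 \<notin> Poly_Mapping.keys N"
  shows "series_xy (psi f) (M, N) =
    (\<Sum>z\<in>short_mperms (deg M + deg N). f z * (\<Sum>(u, v)\<in>splittings z. psi_word u M * psi_word v N))"
    (is "_ = ?c")
proof -
  let ?X = "Poly_Mapping.keys M" and ?Y = "Poly_Mapping.keys N"
  let ?ok = "\<lambda>d e. strict_mono_on ?X d \<and> strict_mono_on ?Y e \<and> (\<forall>r\<in>?X. 0 < d r) \<and> (\<forall>s\<in>?Y. 0 < e s) \<and>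
       (\<forall>r\<in>?X. \<forall>s\<in>?Y. d r < e s)"
  have eq: "psi f (rename d M + rename e N) = ?c" if "?ok d e" for d e
  proof -
    have "psi_word z (rename d M + rename e N) = (\<Sum>(u, v)\<in>splittings z. psi_word u M * psi_word v N)"
      if "z \<in> mperms" for z
    proof -
      have z: "distinct_adj z"
        using mpermsD(1)[OF that] .
      have "(\<Sum>(u, v)\<in>splittings z. psi_word u M * psi_word v N) =
          (\<Sum>(u, v)\<in>splittings z. int (words_count u M * words_count v N))"
        by (intro sum.cong) (auto simp: splittings_def psi_word_eq)
      then show ?thesis
        using \<open>?ok d e\<close> assms words_count_rename[OF _ _ _ _ _ assms z, of d e]
        by (simp add: psi_word_eq[OF z] case_prod_unfold)
    qed
    then show ?thesis
      by (subst psi_eq_sum[of _ "deg M + deg N"]) simp_all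
  qed
  have "(THE c. \<forall>d e. ?ok d e \<longrightarrow> psi f (rename d M + rename e N) = c) = ?c"
  proof (rule the_equality)
    show "\<forall>d e. ?ok d e \<longrightarrow> psi f (rename d M + rename e N) = ?c"
      using eq by blast
    show "c = ?c" if c: "\<forall>d e. ?ok d e \<longrightarrow> psi f (rename d M + rename e N) = c" for c
    proof -
      obtain d e :: "nat \<Rightarrow> nat" where ok: "?ok d e"
        using ex_separating_shifts[OF finite_keys finite_keys assms] by blast
      have "psi f (rename d M + rename e N) = c"
        using c ok by blast
      then show ?thesis
        using eq[OF ok] by (rule trans[OF sym])
    qed
  qed
  then show ?thesis
    using assms by (simp add: series_xy_def Let_def)
qed

lemma psi_cop: "psi_tensor (cop mMR f) = series_xy (psi f)"
proof
  fix p :: "monomial \<times> monomial"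
  obtain M N where p: "p = (M, N)"
    by (cases p)
  define d where "d = max (deg M) (deg N)"
  have d: "deg M \<le> d" "deg N \<le> d"
    by (simp_all add: d_def)
  show "psi_tensor (cop mMR f) p = series_xy (psi f) p"
  proof (cases "0 \<in> Poly_Mapping.keys M \<union> Poly_Mapping.keys N")
    case True
    \<comment> \<open>There is no variable of index 0: the left side vanishes by
      \<open>psi_word_0\<close>, the right side by the convention in
      \<open>series_xy\<close>.\<close>
    have "psi_tensor (cop mMR f) (M, N) = 0"
      unfolding psi_tensor_eq_sum[OF d]
    proof (rule sum.neutral, rule ballI)
      fix p
      assume "p \<in> short_mperms d \<times> short_mperms d"
      then have "psi_word (fst p) M = 0 \<or> psi_word (snd p) N = 0"
        using True psi_word_0 mpermsD(1) by fastforce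
      then show "cop mMR f p * (psi_word (fst p) M * psi_word (snd p) N) = 0"
        by auto
    qed
    moreover have "series_xy (psi f) (M, N) = 0"
      using True by (auto simp: series_xy_def Let_def)
    ultimately show ?thesis
      by (simp add: p)
  next
    case False
    let ?W = "short_mperms (deg M + deg N)"
    let ?P = "short_mperms d \<times> short_mperms d"
    \<comment> \<open>Bounding each half by its own degree, instead of by \<open>d\<close>,
      restricts \<open>z\<close> to length at most \<open>deg M + deg N\<close>, the index set of
      \<open>series_xy_psi\<close>.\<close>
    let ?P' = "{p \<in> ?P. length (fst p) \<le> deg M \<and> length (snd p) \<le> deg N}"
    let ?g = "\<lambda>p. psi_word (fst p) M * psi_word (snd p) N"
    have fin: "finite ?P"
      by (intro finite_cartesian_product finite_mperms_length)
    have restrict: "(\<Sum>p\<in>?P. h p * ?g p) = (\<Sum>p\<in>?P'. h p * ?g p)" for h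
      using fin by (intro sum.mono_neutral_right) (auto intro: psi_word_length)
    have cop: "cop mMR f p = (\<Sum>z\<in>?W. f z * mMR_cop_word z p)" if "p \<in> ?P'" for p
      unfolding mMR_def bialg.simps
    proof (rule lincomb_eq_sum)
      fix z
      assume "z \<in> mperms - ?W"
      then have "mMR_cop_word z p = 0"
        using that mMR_cop_word_nonzero(2)[of z p] by fastforce
      then show "f z * mMR_cop_word z p = 0"
        by simp
    qed (auto simp: finite_mperms_length)
    have "psi_tensor (cop mMR f) (M, N) = (\<Sum>p\<in>?P'. \<Sum>z\<in>?W. f z * (mMR_cop_word z p * ?g p))"
      unfolding psi_tensor_eq_sum[OF d] restrict
      by (simp add: cop sum_distrib_right mult.assoc)
    also have "\<dots> = (\<Sum>z\<in>?W. f z * (\<Sum>p\<in>?P. mMR_cop_word z p * ?g p))"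
      unfolding restrict by (subst sum.swap) (simp add: sum_distrib_left)
    also have "\<dots> = series_xy (psi f) (M, N)"
      using False by (simp add: sum_mMR_cop_word[OF _ d] series_xy_psi)
    finally show ?thesis
      by (simp add: p)
  qed
qed

lemma psi_tens: "psi_tensor (tensor f g) = tensor (psi f) (psi g)"
proof
  fix p :: "monomial \<times> monomial"
  obtain M N where p: "p = (M, N)"
    by (cases p)
  let ?W = "short_mperms (max (deg M) (deg N))"
  have d: "deg M \<le> max (deg M) (deg N)" "deg N \<le> max (deg M) (deg N)"
    by simp_all
  have "psi f M * psi g N = (\<Sum>w\<in>?W. \<Sum>u\<in>?W. (f w * psi_word w M) * (g u * psi_word u N))"
    by (simp only: psi_eq_sum[OF d(1)] psi_eq_sum[OF d(2)] sum_product)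
  also have "\<dots> = (\<Sum>p\<in>?W \<times> ?W. tensor f g p * (psi_word (fst p) M * psi_word (snd p) N))"
    unfolding sum.cartesian_product
    by (intro sum.cong refl) (simp add: tensor_def case_prod_unfold ac_simps)
  also have "\<dots> = psi_tensor (tensor f g) (M, N)"
    by (rule psi_tensor_eq_sum[OF d, symmetric])
  finally show "psi_tensor (tensor f g) p = tensor (psi f) (psi g) p"
    by (simp add: p tensor_def)
qed

lemma Nil_in_mperms [simp]: "[] \<in> mperms"
  by (auto simp: mperms_def mperm_def intro: exI[of _ 0])

lemma short_mperms_0: "short_mperms 0 = {[]}"
  by auto

lemma psi_word_Nil: "psi_word [] = delta 0"
proof
  fix M
  have "{l \<in> enc_lists []. mono_of l = M} = (if M = 0 then {[]} else {})"
    by auto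
  then show "psi_word [] M = delta 0 M"
    by (simp add: psi_word_eq words_count_def delta_def)
qed

lemma psi_unt: "psi (unt mMR n) = (\<lambda>M. n * delta 0 M)"
proof
  fix M
  have "psi (unt mMR n) M = (\<Sum>w\<in>{[]}. unt mMR n w * psi_word w M)"
    unfolding psi_def by (intro lincomb_eq_sum) (auto simp: mMR_def delta_def)
  then show "psi (unt mMR n) M = n * delta 0 M"
    by (simp add: psi_word_Nil mMR_def delta_def)
qed

lemma psi_cou: "psi f 0 = f []"
  using psi_eq_sum[of 0 0 f] unfolding short_mperms_0 by (simp add: psi_word_Nil delta_def)

section \<open>Image and kernel of \<open>psi\<close> and of its tensor square\<close>

lemma finite_comp_of_word_fibre: "finite {w \<in> mperms. comp_of_word w = \<alpha>}"
proof (rule finite_subset)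
  show "{w \<in> mperms. comp_of_word w = \<alpha>} \<subseteq> short_mperms (sum_list \<alpha>)"
    by auto
qed (rule finite_mperms_length)

lemma finite_comp_of_word_fibre2:
  "finite {p \<in> mperms \<times> mperms. map_prod comp_of_word comp_of_word p = q}"
proof -
  have "{p \<in> mperms \<times> mperms. map_prod comp_of_word comp_of_word p = q} =
      {w \<in> mperms. comp_of_word w = fst q} \<times> {w \<in> mperms. comp_of_word w = snd q}"
    by (auto simp: map_prod_def)
  then show ?thesis
    by (simp add: finite_comp_of_word_fibre)
qed

abbreviation Ltilde2 :: "nat list \<times> nat list \<Rightarrow> monomial \<times> monomial \<Rightarrow> int" where
  "Ltilde2 \<equiv> \<lambda>(\<alpha>, \<beta>). tensor (Ltilde \<alpha>) (Ltilde \<beta>)"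

lemma psi_word_comp: "psi_word = (\<lambda>w. Ltilde (comp_of_word w))"
  by (simp add: fun_eq_iff psi_word_def)

lemma psi_word2_comp: "(\<lambda>(w, u). tensor (psi_word w) (psi_word u)) =
    (\<lambda>p. Ltilde2 (map_prod comp_of_word comp_of_word p))"
  by (simp add: psi_word_comp case_prod_unfold)

lemma comp_of_word_funcset:
  "comp_of_word \<in> mperms \<rightarrow> compositions"
  "map_prod comp_of_word comp_of_word \<in> mperms \<times> mperms \<rightarrow> compositions \<times> compositions"
  by auto

lemmas locally_finite_Ltilde2 = locally_finite_tensor[OF locally_finite_Ltilde locally_finite_Ltilde]

lemmas independent_family_Ltilde2 = independent_family_tensor[OF locally_finite_Ltilde
    locally_finite_Ltilde independent_family_Ltilde independent_family_Ltilde]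

lemmas fibre_facts = locally_finite_Ltilde comp_of_word_funcset(1) finite_comp_of_word_fibre

lemmas fibre_facts2 = locally_finite_Ltilde2 comp_of_word_funcset(2) finite_comp_of_word_fibre2

lemma locally_finite_psi_word: "locally_finite mperms psi_word"
  unfolding psi_word_comp by (rule locally_finite_comp[OF fibre_facts])

lemma locally_finite_psi_word2:
  "locally_finite (mperms \<times> mperms) (\<lambda>(w, u). tensor (psi_word w) (psi_word u))"
  unfolding psi_word2_comp by (rule locally_finite_comp[OF fibre_facts2])

text \<open>The section \<open>perm_of_comp\<close> of \<open>comp_of_word\<close> lifts any family
  of coefficients, so arbitrary infinite combinations of the \<open>Ltilde\<close> are
  reached.\<close>

lemma psi_image: "psi ` carr mMR = carr L_bialg"
  using lincomb_comp_image[OF fibre_facts, of perm_of_comp]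
  by (simp add: psi_def[abs_def] psi_word_comp mMR_def L_bialg_def perm_of_comp_in_mperms perm_of_comp)

lemma psi_tensor_image: "psi_tensor ` tcarr mMR = tcarr L_bialg"
  unfolding psi_tensor_def[abs_def] psi_word2_comp mMR_def L_bialg_def bialg.simps
  by (rule lincomb_comp_image[OF fibre_facts2, of "map_prod perm_of_comp perm_of_comp"])
    (auto simp: perm_of_comp_in_mperms perm_of_comp)

text \<open>\<open>I_ideal\<close> is described by representatives among the words, the kernel by
  compositions; the section \<open>r\<close> translates between them. Words that are not
  representatives have empty fibres and impose no condition.\<close>

lemma fibre_sum_section:
  assumes "\<kappa> \<in> X \<rightarrow> K" "\<And>k. k \<in> K \<Longrightarrow> r k \<in> X \<and> \<kappa> (r k) = k"
  shows "(\<forall>x\<in>X. fibre_sum X (\<lambda>x. r (\<kappa> x)) f x = 0) \<longleftrightarrow> (\<forall>k\<in>K. fibre_sum X \<kappa> f k = 0)"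
proof -
  have "fibre_sum X (\<lambda>x. r (\<kappa> x)) f (r k) = fibre_sum X \<kappa> f k" if "k \<in> K" for k
  proof -
    have "{x \<in> X. r (\<kappa> x) = r k} = {x \<in> X. \<kappa> x = k}"
      using assms that by (metis (mono_tags, lifting) Pi_iff)
    then show ?thesis
      by (simp add: fibre_sum_def)
  qed
  moreover have "fibre_sum X (\<lambda>x. r (\<kappa> x)) f x = 0" if "x \<in> X" "x \<noteq> r (\<kappa> x)" for x
  proof -
    have empty: "{y \<in> X. r (\<kappa> y) = x} = {}"
      using assms that by (auto simp: Pi_iff)
    show ?thesis
      unfolding fibre_sum_def empty by simp
  qed
  ultimately show ?thesis
    using assms by (metis Pi_iff)
qed

abbreviation rep :: "nat list \<Rightarrow> nat list" where
  "rep w \<equiv> perm_of_comp (comp_of_word w)"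

lemma rep:
  "rep \<in> mperms \<rightarrow> mperms" "rep (rep w) = rep w"
  "same_Des = {(w, u). w \<in> mperms \<and> u \<in> mperms \<and> rep w = rep u}"
proof -
  show "rep \<in> mperms \<rightarrow> mperms"
    by (simp add: perm_of_comp_in_mperms)
  show "rep (rep w) = rep w"
    by (simp add: perm_of_comp)
  have "rep w = rep u \<longleftrightarrow> length w = length u \<and> Des w = Des u" for w u
    using perm_of_comp(4)[of "comp_of_word w"] perm_of_comp(4)[of "comp_of_word u"]
      comp_of_word_eq_iff[of w u] by (metis compositions_comp_of_word)
  then show "same_Des = {(w, u). w \<in> mperms \<and> u \<in> mperms \<and> rep w = rep u}"
    by (auto simp: same_Des_def)
qed

lemma finite_rep_fibre: "finite {w \<in> mperms. rep w = x}"
proof (rule finite_subset)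
  show "{w \<in> mperms. rep w = x} \<subseteq> short_mperms (length x)"
    using perm_of_comp(3)[OF compositions_comp_of_word] by auto
qed (rule finite_mperms_length)

lemma I_ideal_eq: "I_ideal = {f \<in> carr mMR. \<forall>\<alpha>\<in>compositions. fibre_sum mperms comp_of_word f \<alpha> = 0}"
  using ideal_eq[OF rep(1,2) finite_rep_fibre rep(3)]
    fibre_sum_section[OF comp_of_word_funcset(1), of perm_of_comp]
  by (simp add: I_ideal_def mMR_def perm_of_comp_in_mperms perm_of_comp)

lemma I_tensor_eq: "I_tensor = {f \<in> tcarr mMR. \<forall>q\<in>compositions \<times> compositions.
    fibre_sum (mperms \<times> mperms) (map_prod comp_of_word comp_of_word) f q = 0}"
proof -
  have eq: "(\<lambda>p. map_prod perm_of_comp perm_of_comp (map_prod comp_of_word comp_of_word p)) = map_prod rep rep"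
    by (auto simp: fun_eq_iff)
  have "map_prod perm_of_comp perm_of_comp q \<in> mperms \<times> mperms \<and>
      map_prod comp_of_word comp_of_word (map_prod perm_of_comp perm_of_comp q) = q"
    if "q \<in> compositions \<times> compositions" for q
    using that by (auto simp: perm_of_comp_in_mperms perm_of_comp)
  note zero_iff = fibre_sum_section[OF comp_of_word_funcset(2) this, unfolded eq]
  have "(\<forall>p\<in>mperms \<times> mperms. fibre_sum (mperms \<times> mperms) (map_prod rep rep) f p = 0) \<longleftrightarrow>
      (\<forall>q\<in>compositions \<times> compositions.
        fibre_sum (mperms \<times> mperms) (map_prod comp_of_word comp_of_word) f q = 0)" for f
    by (rule zero_iff)
  then show ?thesis
    unfolding I_tensor_def tensor_ideal_eq[OF rep(1,2) finite_rep_fibre rep(3)]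
    by (simp add: mMR_def)
qed

text \<open>By independence, \<open>psi f = psi g\<close> says that all fibre sums of
  \<open>f - g\<close> over compositions vanish, which is the description of \<open>I_ideal\<close>
  in \<open>I_ideal_eq\<close>.\<close>

lemma I_rel_eq: "I_rel = kernel_rel (carr mMR) psi"
proof -
  have "f - g \<in> carr mMR" if "f \<in> carr mMR" "g \<in> carr mMR" for f g
    using that by (simp add: mMR_def)
  then show ?thesis
    using lincomb_comp_eq_iff[OF fibre_facts independent_family_Ltilde]
    by (auto simp: I_rel_def congruence_def kernel_rel_def I_ideal_eq psi_def psi_word_comp)
qed

lemma I_trel_eq: "I_trel = kernel_rel (tcarr mMR) psi_tensor"
proof -
  have diff: "S - T \<in> tcarr mMR" if "S \<in> tcarr mMR" "T \<in> tcarr mMR" for S T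
    using that by (simp add: mMR_def)
  show ?thesis
    unfolding I_trel_def congruence_def kernel_rel_def I_tensor_eq psi_tensor_def psi_word2_comp
      lincomb_comp_eq_iff[OF fibre_facts2 independent_family_Ltilde2]
    using diff by auto
qed

lemma mMR_closed: "bialg_closed mMR"
proof -
  have "mul mMR f g x = 0" if "x \<notin> mperms" for f g x
  proof -
    have "mMR_mul_word p x = 0" if "p \<in> mperms \<times> mperms" for p
      using that \<open>x \<notin> mperms\<close> mMR_mul_word_nonzero(1)[of "fst p" "snd p" x]
      by (cases "mMR_mul_word p x = 0") auto
    then show ?thesis
      unfolding mMR_def bialg.simps lincomb_def by (intro sum.neutral) auto
  qed
  moreover have "cop mMR f p = 0" if "p \<notin> mperms \<times> mperms" for f p
  proof -
    have "mMR_cop_word z p = 0" if "z \<in> mperms" for z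
      using \<open>p \<notin> mperms \<times> mperms\<close> mMR_cop_word_nonzero(1)[OF that, of p] by blast
    then show ?thesis
      unfolding mMR_def bialg.simps lincomb_def by (intro sum.neutral) auto
  qed
  ultimately show ?thesis
    unfolding bialg_closed_def by (auto simp: mMR_def tensor_def delta_def)
qed

lemma psi_hom: "bialg_hom mMR L_bialg psi psi_tensor"
proof -
  have "psi \<in> carr mMR \<rightarrow> carr L_bialg" "psi_tensor \<in> tcarr mMR \<rightarrow> tcarr L_bialg"
    using psi_image psi_tensor_image by auto
  moreover have "psi (add mMR f g) = add L_bialg (psi f) (psi g)" for f g
    by (simp add: mMR_def L_bialg_def psi_def lincomb_add[OF locally_finite_psi_word])
  moreover have "psi_tensor (tadd mMR S T) = tadd L_bialg (psi_tensor S) (psi_tensor T)" for S T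
    by (simp add: mMR_def L_bialg_def psi_tensor_def lincomb_add[OF locally_finite_psi_word2])
  moreover have "psi_tensor (tens mMR f g) = tens L_bialg (psi f) (psi g)" for f g
    by (simp add: mMR_def L_bialg_def psi_tens)
  moreover have "psi (mul mMR f g) = mul L_bialg (psi f) (psi g)" for f g
    by (simp add: psi_mul L_bialg_def)
  moreover have "psi (unt mMR n) = unt L_bialg n" for n
    by (simp add: psi_unt L_bialg_def)
  moreover have "psi_tensor (cop mMR f) = cop L_bialg (psi f)" for f
    by (simp add: psi_cop L_bialg_def)
  moreover have "cou mMR f = cou L_bialg (psi f)" for f
    by (simp add: mMR_def L_bialg_def psi_cou)
  ultimately show ?thesis
    unfolding bialg_hom_def by blast
qed

interpretation psi: surj_bialg_hom mMR L_bialg psi psi_tensor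
  by unfold_locales (rule mMR_closed psi_hom psi_image psi_tensor_image)+

lemma mQSym_eq: "mQSym = psi.Q"
  by (simp add: mQSym_def psi.Q_def I_rel_eq I_trel_eq)

theorem theorem5p11:
  shows
    "(locally_finite (mperms \<times> mperms) mMR_mul_word \<and>
      locally_finite mperms mMR_cop_word \<and>
      locally_finite mperms psi_word \<and>
      locally_finite (mperms \<times> mperms) (\<lambda>(w, u). tensor (psi_word w) (psi_word u)) \<and>
      locally_finite compositions Ltilde) \<and>
     bialg_closed mMR \<and> bialg_closed L_bialg \<and> bialg_closed mQSym \<and>
     bialg_hom mMR L_bialg psi psi_tensor \<and>
     bialg_iso mQSym L_bialg psi_quot psi_tensor_quot \<and>
     equiv (carr mMR) I_rel \<and> equiv (tcarr mMR) I_trel \<and>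
     (\<forall>f\<in>carr mMR. psi_quot (I_rel `` {f}) = psi f) \<and>
     (\<forall>T\<in>tcarr mMR. psi_tensor_quot (I_trel `` {T}) = psi_tensor T)"
proof (intro conjI ballI)
  show "bialg_iso mQSym L_bialg psi_quot psi_tensor_quot"
    using psi.quotient_iso by (simp add: mQSym_eq psi_quot_def[abs_def] psi_tensor_quot_def[abs_def])
  show "equiv (carr mMR) I_rel" "equiv (tcarr mMR) I_trel"
    by (simp_all add: I_rel_eq I_trel_eq equiv_kernel_rel)
  show "psi_quot (I_rel `` {f}) = psi f" if "f \<in> carr mMR" for f
    using that by (simp add: psi_quot_def I_rel_eq the_elem_kernel_class)
  show "psi_tensor_quot (I_trel `` {T}) = psi_tensor T" if "T \<in> tcarr mMR" for T
    using that by (simp add: psi_tensor_quot_def I_trel_eq the_elem_kernel_class)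
qed (simp_all add: locally_finite_mMR_mul_word locally_finite_mMR_cop_word locally_finite_psi_word
    locally_finite_psi_word2 locally_finite_Ltilde mMR_closed psi.target_closed psi_hom mQSym_eq
    psi.quotient_closed)

end
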